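(* Let $N$ be the once-punctured torus bundle over $S^1$ with monodromy $\varphi=\begin{pmatrix}-1&-2\\-2&-5\end{pmatrix}$, with $$\pi_1(N)=\left\langle a,b,t\ \middle|\ tat^{-1}=b^{-1}a^{-1}b^{-1},\ tbt^{-1}=ba\,(b^{-1}a^{-1}b^{-1})^3\right\rangle ,$$ and let $l=aba^{-1}b^{-1}$, so that $\{l,t\}$ is a basis of $\pi_1(\partial N)$. Let $X_0$ be an irreducible component of the $\mathrm{SL}(2,\mathbb C)$ character variety $X(N)$ which contains the character of a discrete faithful representation. Then $X_0$ is a curve birationally isomorphic to $\mathbb{CP}^1$, and it has exactly four ideal points. At each ideal point some peripheral element has a trace function with a pole; two of the ideal points have associated slope $\{t,t^{-1}\}$ and the other two have associated slope $\{lt,(lt)^{-1}\}$. The root of unity associated to each of the four ideal points is $\pm i$. In particular, $N$ is a hyperbolic 3-manifold having ideal points whose associated roots of unity are not $\pm1$.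
   Context: $N$ is regarded as a compact 3-manifold whose boundary is a torus; its interior carries a complete hyperbolic metric of finite volume. The generators $a,b$ generate the free group $\pi_1(F)$ of the once-punctured torus fiber $F$. For a compact 3-manifold $M$, $X(M)$ denotes its $\mathrm{SL}(2,\mathbb C)$ character variety (the set of characters of representations $\pi_1(M)\to\mathrm{SL}(2,\mathbb C)$), a complex affine algebraic set. For $\gamma\in\pi_1(M)$, $\mathrm{tr}_\gamma$ is the regular function on $X(M)$ whose value at the character of $\rho$ is $\mathrm{tr}(\rho(\gamma))$. Ideal points: if $X_0\subset X(M)$ is an irreducible curve, let $f:\widetilde X_0\to X_0$ be a birational map with $\widetilde X_0$ a smooth projective curve; the ideal points of $X_0$ are the points of $\widetilde X_0\setminus f^{-1}(X_0)$, i.e. the points of $\widetilde X_0$ at which some $\mathrm{tr}_\gamma$, viewed as a meromorphic function on $\widetilde X_0$, has a pole. Slopes and roots of unity: suppose $\partial M$ is a torus. A slope is a pair $\{\alpha,\alpha^{-1}\}$ of mutually inverse primitive elements of $\pi_1(\partial M)\cong\mathbb Z^2$. If $x$ is an ideal point at which $\mathrm{tr}_\delta$ has a pole for some peripheral $\delta\in\pi_1(\partial M)$, there is exactly one slope $\{\alpha,\alpha^{-1}\}$ with $\mathrm{tr}_\alpha(x)$ finite; it is called the slope associated to $x$ (it is the boundary slope of every incompressible surface associated to $x$). By a theorem of Cooper, Culler, Gillet, Long and Shalen, $\mathrm{tr}_\alpha(x)=\lambda+\lambda^{-1}$ for a root of unity $\lambda$, well defined up to inversion, called the root of unity associated to $x$.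 *)

theory Defs
  imports "HOL-Analysis.Analysis" "HOL-Algebra.Generated_Groups"
begin

section \<open>Finitely presented groups\<close>

text \<open>A letter \<open>(g, True)\<close> is the generator \<open>g\<close>, and \<open>(g, False)\<close> is its inverse.\<close>

type_synonym 'g word = "('g \<times> bool) list"

definition inv_word :: "'g word \<Rightarrow> 'g word" where
  "inv_word w = map (\<lambda>(g, e). (g, \<not> e)) (rev w)"

text \<open>Relations are pairs of words \<open>(u, v)\<close>, standing for \<open>u = v\<close>.\<close>

inductive word_eq :: "('g word \<times> 'g word) set \<Rightarrow> 'g word \<Rightarrow> 'g word \<Rightarrow> bool"
  for R where
  refl: "word_eq R u u"
| sym: "word_eq R u v \<Longrightarrow> word_eq R v u"
| trans: "word_eq R u v \<Longrightarrow> word_eq R v w \<Longrightarrow> word_eq R u w"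
| append: "word_eq R u v \<Longrightarrow> word_eq R u' v' \<Longrightarrow> word_eq R (u @ u') (v @ v')"
| cancel: "word_eq R [(g, e), (g, \<not> e)] []"
| relation: "(u, v) \<in> R \<Longrightarrow> word_eq R u v"

definition word_class :: "('g word \<times> 'g word) set \<Rightarrow> 'g word \<Rightarrow> 'g word set" where
  "word_class R w = {v. word_eq R w v}"

definition presented_group :: "('g word \<times> 'g word) set \<Rightarrow> 'g word set monoid" where
  "presented_group R =
     \<lparr>carrier = range (word_class R),
      mult = (\<lambda>U V. \<Union>u\<in>U. \<Union>v\<in>V. word_class R (u @ v)),
      one = word_class R []\<rparr>"

lemma word_class_eq_iff: "word_class R u = word_class R v \<longleftrightarrow> word_eq R u v"
  unfolding word_class_def by (blast intro: word_eq.intros)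

lemma presented_group_mult:
  "word_class R u \<otimes>\<^bsub>presented_group R\<^esub> word_class R v = word_class R (u @ v)"
proof -
  have *: "word_class R (u' @ v') = word_class R (u @ v)"
    if "u' \<in> word_class R u" "v' \<in> word_class R v" for u' v'
  proof -
    have "word_eq R u u'" "word_eq R v v'"
      using that by (simp_all add: word_class_def)
    then show ?thesis
      unfolding word_class_eq_iff by (intro word_eq.sym[OF word_eq.append])
  qed
  have "u \<in> word_class R u" "v \<in> word_class R v"
    by (auto simp: word_class_def intro: word_eq.refl)
  then have "(\<Union>u'\<in>word_class R u. \<Union>v'\<in>word_class R v. word_class R (u' @ v')) =
      word_class R (u @ v)"
    using * by blast
  then show ?thesis
    unfolding presented_group_def monoid.simps .
qed

lemma inv_word_left: "word_eq R (inv_word w @ w) []"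
proof (induction w)
  case Nil
  show ?case by (simp add: inv_word_def word_eq.refl)
next
  case (Cons x w)
  obtain g e where x: "x = (g, e)" by (cases x)
  have "word_eq R [(g, \<not> e), (g, e)] []"
    using word_eq.cancel[of R g "\<not> e"] by simp
  then have "word_eq R (inv_word w @ [(g, \<not> e), (g, e)] @ w) (inv_word w @ [] @ w)"
    by (intro word_eq.append word_eq.refl)
  then show ?case
    using Cons.IH by (auto simp: inv_word_def x intro: word_eq.trans)
qed

lemma group_presented_group: "group (presented_group R)"
proof (rule groupI)
  have carr: "carrier (presented_group R) = range (word_class R)"
    and one: "\<one>\<^bsub>presented_group R\<^esub> = word_class R []"
    by (simp_all add: presented_group_def)
  fix x assume "x \<in> carrier (presented_group R)"
  then obtain u where x: "x = word_class R u" unfolding carr by blast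
  show "\<one>\<^bsub>presented_group R\<^esub> \<otimes>\<^bsub>presented_group R\<^esub> x = x"
    by (simp add: one x presented_group_mult)
  have "word_class R (inv_word u) \<otimes>\<^bsub>presented_group R\<^esub> x = \<one>\<^bsub>presented_group R\<^esub>"
    by (simp add: one x presented_group_mult word_class_eq_iff inv_word_left)
  then show "\<exists>y\<in>carrier (presented_group R). y \<otimes>\<^bsub>presented_group R\<^esub> x = \<one>\<^bsub>presented_group R\<^esub>"
    unfolding carr by blast
  fix y assume "y \<in> carrier (presented_group R)"
  then obtain v where y: "y = word_class R v" unfolding carr by blast
  show "x \<otimes>\<^bsub>presented_group R\<^esub> y \<in> carrier (presented_group R)"
    by (simp add: carr x y presented_group_mult)
  fix z assume "z \<in> carrier (presented_group R)"
  then obtain w where z: "z = word_class R w" unfolding carr by blast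
  show "x \<otimes>\<^bsub>presented_group R\<^esub> y \<otimes>\<^bsub>presented_group R\<^esub> z =
        x \<otimes>\<^bsub>presented_group R\<^esub> (y \<otimes>\<^bsub>presented_group R\<^esub> z)"
    by (simp add: x y z presented_group_mult)
qed (simp add: presented_group_def)


section \<open>The group of the punctured torus bundle\<close>

text \<open>Conjugation by \<open>t\<close> sends \<open>a\<close>, \<open>b\<close> to words with exponent sums \<open>(-1, -2)\<close>, \<open>(-2, -5)\<close>
  in \<open>(a, b)\<close>, which are the columns of the monodromy matrix, and it fixes the boundary
  word \<open>aba\<^sup>-\<^sup>1b\<^sup>-\<^sup>1\<close> of the fibre in the free group on \<open>a\<close>, \<open>b\<close>.\<close>

datatype gen = Gen_a | Gen_b | Gen_t

definition wa :: "gen word" where "wa = [(Gen_a, True)]"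
definition wb :: "gen word" where "wb = [(Gen_b, True)]"
definition wt :: "gen word" where "wt = [(Gen_t, True)]"

definition bundle_relations :: "(gen word \<times> gen word) set" where
  "bundle_relations =
     (let u = inv_word wb @ inv_word wa @ inv_word wb in
      {(wt @ wa @ inv_word wt, u),
       (wt @ wb @ inv_word wt, wb @ wa @ u @ u @ u)})"

definition piN :: "gen word set monoid" where
  "piN = presented_group bundle_relations"

definition lN :: "gen word set" where
  "lN = word_class bundle_relations (wa @ wb @ inv_word wa @ inv_word wb)"

definition tN :: "gen word set" where
  "tN = word_class bundle_relations wt"

definition peripheralN :: "gen word set set" where
  "peripheralN = generate piN {lN, tN}"

lemma group_piN: "group piN"
  unfolding piN_def by (rule group_presented_group)


section \<open>Representations and characters\<close>

definition SL2C :: "(complex^2^2) monoid" where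
  "SL2C = \<lparr>carrier = {A. det A = 1}, mult = (**), one = mat 1\<rparr>"

lemma group_SL2C: "group SL2C"
proof (rule groupI)
  fix A assume "A \<in> carrier SL2C"
  then have A: "det A = 1" by (simp add: SL2C_def)
  then have "invertible A" by (simp add: invertible_det_nz)
  then obtain B where inv: "A ** B = mat 1" "B ** A = mat 1"
    by (auto simp: invertible_def)
  have "det B * det A = 1"
    using arg_cong[OF inv(2), of det] by (simp add: det_mul)
  with A have "det B = 1" by simp
  with inv show "\<exists>B\<in>carrier SL2C. B \<otimes>\<^bsub>SL2C\<^esub> A = \<one>\<^bsub>SL2C\<^esub>"
    by (auto simp: SL2C_def)
qed (auto simp: SL2C_def det_mul matrix_mul_assoc)

definition discrete_faithful :: "('g, 'm) monoid_scheme \<Rightarrow> ('g \<Rightarrow> complex^2^2) \<Rightarrow> bool" where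
  "discrete_faithful G \<rho> \<longleftrightarrow>
     \<rho> \<in> hom G SL2C \<and> inj_on \<rho> (carrier G) \<and> discrete (\<rho> ` carrier G)"

definition character :: "('g, 'm) monoid_scheme \<Rightarrow> ('g \<Rightarrow> complex^2^2) \<Rightarrow> 'g \<Rightarrow> complex" where
  "character G \<rho> = restrict (\<lambda>\<gamma>. trace (\<rho> \<gamma>)) (carrier G)"


section \<open>Spaces with functions\<close>

text \<open>A set with a Zariski topology and, for every open subset, its regular functions. A regular
  function on \<open>U\<close> is represented by every total function with the same values on \<open>U\<close>.\<close>

record 'p fspace =
  zar :: "'p topology"
  reg :: "'p set \<Rightarrow> ('p \<Rightarrow> complex) set"

abbreviation points :: "'p fspace \<Rightarrow> 'p set" where
  "points V \<equiv> topspace (zar V)"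

text \<open>The points \<open>X\<close>, with the topology generated by the sets \<open>q \<noteq> 0\<close> and with the functions
  which are locally of the form \<open>p / q\<close>, for \<open>(p, q)\<close> in a given set \<open>F\<close>.\<close>

definition fraction_space ::
    "'p set \<Rightarrow> (('p \<Rightarrow> complex) \<times> ('p \<Rightarrow> complex)) set \<Rightarrow> 'p fspace" where
  "fraction_space X F =
     (let T = topology_generated_by {{x \<in> X. q x \<noteq> 0} | p q. (p, q) \<in> F} in
      \<lparr>zar = T,
       reg = (\<lambda>U. {g. \<forall>x\<in>U. \<exists>(p, q)\<in>F. \<exists>W. openin T W \<and> x \<in> W \<and> W \<subseteq> U \<and>
                         (\<forall>y\<in>W. q y \<noteq> 0 \<and> g y = p y / q y)})\<rparr>)"

definition sub_fspace :: "'p fspace \<Rightarrow> 'p set \<Rightarrow> 'p fspace" where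
  "sub_fspace V S =
     \<lparr>zar = subtopology (zar V) S,
      reg = (\<lambda>U. {g. \<forall>x\<in>U. \<exists>W h. openin (zar V) W \<and> x \<in> W \<and> h \<in> reg V W \<and>
                        (\<forall>y\<in>W \<inter> U. g y = h y)})\<rparr>"

definition morphism :: "'p fspace \<Rightarrow> 'q fspace \<Rightarrow> ('p \<Rightarrow> 'q) \<Rightarrow> bool" where
  "morphism V W f \<longleftrightarrow>
     continuous_map (zar V) (zar W) f \<and>
     (\<forall>U g. openin (zar W) U \<and> g \<in> reg W U \<longrightarrow> g \<circ> f \<in> reg V {x \<in> points V. f x \<in> U})"

definition isomorphism :: "'p fspace \<Rightarrow> 'q fspace \<Rightarrow> ('p \<Rightarrow> 'q) \<Rightarrow> bool" where
  "isomorphism V W f \<longleftrightarrow>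
     morphism V W f \<and>
     (\<exists>g. morphism W V g \<and> (\<forall>x\<in>points V. g (f x) = x) \<and> (\<forall>y\<in>points W. f (g y) = y))"

text \<open>A birational map from \<open>V\<close> to \<open>W\<close>, represented by an isomorphism \<open>f\<close> from a nonempty open
  subset \<open>U\<close> of \<open>V\<close> onto an open subset of \<open>W\<close>; used for irreducible \<open>V\<close>, \<open>W\<close>.\<close>

definition birational_map :: "'p fspace \<Rightarrow> 'q fspace \<Rightarrow> 'p set \<Rightarrow> ('p \<Rightarrow> 'q) \<Rightarrow> bool" where
  "birational_map V W U f \<longleftrightarrow>
     openin (zar V) U \<and> U \<noteq> {} \<and> openin (zar W) (f ` U) \<and>
     isomorphism (sub_fspace V U) (sub_fspace W (f ` U)) f"

definition birational :: "'p fspace \<Rightarrow> 'q fspace \<Rightarrow> bool" where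
  "birational V W \<longleftrightarrow> (\<exists>U f. birational_map V W U f)"

definition irreducible_in :: "'p topology \<Rightarrow> 'p set \<Rightarrow> bool" where
  "irreducible_in T S \<longleftrightarrow>
     S \<subseteq> topspace T \<and> S \<noteq> {} \<and>
     (\<forall>C D. closedin T C \<and> closedin T D \<and> S \<subseteq> C \<union> D \<longrightarrow> S \<subseteq> C \<or> S \<subseteq> D)"

definition irreducible_component :: "'p fspace \<Rightarrow> 'p set \<Rightarrow> bool" where
  "irreducible_component V S \<longleftrightarrow>
     irreducible_in (zar V) S \<and> (\<forall>S'. irreducible_in (zar V) S' \<and> S \<subseteq> S' \<longrightarrow> S' = S)"

definition krull_dim :: "'p topology \<Rightarrow> enat" where
  "krull_dim T =
     Sup {enat n | n Z. (\<forall>i\<le>n. closedin T (Z i) \<and> irreducible_in T (Z i)) \<and>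
                        (\<forall>i<n. Z i \<subset> Z (Suc i))}"

definition irreducible_curve :: "'p fspace \<Rightarrow> 'p set \<Rightarrow> bool" where
  "irreducible_curve V C \<longleftrightarrow>
     closedin (zar V) C \<and> irreducible_in (zar V) C \<and> krull_dim (subtopology (zar V) C) = 1"

text \<open>The local ring at \<open>x\<close> of the curve \<open>V\<close> is regular, that is, its maximal ideal has one
  generator, the germ of \<open>u\<close>.\<close>

definition smooth_curve_at :: "'p fspace \<Rightarrow> 'p \<Rightarrow> bool" where
  "smooth_curve_at V x \<longleftrightarrow>
     (\<exists>U u. openin (zar V) U \<and> x \<in> U \<and> u \<in> reg V U \<and> u x = 0 \<and>
        (\<forall>W g. openin (zar V) W \<and> x \<in> W \<and> g \<in> reg V W \<and> g x = 0 \<longrightarrow>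
           (\<exists>W' h. openin (zar V) W' \<and> x \<in> W' \<and> W' \<subseteq> U \<inter> W \<and> h \<in> reg V W' \<and>
                   (\<forall>y\<in>W'. g y = u y * h y))))"

inductive_set generated_algebra :: "('p \<Rightarrow> complex) set \<Rightarrow> ('p \<Rightarrow> complex) set"
  for S where
  const: "(\<lambda>_. c) \<in> generated_algebra S"
| gen: "f \<in> S \<Longrightarrow> f \<in> generated_algebra S"
| add: "f \<in> generated_algebra S \<Longrightarrow> g \<in> generated_algebra S \<Longrightarrow>
          (\<lambda>x. f x + g x) \<in> generated_algebra S"
| mult: "f \<in> generated_algebra S \<Longrightarrow> g \<in> generated_algebra S \<Longrightarrow>
          (\<lambda>x. f x * g x) \<in> generated_algebra S"


section \<open>The character variety\<close>

text \<open>For finitely generated \<open>G\<close>, finitely many of the functions \<open>tr\<^sub>\<gamma>\<close> generate the algebra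
  below and separate characters, so that they embed this space as an affine algebraic set.\<close>

definition trace_algebra ::
    "('g, 'm) monoid_scheme \<Rightarrow> (('g \<Rightarrow> complex) \<Rightarrow> complex) set" where
  "trace_algebra G = generated_algebra ((\<lambda>\<gamma> ch. ch \<gamma>) ` carrier G)"

definition char_variety :: "('g, 'm) monoid_scheme \<Rightarrow> ('g \<Rightarrow> complex) fspace" where
  "char_variety G =
     fraction_space (character G ` hom G SL2C) (trace_algebra G \<times> trace_algebra G)"


section \<open>Projective space\<close>

text \<open>The projective space of \<open>\<complex>\<^sup>n\<close>, of dimension \<open>n - 1\<close>: a point is a line through the origin
  without the origin. A fraction of homogeneous polynomials of equal degree does not depend on the
  chosen representatives of the points.\<close>

definition homogeneous_poly :: "nat \<Rightarrow> (complex^'n \<Rightarrow> complex) \<Rightarrow> bool" where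
  "homogeneous_poly d p \<longleftrightarrow>
     p \<in> generated_algebra (range (\<lambda>i v. v $ i)) \<and> (\<forall>c v. p (c *s v) = c ^ d * p v)"

definition proj_points :: "(complex^'n) set set" where
  "proj_points = {{c *s v | c. c \<noteq> 0} | v. v \<noteq> 0}"

definition proj_rep :: "(complex^'n) set \<Rightarrow> complex^'n" where
  "proj_rep P = (SOME v. v \<in> P)"

definition proj_space :: "(complex^'n) set fspace" where
  "proj_space =
     fraction_space proj_points
       {(p \<circ> proj_rep, q \<circ> proj_rep) | p q. \<exists>d. homogeneous_poly d p \<and> homogeneous_poly d q}"

definition smooth_projective_curve :: "(complex^'n) set set \<Rightarrow> bool" where
  "smooth_projective_curve Y \<longleftrightarrow>
     irreducible_curve proj_space Y \<and> (\<forall>y\<in>Y. smooth_curve_at (sub_fspace proj_space Y) y)"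

text \<open>A smooth projective curve \<open>Y\<close> with a birational map \<open>f\<close> to the curve \<open>C\<close> in \<open>V\<close>.\<close>

definition smooth_model ::
    "'p fspace \<Rightarrow> 'p set \<Rightarrow> (complex^'n) set set \<Rightarrow> (complex^'n) set set \<Rightarrow>
     ((complex^'n) set \<Rightarrow> 'p) \<Rightarrow> bool" where
  "smooth_model V C Y U f \<longleftrightarrow>
     smooth_projective_curve Y \<and>
     birational_map (sub_fspace proj_space Y) (sub_fspace V C) U f"


section \<open>Ideal points, slopes and roots of unity\<close>

text \<open>The meromorphic function on \<open>V\<close> given by the regular function \<open>g\<close> on the nonempty open set
  \<open>U\<close> is regular at \<open>x\<close> with value \<open>c\<close>, respectively has a pole at \<open>x\<close>: its reciprocal is regular
  at \<open>x\<close> and vanishes there.\<close>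

definition has_value_at :: "'p fspace \<Rightarrow> 'p set \<Rightarrow> ('p \<Rightarrow> complex) \<Rightarrow> 'p \<Rightarrow> complex \<Rightarrow> bool" where
  "has_value_at V U g x c \<longleftrightarrow>
     (\<exists>W h. openin (zar V) W \<and> x \<in> W \<and> h \<in> reg V W \<and> h x = c \<and> (\<forall>y\<in>W \<inter> U. g y = h y))"

definition has_pole_at :: "'p fspace \<Rightarrow> 'p set \<Rightarrow> ('p \<Rightarrow> complex) \<Rightarrow> 'p \<Rightarrow> bool" where
  "has_pole_at V U g x \<longleftrightarrow>
     (\<exists>W h. openin (zar V) W \<and> x \<in> W \<and> h \<in> reg V W \<and> h x = 0 \<and> (\<forall>y\<in>W \<inter> U. h y * g y = 1))"

text \<open>In what follows \<open>G\<close> is the group and \<open>P\<close> its peripheral subgroup, and \<open>Y\<close>, \<open>U\<close>, \<open>f\<close> is a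
  smooth model of a curve of characters of \<open>G\<close>; the pullback of \<open>tr\<^sub>\<gamma>\<close> is \<open>\<lambda>y. f y \<gamma>\<close>.\<close>

definition trace_pole ::
    "(complex^'n) set set \<Rightarrow> (complex^'n) set set \<Rightarrow> ((complex^'n) set \<Rightarrow> 'g \<Rightarrow> complex) \<Rightarrow>
     (complex^'n) set \<Rightarrow> 'g \<Rightarrow> bool" where
  "trace_pole Y U f x \<gamma> \<longleftrightarrow> has_pole_at (sub_fspace proj_space Y) U (\<lambda>y. f y \<gamma>) x"

definition trace_value ::
    "(complex^'n) set set \<Rightarrow> (complex^'n) set set \<Rightarrow> ((complex^'n) set \<Rightarrow> 'g \<Rightarrow> complex) \<Rightarrow>
     (complex^'n) set \<Rightarrow> 'g \<Rightarrow> complex \<Rightarrow> bool" where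
  "trace_value Y U f x \<gamma> c \<longleftrightarrow> has_value_at (sub_fspace proj_space Y) U (\<lambda>y. f y \<gamma>) x c"

definition ideal_points ::
    "('g, 'm) monoid_scheme \<Rightarrow> (complex^'n) set set \<Rightarrow> (complex^'n) set set \<Rightarrow>
     ((complex^'n) set \<Rightarrow> 'g \<Rightarrow> complex) \<Rightarrow> (complex^'n) set set" where
  "ideal_points G Y U f = {x \<in> Y. \<exists>\<gamma>\<in>carrier G. trace_pole Y U f x \<gamma>}"

definition primitive_in :: "('g, 'm) monoid_scheme \<Rightarrow> 'g set \<Rightarrow> 'g \<Rightarrow> bool" where
  "primitive_in G P \<alpha> \<longleftrightarrow>
     \<alpha> \<in> P \<and> (\<forall>\<beta>\<in>P. \<forall>k::int. \<alpha> = \<beta> [^]\<^bsub>G\<^esub> k \<longrightarrow> \<bar>k\<bar> = 1)"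

definition slopes :: "('g, 'm) monoid_scheme \<Rightarrow> 'g set \<Rightarrow> 'g set set" where
  "slopes G P = {{\<alpha>, inv\<^bsub>G\<^esub> \<alpha>} | \<alpha>. primitive_in G P \<alpha>}"

definition associated_slope ::
    "('g, 'm) monoid_scheme \<Rightarrow> 'g set \<Rightarrow> (complex^'n) set set \<Rightarrow> (complex^'n) set set \<Rightarrow>
     ((complex^'n) set \<Rightarrow> 'g \<Rightarrow> complex) \<Rightarrow> (complex^'n) set \<Rightarrow> 'g set \<Rightarrow> bool" where
  "associated_slope G P Y U f x s \<longleftrightarrow>
     (\<exists>\<delta>\<in>P. trace_pole Y U f x \<delta>) \<and>
     {s' \<in> slopes G P. \<forall>\<alpha>\<in>s'. \<exists>c. trace_value Y U f x \<alpha> c} = {s}"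

definition associated_root ::
    "('g, 'm) monoid_scheme \<Rightarrow> 'g set \<Rightarrow> (complex^'n) set set \<Rightarrow> (complex^'n) set set \<Rightarrow>
     ((complex^'n) set \<Rightarrow> 'g \<Rightarrow> complex) \<Rightarrow> (complex^'n) set \<Rightarrow> complex \<Rightarrow> bool" where
  "associated_root G P Y U f x \<zeta> \<longleftrightarrow>
     (\<exists>n>0. \<zeta> ^ n = 1) \<and>
     (\<exists>s. associated_slope G P Y U f x s \<and>
          (\<forall>\<alpha>\<in>s. trace_value Y U f x \<alpha> (\<zeta> + inverse \<zeta>)))"

end

theory Submission
  imports Defs "HOL-Computational_Algebra.Polynomial"
begin

text \<open>
  Let \<open>x\<close>, \<open>y\<close>, \<open>z\<close> be the traces of \<open>a\<close>, \<open>b\<close>, \<open>ab\<close> under a representation of \<open>\<pi>\<^sub>1(N)\<close>. The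
  relations say that \<open>a\<close>, \<open>b\<close>, \<open>ab\<close> have the same traces as their images under the monodromy, which
  off \<open>{y = 0}\<close> gives \<open>y = 2x/z\<close> and the conic \<open>2x\<^sup>2 = z\<^sup>2 + 4\<close>. If moreover \<open>tr l \<noteq> 2\<close>, the traces of
  \<open>t\<close>, \<open>at\<close>, \<open>bt\<close>, \<open>abt\<close> are \<open>cz\<^sup>2/2\<close>, \<open>cx\<close>, \<open>c(xz - y)\<close>, \<open>cz\<close> with \<open>c = \<plusminus>i\<close>. A faithful
  representation has \<open>y \<noteq> 0\<close>, as otherwise \<open>b\<^sup>4 = 1\<close>, and \<open>tr l \<noteq> 2\<close>, as otherwise the commutators
  \<open>[a, b]\<close> and \<open>[a\<^sup>-\<^sup>1, b]\<close> commute. So \<open>X\<^sub>0\<close> is one of two curves, distinguished by \<open>c\<close>, and it is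
  parametrized by \<open>s \<noteq> 0, \<plusminus>1\<close> through \<open>z = s - 1/s\<close>, \<open>\<surd>2 x = s + 1/s\<close>.

  The ideal points are the points of the smooth model over \<open>s = 0, \<infinity>, 1, -1\<close>: there
  \<open>tr l = z\<^sup>2/2 + 8/z\<^sup>2 - 2\<close> has a pole, while \<open>tr t = cz\<^sup>2/2\<close> vanishes over \<open>s = \<plusminus>1\<close> and
  \<open>tr lt = 8c/z\<^sup>2\<close> vanishes over \<open>s = 0, \<infinity>\<close>; trace zero means that the root of unity is \<open>\<plusminus>i\<close>. That
  the smooth model has exactly one point over each value of \<open>s\<close> follows once \<open>s\<close> is known to have a
  value or a pole at every smooth point. This holds because two regular functions on the curve are
  algebraically dependent, so that orders with respect to a uniformizer are finite.
\<close>

section \<open>Spaces of fractions\<close>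

text \<open>The claim concerns every smooth model, in a projective space of any dimension, so
  nothing explicit is known about the points of \<open>Y\<close>. The only access is the rational
  map \<open>\<gamma>\<close> from the line, along which a regular function on a nonempty open set
  becomes a quotient of polynomials in \<open>s\<close> off a finite set. Every local question on
  \<open>Y\<close> is pushed through it to polynomials at one parameter value; infinity is reached
  by repeating everything with \<open>1 / s\<close>. The uniqueness of the slope is analytic.
  Commuting peripheral matrices share an eigenvector, so if \<open>m\<close> and
  \<open>l^p m^q\<close> with nonzero \<open>p\<close> had bounded traces near a parameter value,
  then so would \<open>l\<close>, which has a pole there. Seven traces of words in \<open>a\<close>,
  \<open>b\<close>, \<open>t\<close> determine a character. The equations obtained from the
  relations are linear in the traces involving \<open>t\<close>, with one exception, and this one
  leaves the two values of the scalar \<open>c\<close> of the overview. For a faithful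
  representation a relation between its matrices is a relation of the group and holds in every
  representation. Both degenerate pieces are excluded because the resulting relation fails in one
  explicit representation with numerical entries.\<close>

locale graded_functions =
  fixes H :: "nat \<Rightarrow> ('p \<Rightarrow> complex) set"
  assumes one: "(\<lambda>_. 1) \<in> H 0"
    and add: "f \<in> H d \<Longrightarrow> g \<in> H d \<Longrightarrow> (\<lambda>x. f x + g x) \<in> H d"
    and scale: "f \<in> H d \<Longrightarrow> (\<lambda>x. c * f x) \<in> H d"
    and mult: "f \<in> H d \<Longrightarrow> g \<in> H e \<Longrightarrow> (\<lambda>x. f x * g x) \<in> H (d + e)"

definition fractions :: "(nat \<Rightarrow> ('p \<Rightarrow> complex) set) \<Rightarrow> (('p \<Rightarrow> complex) \<times> ('p \<Rightarrow> complex)) set" where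
  "fractions H = (\<Union>d. H d \<times> H d)"

definition fraction_open :: "(nat \<Rightarrow> ('p \<Rightarrow> complex) set) \<Rightarrow> 'p set \<Rightarrow> 'p set \<Rightarrow> bool" where
  "fraction_open H S U \<longleftrightarrow>
     U \<subseteq> S \<and> (\<forall>x\<in>U. \<exists>d. \<exists>q\<in>H d. q x \<noteq> 0 \<and> {y \<in> S. q y \<noteq> 0} \<subseteq> U)"

text \<open>The open set of the definition of a regular function can be absorbed into the
  denominator.\<close>

definition fraction_regular :: "(nat \<Rightarrow> ('p \<Rightarrow> complex) set) \<Rightarrow> 'p set \<Rightarrow> ('p \<Rightarrow> complex) \<Rightarrow> bool" where
  "fraction_regular H A g \<longleftrightarrow>
     (\<forall>x\<in>A. \<exists>d. \<exists>p\<in>H d. \<exists>q\<in>H d. q x \<noteq> 0 \<and> (\<forall>y\<in>A. q y \<noteq> 0 \<longrightarrow> g y = p y / q y))"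

text \<open>Projective space and the character variety share this description: \<open>H d\<close>
  holds the forms of degree \<open>d\<close> in the first case and the whole trace algebra for every
  \<open>d\<close> in the second. It depends only on \<open>H\<close> and the set of points and
  passes to subspaces, so nested uses of \<open>sub_fspace\<close> need not be unfolded.\<close>

definition fraction_model :: "(nat \<Rightarrow> ('p \<Rightarrow> complex) set) \<Rightarrow> 'p fspace \<Rightarrow> 'p set \<Rightarrow> bool" where
  "fraction_model H V S \<longleftrightarrow>
     (\<forall>U. openin (zar V) U \<longleftrightarrow> fraction_open H S U) \<and>
     (\<forall>A g. openin (zar V) A \<longrightarrow> (g \<in> reg V A \<longleftrightarrow> fraction_regular H A g))"

lemma fraction_modelD:
  assumes "fraction_model H V S"
  shows "openin (zar V) U \<longleftrightarrow> fraction_open H S U"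
    and "openin (zar V) A \<Longrightarrow> g \<in> reg V A \<longleftrightarrow> fraction_regular H A g"
  using assms by (auto simp: fraction_model_def)

lemma zar_sub_fspace [simp]: "zar (sub_fspace V S) = subtopology (zar V) S"
  by (simp add: sub_fspace_def)

lemma reg_sub_fspace:
  "g \<in> reg (sub_fspace V S) A \<longleftrightarrow>
     (\<forall>x\<in>A. \<exists>W h. openin (zar V) W \<and> x \<in> W \<and> h \<in> reg V W \<and> (\<forall>y\<in>W \<inter> A. g y = h y))"
  by (simp add: sub_fspace_def)

lemma openin_topology_generated_by_basis:
  assumes int: "\<And>a b. a \<in> B \<Longrightarrow> b \<in> B \<Longrightarrow> a \<inter> b \<in> B"
  shows "openin (topology_generated_by B) U \<longleftrightarrow> (\<forall>x\<in>U. \<exists>b\<in>B. x \<in> b \<and> b \<subseteq> U)"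
proof
  assume "openin (topology_generated_by B) U"
  then have "generate_topology_on B U" by (simp add: openin_topology_generated_by_iff)
  then show "\<forall>x\<in>U. \<exists>b\<in>B. x \<in> b \<and> b \<subseteq> U"
  proof induction
    case (Int a b)
    show ?case
    proof
      fix x assume "x \<in> a \<inter> b"
      then obtain c d where "c \<in> B" "x \<in> c" "c \<subseteq> a" "d \<in> B" "x \<in> d" "d \<subseteq> b"
        using Int.IH by blast
      then show "\<exists>e\<in>B. x \<in> e \<and> e \<subseteq> a \<inter> b"
        by (intro bexI[of _ "c \<inter> d"] int) auto
    qed
  next
    case (UN K)
    show ?case
    proof
      fix x assume "x \<in> \<Union>K"
      then obtain k where k: "k \<in> K" "x \<in> k" by blast
      with UN.IH obtain b where "b \<in> B" "x \<in> b" "b \<subseteq> k" by blast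
      then show "\<exists>b\<in>B. x \<in> b \<and> b \<subseteq> \<Union>K" using k(1) by blast
    qed
  qed auto
next
  assume *: "\<forall>x\<in>U. \<exists>b\<in>B. x \<in> b \<and> b \<subseteq> U"
  have "openin (topology_generated_by B) (\<Union>{b \<in> B. b \<subseteq> U})"
    by (intro openin_Union) (auto intro: topology_generated_by_Basis)
  moreover have "\<Union>{b \<in> B. b \<subseteq> U} = U" using * by blast
  ultimately show "openin (topology_generated_by B) U" by simp
qed

context graded_functions
begin

lemma const: "(\<lambda>_. c) \<in> H 0"
  using scale[OF one, of c] by simp

lemma zero: "f \<in> H d \<Longrightarrow> (\<lambda>_. 0) \<in> H d"
  using scale[of f d 0] by simp

lemma power: "f \<in> H d \<Longrightarrow> (\<lambda>x. f x ^ n) \<in> H (n * d)"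
  by (induction n) (auto simp: one dest: mult)

lemma openin_fraction_space:
  "openin (topology_generated_by {{x \<in> X. q x \<noteq> 0} | p q. (p, q) \<in> fractions H}) U
     \<longleftrightarrow> fraction_open H X U"
proof -
  define B where "B = {{x \<in> X. q x \<noteq> 0} | p q. (p, q) \<in> fractions H}"
  have mem: "b \<in> B \<longleftrightarrow> (\<exists>d. \<exists>q\<in>H d. b = {x \<in> X. q x \<noteq> 0})" for b
    by (auto simp: fractions_def B_def)
  have "a \<inter> b \<in> B" if "a \<in> B" "b \<in> B" for a b
  proof -
    obtain d q where "q \<in> H d" "a = {x \<in> X. q x \<noteq> 0}"
      using \<open>a \<in> B\<close> unfolding mem by blast
    moreover obtain e r where "r \<in> H e" "b = {x \<in> X. r x \<noteq> 0}"
      using \<open>b \<in> B\<close> unfolding mem by blast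
    \<comment> \<open>Two basic sets meet in the basic set of the product of their functions, whose
      degrees add.\<close>
    ultimately show ?thesis
      unfolding mem by (intro exI[of _ "d + e"] bexI[OF _ mult[of q d r e]]) auto
  qed
  then have "openin (topology_generated_by B) U \<longleftrightarrow> (\<forall>x\<in>U. \<exists>b\<in>B. x \<in> b \<and> b \<subseteq> U)"
    by (intro openin_topology_generated_by_basis)
  also have "\<dots> \<longleftrightarrow> fraction_open H X U"
  proof
    assume L: "\<forall>x\<in>U. \<exists>b\<in>B. x \<in> b \<and> b \<subseteq> U"
    have "x \<in> X \<and> (\<exists>d. \<exists>q\<in>H d. q x \<noteq> 0 \<and> {y \<in> X. q y \<noteq> 0} \<subseteq> U)" if x: "x \<in> U" for x
    proof -
      obtain b where b: "b \<in> B" "x \<in> b" "b \<subseteq> U" using L x by blast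
      obtain d q where "q \<in> H d" "b = {x \<in> X. q x \<noteq> 0}" using b(1) unfolding mem by blast
      with b(2,3) show ?thesis by auto
    qed
    then show "fraction_open H X U" unfolding fraction_open_def by blast
  next
    assume R: "fraction_open H X U"
    show "\<forall>x\<in>U. \<exists>b\<in>B. x \<in> b \<and> b \<subseteq> U"
    proof
      fix x assume x: "x \<in> U"
      obtain d q where q: "q \<in> H d" "q x \<noteq> 0" "{y \<in> X. q y \<noteq> 0} \<subseteq> U"
        using R x unfolding fraction_open_def by meson
      have "x \<in> X" using R x unfolding fraction_open_def by blast
      then show "\<exists>b\<in>B. x \<in> b \<and> b \<subseteq> U"
        using q by (intro bexI[of _ "{y \<in> X. q y \<noteq> 0}"] iffD2[OF mem]) blast+
    qed
  qed
  finally show ?thesis unfolding B_def .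
qed

lemma fraction_model_fraction_space: "fraction_model H (fraction_space X (fractions H)) X"
proof -
  let ?V = "fraction_space X (fractions H)"
  let ?T = "topology_generated_by {{x \<in> X. q x \<noteq> 0} | p q. (p, q) \<in> fractions H}"
  have zar: "zar ?V = ?T" and reg: "reg ?V A = {g. \<forall>x\<in>A. \<exists>(p,q)\<in>fractions H. \<exists>W. openin ?T W \<and>
      x \<in> W \<and> W \<subseteq> A \<and> (\<forall>y\<in>W. q y \<noteq> 0 \<and> g y = p y / q y)}" for A
    by (simp_all add: fraction_space_def Let_def)
  have "g \<in> reg ?V A \<longleftrightarrow> fraction_regular H A g" if A: "fraction_open H X A" for A g
  proof
    assume g: "g \<in> reg ?V A"
    show "fraction_regular H A g"
      unfolding fraction_regular_def
    proof
      fix x assume x: "x \<in> A"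
      obtain pq W where pq': "pq \<in> fractions H" and W: "fraction_open H X W" "x \<in> W" "W \<subseteq> A"
        and eq': "case pq of (p, q) \<Rightarrow> \<forall>y\<in>W. q y \<noteq> 0 \<and> g y = p y / q y"
        using g x unfolding reg openin_fraction_space mem_Collect_eq case_prod_beta by meson
      obtain d p q where pq: "p \<in> H d" "q \<in> H d" and eq: "\<forall>y\<in>W. q y \<noteq> 0 \<and> g y = p y / q y"
        using pq' eq' unfolding fractions_def by auto
      obtain e r where r: "r \<in> H e" "r x \<noteq> 0" "{y \<in> X. r y \<noteq> 0} \<subseteq> W"
        using W unfolding fraction_open_def by blast
      \<comment> \<open>Multiplying by \<open>r\<close> makes the denominator vanish outside
        \<open>W\<close>, so the equation is asserted only inside \<open>W\<close>.\<close>
      have "\<forall>y\<in>A. q y * r y \<noteq> 0 \<longrightarrow> g y = (p y * r y) / (q y * r y)"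
        using r eq A by (auto simp: fraction_open_def)
      then show "\<exists>d. \<exists>p\<in>H d. \<exists>q\<in>H d. q x \<noteq> 0 \<and> (\<forall>y\<in>A. q y \<noteq> 0 \<longrightarrow> g y = p y / q y)"
        using eq W r by (intro exI[of _ "d + e"] bexI[OF _ mult[OF pq(1) r(1)]] bexI[OF _ mult[OF pq(2) r(1)]]) auto
    qed
  next
    assume g: "fraction_regular H A g"
    show "g \<in> reg ?V A"
      unfolding reg openin_fraction_space mem_Collect_eq
    proof
      fix x assume x: "x \<in> A"
      obtain d p q where pq: "p \<in> H d" "q \<in> H d" "q x \<noteq> 0"
        and eq: "\<forall>y\<in>A. q y \<noteq> 0 \<longrightarrow> g y = p y / q y"
        using g x unfolding fraction_regular_def by blast
      obtain e r where r: "r \<in> H e" "r x \<noteq> 0" "{y \<in> X. r y \<noteq> 0} \<subseteq> A"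
        using A x unfolding fraction_open_def by blast
      have "fraction_open H X {y \<in> X. q y * r y \<noteq> 0}"
        unfolding fraction_open_def by (intro conjI ballI exI[of _ "d + e"] bexI[OF _ mult[OF pq(2) r(1)]]) auto
      moreover have "x \<in> X" using A x by (auto simp: fraction_open_def)
      ultimately show "\<exists>(p, q)\<in>fractions H. \<exists>W. fraction_open H X W \<and> x \<in> W \<and> W \<subseteq> A \<and>
          (\<forall>y\<in>W. q y \<noteq> 0 \<and> g y = p y / q y)"
        using pq eq r
        by (intro bexI[of _ "(p, q)"]) (auto simp: fractions_def intro!: exI[of _ "{y \<in> X. q y * r y \<noteq> 0}"])
    qed
  qed
  then show ?thesis
    unfolding fraction_model_def zar openin_fraction_space by blast
qed

text \<open>Both directions shrink to a basic set. An ambient neighbourhood is absorbed into the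
  denominator; conversely \<open>p / q\<close> is regular on the whole ambient set where
  \<open>q\<close> does not vanish, not only on the subspace.\<close>

lemma fraction_model_sub_fspace:
  assumes V: "fraction_model H V S"
  shows "fraction_model H (sub_fspace V S') (S \<inter> S')"
proof -
  note openV = fraction_modelD(1)[OF V] and regV = fraction_modelD(2)[OF V]
  have basic: "fraction_open H S {y \<in> S. q y \<noteq> 0}" if "q \<in> H d" for q d
    using that unfolding fraction_open_def by blast
  have "openin (zar (sub_fspace V S')) U \<longleftrightarrow> fraction_open H (S \<inter> S') U" for U
  proof
    assume "openin (zar (sub_fspace V S')) U"
    then obtain O' where O': "fraction_open H S O'" "U = O' \<inter> S'"
      unfolding zar_sub_fspace openin_subtopology openV by blast
    have "\<exists>d. \<exists>q\<in>H d. q x \<noteq> 0 \<and> {y \<in> S \<inter> S'. q y \<noteq> 0} \<subseteq> U" if x: "x \<in> U" for x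
    proof -
      obtain d q where "q \<in> H d" "q x \<noteq> 0" "{y \<in> S. q y \<noteq> 0} \<subseteq> O'"
        using O' x unfolding fraction_open_def by blast
      then show ?thesis using O'(2) x by blast
    qed
    then show "fraction_open H (S \<inter> S') U"
      using O' unfolding fraction_open_def by blast
  next
    assume U: "fraction_open H (S \<inter> S') U"
    define O' where "O' = \<Union>{b. \<exists>d. \<exists>q\<in>H d. b = {y \<in> S. q y \<noteq> 0} \<and> b \<inter> S' \<subseteq> U}"
    have "openin (zar V) O'"
      unfolding O'_def by (intro openin_Union) (auto simp: openV basic)
    moreover have "U = O' \<inter> S'"
    proof
      show "U \<subseteq> O' \<inter> S'"
      proof
        fix x assume x: "x \<in> U"
        obtain d q where q: "q \<in> H d" "q x \<noteq> 0" "{y \<in> S \<inter> S'. q y \<noteq> 0} \<subseteq> U"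
          using U x unfolding fraction_open_def by blast
        have "{y \<in> S. q y \<noteq> 0} \<subseteq> O'" using q unfolding O'_def by blast
        then show "x \<in> O' \<inter> S'" using x q U unfolding fraction_open_def by blast
      qed
      show "O' \<inter> S' \<subseteq> U" unfolding O'_def by blast
    qed
    ultimately show "openin (zar (sub_fspace V S')) U"
      unfolding zar_sub_fspace openin_subtopology by blast
  qed
  moreover have "g \<in> reg (sub_fspace V S') A \<longleftrightarrow> fraction_regular H A g"
    if A: "fraction_open H (S \<inter> S') A" for A g
  proof
    assume g: "g \<in> reg (sub_fspace V S') A"
    show "fraction_regular H A g"
      unfolding fraction_regular_def
    proof
      fix x assume x: "x \<in> A"
      obtain W h where W: "openin (zar V) W" "x \<in> W" "h \<in> reg V W" "\<forall>y\<in>W \<inter> A. g y = h y"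
        using g x unfolding reg_sub_fspace by blast
      have "fraction_regular H W h" using W regV by blast
      then obtain d p q where pq: "p \<in> H d" "q \<in> H d" "q x \<noteq> 0"
        and eq: "\<forall>y\<in>W. q y \<noteq> 0 \<longrightarrow> h y = p y / q y"
        using W(2) unfolding fraction_regular_def by blast
      obtain e r where r: "r \<in> H e" "r x \<noteq> 0" "{y \<in> S. r y \<noteq> 0} \<subseteq> W"
        using W(1,2) unfolding openV fraction_open_def by blast
      have "\<forall>y\<in>A. q y * r y \<noteq> 0 \<longrightarrow> g y = (p y * r y) / (q y * r y)"
        using r eq A W(4) by (auto simp: fraction_open_def)
      then show "\<exists>d. \<exists>p\<in>H d. \<exists>q\<in>H d. q x \<noteq> 0 \<and> (\<forall>y\<in>A. q y \<noteq> 0 \<longrightarrow> g y = p y / q y)"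
        using pq r by (intro exI[of _ "d + e"] bexI[OF _ mult[OF pq(1) r(1)]] bexI[OF _ mult[OF pq(2) r(1)]]) auto
    qed
  next
    assume g: "fraction_regular H A g"
    have "\<exists>W h. openin (zar V) W \<and> x \<in> W \<and> h \<in> reg V W \<and> (\<forall>y\<in>W \<inter> A. g y = h y)" if x: "x \<in> A" for x
    proof -
      obtain d p q where pq: "p \<in> H d" "q \<in> H d" "q x \<noteq> 0"
        and eq: "\<forall>y\<in>A. q y \<noteq> 0 \<longrightarrow> g y = p y / q y"
        using g x unfolding fraction_regular_def by blast
      have "fraction_regular H {y \<in> S. q y \<noteq> 0} (\<lambda>y. p y / q y)"
        unfolding fraction_regular_def using pq by blast
      then have "(\<lambda>y. p y / q y) \<in> reg V {y \<in> S. q y \<noteq> 0}"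
        using regV basic[OF pq(2)] openV by blast
      then show ?thesis
        using pq eq A x basic[OF pq(2)] openV
        by (intro exI[of _ "{y \<in> S. q y \<noteq> 0}"] exI[of _ "\<lambda>y. p y / q y"])
          (auto simp: fraction_open_def)
    qed
    then show "g \<in> reg (sub_fspace V S') A"
      unfolding reg_sub_fspace by blast
  qed
  ultimately show ?thesis
    unfolding fraction_model_def by blast
qed

end

locale fraction_fspace = graded_functions H for H :: "nat \<Rightarrow> ('p \<Rightarrow> complex) set" +
  fixes V :: "'p fspace" and S :: "'p set"
  assumes model: "fraction_model H V S"
begin

lemmas openin_iff = fraction_modelD(1)[OF model]
lemmas reg_iff = fraction_modelD(2)[OF model]

lemma openin_basic: "q \<in> H d \<Longrightarrow> openin (zar V) {y \<in> S. q y \<noteq> 0}"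
  unfolding openin_iff fraction_open_def by blast

lemma openin_basic_nbhd:
  "openin (zar V) U \<Longrightarrow> x \<in> U \<Longrightarrow> \<exists>d. \<exists>q\<in>H d. q x \<noteq> 0 \<and> {y \<in> S. q y \<noteq> 0} \<subseteq> U"
  unfolding openin_iff fraction_open_def by blast

lemma points_eq: "points V = S"
proof
  show "points V \<subseteq> S"
    using openin_topspace[of "zar V"] unfolding openin_iff fraction_open_def by blast
  show "S \<subseteq> points V"
    using openin_subset[OF openin_basic[OF one]] by simp
qed

lemma openin_subset_S: "openin (zar V) U \<Longrightarrow> U \<subseteq> S"
  unfolding openin_iff fraction_open_def by blast

lemma regE:
  assumes "g \<in> reg V A" "openin (zar V) A" "x \<in> A"
  obtains d p q where "p \<in> H d" "q \<in> H d" "q x \<noteq> 0" "\<And>y. y \<in> A \<Longrightarrow> q y \<noteq> 0 \<Longrightarrow> g y = p y / q y"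
  using assms reg_iff[OF assms(2)] unfolding fraction_regular_def by blast

lemma regI:
  assumes "openin (zar V) A"
    and "\<And>x. x \<in> A \<Longrightarrow> \<exists>d. \<exists>p\<in>H d. \<exists>q\<in>H d. q x \<noteq> 0 \<and> (\<forall>y\<in>A. q y \<noteq> 0 \<longrightarrow> g y = p y / q y)"
  shows "g \<in> reg V A"
  using assms reg_iff[OF assms(1)] unfolding fraction_regular_def by blast

lemma reg_quotient:
  assumes "p \<in> H d" "q \<in> H d" "openin (zar V) A" "\<And>y. y \<in> A \<Longrightarrow> q y \<noteq> 0"
  shows "(\<lambda>y. p y / q y) \<in> reg V A"
  using assms(3)
proof (rule regI)
  fix x assume "x \<in> A"
  then show "\<exists>d. \<exists>p'\<in>H d. \<exists>q'\<in>H d. q' x \<noteq> 0 \<and> (\<forall>y\<in>A. q' y \<noteq> 0 \<longrightarrow> p y / q y = p' y / q' y)"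
    using assms by (intro exI[of _ d] bexI[of _ p] bexI[of _ q]) auto
qed

lemma reg_const: "openin (zar V) A \<Longrightarrow> (\<lambda>_. c) \<in> reg V A"
  using reg_quotient[OF const[of c] one] by simp

lemma reg_restrict:
  assumes "g \<in> reg V A" "openin (zar V) A" "openin (zar V) B" "B \<subseteq> A"
  shows "g \<in> reg V B"
  using assms(3)
proof (rule regI)
  fix x assume "x \<in> B"
  then have "x \<in> A" using assms(4) by blast
  with assms(1,2) obtain d p q where "p \<in> H d" "q \<in> H d" "q x \<noteq> 0"
    "\<And>y. y \<in> A \<Longrightarrow> q y \<noteq> 0 \<Longrightarrow> g y = p y / q y" by (rule regE) blast
  then show "\<exists>d. \<exists>p\<in>H d. \<exists>q\<in>H d. q x \<noteq> 0 \<and> (\<forall>y\<in>B. q y \<noteq> 0 \<longrightarrow> g y = p y / q y)"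
    using assms(4) by (intro exI[of _ d] bexI[of _ p] bexI[of _ q]) auto
qed

lemma reg_add:
  assumes "g \<in> reg V A" "h \<in> reg V A" "openin (zar V) A"
  shows "(\<lambda>y. g y + h y) \<in> reg V A"
  using assms(3)
proof (rule regI)
  fix x assume x: "x \<in> A"
  from assms(1,3) x obtain d p q where 1: "p \<in> H d" "q \<in> H d" "q x \<noteq> 0"
    "\<And>y. y \<in> A \<Longrightarrow> q y \<noteq> 0 \<Longrightarrow> g y = p y / q y" by (rule regE) blast
  from assms(2,3) x obtain e r s where 2: "r \<in> H e" "s \<in> H e" "s x \<noteq> 0"
    "\<And>y. y \<in> A \<Longrightarrow> s y \<noteq> 0 \<Longrightarrow> h y = r y / s y" by (rule regE) blast
  have "(\<lambda>y. p y * s y + q y * r y) \<in> H (d + e)"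
    by (intro add mult 1 2)
  with 1 2 mult[OF 1(2) 2(2)]
  show "\<exists>d. \<exists>p\<in>H d. \<exists>q\<in>H d. q x \<noteq> 0 \<and> (\<forall>y\<in>A. q y \<noteq> 0 \<longrightarrow> g y + h y = p y / q y)"
    by (intro exI[of _ "d + e"] bexI[of _ "\<lambda>y. p y * s y + q y * r y"] bexI[of _ "\<lambda>y. q y * s y"])
      (auto simp: field_simps)
qed

lemma reg_mult:
  assumes "g \<in> reg V A" "h \<in> reg V A" "openin (zar V) A"
  shows "(\<lambda>y. g y * h y) \<in> reg V A"
  using assms(3)
proof (rule regI)
  fix x assume x: "x \<in> A"
  from assms(1,3) x obtain d p q where 1: "p \<in> H d" "q \<in> H d" "q x \<noteq> 0"
    "\<And>y. y \<in> A \<Longrightarrow> q y \<noteq> 0 \<Longrightarrow> g y = p y / q y" by (rule regE) blast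
  from assms(2,3) x obtain e r s where 2: "r \<in> H e" "s \<in> H e" "s x \<noteq> 0"
    "\<And>y. y \<in> A \<Longrightarrow> s y \<noteq> 0 \<Longrightarrow> h y = r y / s y" by (rule regE) blast
  from 1 2 mult[OF 1(2) 2(2)] mult[OF 1(1) 2(1)]
  show "\<exists>d. \<exists>p\<in>H d. \<exists>q\<in>H d. q x \<noteq> 0 \<and> (\<forall>y\<in>A. q y \<noteq> 0 \<longrightarrow> g y * h y = p y / q y)"
    by (intro exI[of _ "d + e"] bexI[of _ "\<lambda>y. p y * r y"] bexI[of _ "\<lambda>y. q y * s y"]) auto
qed

lemma reg_inverse:
  assumes "g \<in> reg V A" "openin (zar V) A" "\<And>x. x \<in> A \<Longrightarrow> g x \<noteq> 0"
  shows "(\<lambda>y. inverse (g y)) \<in> reg V A"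
  using assms(2)
proof (rule regI)
  fix x assume x: "x \<in> A"
  from assms(1,2) x obtain d p q where 1: "p \<in> H d" "q \<in> H d" "q x \<noteq> 0"
    "\<And>y. y \<in> A \<Longrightarrow> q y \<noteq> 0 \<Longrightarrow> g y = p y / q y" by (rule regE) blast
  then have "p x \<noteq> 0" using assms(3)[OF x] x by force
  with 1 mult[OF 1(2) 1(2)] mult[OF 1(1) 1(2)]
  show "\<exists>d. \<exists>p\<in>H d. \<exists>q\<in>H d. q x \<noteq> 0 \<and> (\<forall>y\<in>A. q y \<noteq> 0 \<longrightarrow> inverse (g y) = p y / q y)"
    by (intro exI[of _ "d + d"] bexI[of _ "\<lambda>y. q y * q y"] bexI[of _ "\<lambda>y. p y * q y"]) auto
qed

lemma reg_power: "g \<in> reg V A \<Longrightarrow> openin (zar V) A \<Longrightarrow> (\<lambda>y. g y ^ n) \<in> reg V A"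
  by (induction n) (auto intro: reg_const reg_mult)

lemma reg_sum:
  assumes "openin (zar V) A" "\<And>i. i \<in> I \<Longrightarrow> g i \<in> reg V A"
  shows "(\<lambda>y. \<Sum>i\<in>I. g i y) \<in> reg V A"
  using assms(2) by (induction I rule: infinite_finite_induct) (auto intro: reg_const reg_add assms(1))

lemma reg_scale: "g \<in> reg V A \<Longrightarrow> openin (zar V) A \<Longrightarrow> (\<lambda>y. c * g y) \<in> reg V A"
  by (intro reg_mult reg_const)

lemma reg_diff: "g \<in> reg V A \<Longrightarrow> h \<in> reg V A \<Longrightarrow> openin (zar V) A \<Longrightarrow> (\<lambda>y. g y - h y) \<in> reg V A"
  using reg_add[OF _ reg_scale[of h A "-1"], of g] by simp

lemma reg_poly: "g \<in> reg V A \<Longrightarrow> openin (zar V) A \<Longrightarrow> (\<lambda>y. poly p (g y)) \<in> reg V A"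
  by (induction p) (auto intro!: reg_const reg_add reg_mult)

lemma openin_nonzero:
  assumes "g \<in> reg V A" "openin (zar V) A"
  shows "openin (zar V) {y \<in> A. g y \<noteq> 0}"
proof -
  have AS: "A \<subseteq> S" using assms openin_subset_S by blast
  have "\<exists>d. \<exists>q\<in>H d. q x \<noteq> 0 \<and> {y \<in> S. q y \<noteq> 0} \<subseteq> {y \<in> A. g y \<noteq> 0}" if x: "x \<in> A" "g x \<noteq> 0" for x
  proof -
    from assms x(1) obtain d p q where 1: "p \<in> H d" "q \<in> H d" "q x \<noteq> 0"
      "\<And>y. y \<in> A \<Longrightarrow> q y \<noteq> 0 \<Longrightarrow> g y = p y / q y" by (rule regE) blast
    obtain e r where 2: "r \<in> H e" "r x \<noteq> 0" "{y \<in> S. r y \<noteq> 0} \<subseteq> A"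
      using openin_basic_nbhd[OF assms(2) x(1)] by blast
    have "p x \<noteq> 0" using 1 x by force
    then show ?thesis
      using 1 2 AS by (intro exI[of _ "d + d + e"] bexI[OF _ mult[OF mult[OF 1(1,2)] 2(1)]]) auto
  qed
  then show ?thesis using AS unfolding openin_iff fraction_open_def by blast
qed

lemma sub_fraction_fspace: "fraction_fspace H (sub_fspace V S') (S \<inter> S')"
  by unfold_locales (rule fraction_model_sub_fspace[OF model])

end

text \<open>Open sets and regular functions are both made of fractions, so it suffices to pull
  fractions back to fractions whose denominators have the right zeros. The degree \<open>e\<close>
  may differ from \<open>d\<close>.\<close>

lemma morphismI:
  assumes V: "fraction_fspace H V S" and V': "fraction_fspace H' V' S'"
    and fS: "\<And>x. x \<in> S \<Longrightarrow> f x \<in> S'"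
    and pull: "\<And>d p q. p \<in> H' d \<Longrightarrow> q \<in> H' d \<Longrightarrow> \<exists>e. \<exists>p'\<in>H e. \<exists>q'\<in>H e. \<forall>x\<in>S.
      (q (f x) \<noteq> 0 \<longleftrightarrow> q' x \<noteq> 0) \<and> (q' x \<noteq> 0 \<longrightarrow> p (f x) / q (f x) = p' x / q' x)"
  shows "morphism V V' f"
proof -
  interpret V: fraction_fspace H V S by fact
  interpret V': fraction_fspace H' V' S' by fact
  have pre: "openin (zar V) {x \<in> S. f x \<in> U}" if U: "openin (zar V') U" for U
    unfolding V.openin_iff fraction_open_def
  proof safe
    fix x assume x: "x \<in> S" "f x \<in> U"
    obtain d q where q: "q \<in> H' d" "q (f x) \<noteq> 0" "{y \<in> S'. q y \<noteq> 0} \<subseteq> U"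
      using V'.openin_basic_nbhd[OF U x(2)] by blast
    obtain e q' where "q' \<in> H e" "\<forall>x\<in>S. (q (f x) \<noteq> 0 \<longleftrightarrow> q' x \<noteq> 0)"
      using pull[OF q(1) q(1)] by blast
    then show "\<exists>d. \<exists>q\<in>H d. q x \<noteq> 0 \<and> {y \<in> S. q y \<noteq> 0} \<subseteq> {x \<in> S. f x \<in> U}"
      using q x fS by (intro exI bexI[of _ q']) auto
  qed
  have reg: "g \<circ> f \<in> reg V {x \<in> S. f x \<in> U}" if U: "openin (zar V') U" and g: "g \<in> reg V' U" for U g
    using pre[OF U]
  proof (rule V.regI)
    fix x assume x: "x \<in> {x \<in> S. f x \<in> U}"
    then have "f x \<in> U" by blast
    with g U obtain d p q where pq: "p \<in> H' d" "q \<in> H' d" "q (f x) \<noteq> 0"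
      "\<And>y. y \<in> U \<Longrightarrow> q y \<noteq> 0 \<Longrightarrow> g y = p y / q y" by (rule V'.regE) blast
    obtain e p' q' where "p' \<in> H e" "q' \<in> H e" "\<forall>x\<in>S.
      (q (f x) \<noteq> 0 \<longleftrightarrow> q' x \<noteq> 0) \<and> (q' x \<noteq> 0 \<longrightarrow> p (f x) / q (f x) = p' x / q' x)"
      using pull[OF pq(1,2)] by blast
    then show "\<exists>d. \<exists>p\<in>H d. \<exists>q\<in>H d. q x \<noteq> 0 \<and>
        (\<forall>y\<in>{x \<in> S. f x \<in> U}. q y \<noteq> 0 \<longrightarrow> (g \<circ> f) y = p y / q y)"
      using pq x by (intro exI bexI[of _ p'] bexI[of _ q']) auto
  qed
  show ?thesis
    unfolding morphism_def continuous_map_def V.points_eq V'.points_eq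
    using fS pre reg by auto
qed

section \<open>Linear dependence, and polynomials off finite sets\<close>

text \<open>Gaussian elimination: a vector with nonzero last coordinate clears that coordinate in
  all the others, which leaves one vector and one coordinate fewer.\<close>

lemma linear_dependence:
  fixes v :: "'i \<Rightarrow> nat \<Rightarrow> complex"
  assumes "finite I" "card I > n"
  shows "\<exists>c. (\<exists>i\<in>I. c i \<noteq> 0) \<and> (\<forall>k<n. (\<Sum>i\<in>I. c i * v i k) = 0)"
  using assms
proof (induction n arbitrary: I v)
  case 0
  then have "I \<noteq> {}" by auto
  then show ?case by (intro exI[of _ "\<lambda>_. 1"]) auto
next
  case (Suc n)
  show ?case
  proof (cases "\<forall>i\<in>I. v i n = 0")
    case True
    obtain c where c: "\<exists>i\<in>I. c i \<noteq> 0" "\<forall>k<n. (\<Sum>i\<in>I. c i * v i k) = 0"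
      using Suc.IH[of I v] Suc.prems by auto
    have "(\<Sum>i\<in>I. c i * v i k) = 0" if "k < Suc n" for k
      using that c(2) True by (cases "k = n") (auto intro: sum.neutral)
    with c(1) show ?thesis by blast
  next
    case False
    then obtain j where j: "j \<in> I" "v j n \<noteq> 0" by blast
    define v' where "v' = (\<lambda>i k. v i k - v i n / v j n * v j k)"
    have "finite (I - {j})" "card (I - {j}) > n"
      using Suc.prems j by (auto simp: card_Diff_singleton)
    then obtain c where c: "\<exists>i\<in>I - {j}. c i \<noteq> 0" "\<forall>k<n. (\<Sum>i\<in>I - {j}. c i * v' i k) = 0"
      using Suc.IH[of "I - {j}" v'] by blast
    \<comment> \<open>The coefficient of the pivot is forced by the last coordinate; the other
      coordinates then vanish because those of \<open>v'\<close> do.\<close>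
    define c' where "c' = c(j := - (\<Sum>i\<in>I - {j}. c i * v i n) / v j n)"
    have split: "(\<Sum>i\<in>I. c' i * v i k) = c' j * v j k + (\<Sum>i\<in>I - {j}. c i * v i k)" for k
    proof -
      have "(\<Sum>i\<in>I. c' i * v i k) = c' j * v j k + (\<Sum>i\<in>I - {j}. c' i * v i k)"
        using Suc.prems(1) j(1) by (rule sum.remove)
      also have "(\<Sum>i\<in>I - {j}. c' i * v i k) = (\<Sum>i\<in>I - {j}. c i * v i k)"
        by (intro sum.cong) (auto simp: c'_def)
      finally show ?thesis .
    qed
    have "(\<Sum>i\<in>I. c' i * v i k) = 0" if k: "k < Suc n" for k
    proof (cases "k = n")
      case True
      then show ?thesis unfolding split using j by (simp add: c'_def)
    next
      case False
      have "(\<Sum>i\<in>I - {j}. c i * v' i k) =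
          (\<Sum>i\<in>I - {j}. c i * v i k) - (\<Sum>i\<in>I - {j}. c i * v i n) / v j n * v j k"
        unfolding v'_def sum_divide_distrib sum_distrib_right sum_subtractf[symmetric]
        by (intro sum.cong) (auto simp: algebra_simps)
      moreover have "(\<Sum>i\<in>I - {j}. c i * v' i k) = 0" using c(2) k False by auto
      ultimately show ?thesis unfolding split by (simp add: c'_def)
    qed
    moreover have "\<exists>i\<in>I. c' i \<noteq> 0" using c(1) by (auto simp: c'_def)
    ultimately show ?thesis by blast
  qed
qed

lemma poly_dependence:
  fixes p :: "'i \<Rightarrow> complex poly"
  assumes "finite I" "card I > Suc n" "\<And>i. i \<in> I \<Longrightarrow> degree (p i) \<le> n"
  shows "\<exists>c. (\<exists>i\<in>I. c i \<noteq> 0) \<and> (\<Sum>i\<in>I. smult (c i) (p i)) = 0"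
proof -
  obtain c where c: "\<exists>i\<in>I. c i \<noteq> 0" "\<forall>k<Suc n. (\<Sum>i\<in>I. c i * coeff (p i) k) = 0"
    using linear_dependence[OF assms(1,2), of "\<lambda>i. coeff (p i)"] by blast
  have "(\<Sum>i\<in>I. c i * coeff (p i) k) = 0" for k
  proof (cases "k < Suc n")
    case False
    then have "coeff (p i) k = 0" if "i \<in> I" for i
      using assms(3)[OF that] by (intro coeff_eq_0) auto
    then show ?thesis by (intro sum.neutral) auto
  qed (use c in auto)
  then have "(\<Sum>i\<in>I. smult (c i) (p i)) = 0"
    by (intro poly_eqI) (simp add: coeff_sum)
  with c(1) show ?thesis by blast
qed

lemma eventually_poly_nonzero:
  fixes p :: "complex poly"
  assumes "p \<noteq> 0"
  shows "eventually (\<lambda>s. poly p s \<noteq> 0) cofinite"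
  using poly_roots_finite[OF assms] by (simp add: eventually_cofinite)

lemma not_eventually_False_cofinite: "\<not> eventually (\<lambda>s::complex. False) cofinite"
  using infinite_UNIV_char_0[where 'a = complex] by (simp add: eventually_cofinite)

lemma eventually_cofinite_poly_eqD:
  fixes p q :: "complex poly"
  assumes "eventually (\<lambda>s. poly p s = poly q s) cofinite"
  shows "p = q"
proof (rule ccontr)
  assume "p \<noteq> q"
  then have "eventually (\<lambda>s. poly (p - q) s \<noteq> 0) cofinite"
    by (intro eventually_poly_nonzero) auto
  with assms have "eventually (\<lambda>s::complex. False) cofinite"
    by eventually_elim auto
  then show False using not_eventually_False_cofinite by blast
qed

section \<open>Values, poles and orders on irreducible spaces\<close>

text \<open>The condition of \<open>smooth_curve_at\<close> with its witnesses named, so that the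
  same \<open>u\<close> can be divided out again and again.\<close>

definition uniformizer :: "'p fspace \<Rightarrow> 'p \<Rightarrow> 'p set \<Rightarrow> ('p \<Rightarrow> complex) \<Rightarrow> bool" where
  "uniformizer V x U u \<longleftrightarrow>
     openin (zar V) U \<and> x \<in> U \<and> u \<in> reg V U \<and> u x = 0 \<and>
     (\<forall>W g. openin (zar V) W \<and> x \<in> W \<and> g \<in> reg V W \<and> g x = 0 \<longrightarrow>
        (\<exists>W' h. openin (zar V) W' \<and> x \<in> W' \<and> W' \<subseteq> U \<inter> W \<and> h \<in> reg V W' \<and>
           (\<forall>y\<in>W'. g y = u y * h y)))"

lemma uniformizerD:
  assumes "uniformizer V x U u" "openin (zar V) W" "x \<in> W" "g \<in> reg V W" "g x = 0"
  shows "\<exists>W' h. openin (zar V) W' \<and> x \<in> W' \<and> W' \<subseteq> U \<inter> W \<and> h \<in> reg V W' \<and> (\<forall>y\<in>W'. g y = u y * h y)"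
  using assms unfolding uniformizer_def by blast

lemma smooth_curve_at_iff: "smooth_curve_at V x \<longleftrightarrow> (\<exists>U u. uniformizer V x U u)"
  unfolding smooth_curve_at_def uniformizer_def ..

locale irreducible_fspace = fraction_fspace H V S
  for H :: "nat \<Rightarrow> ('p \<Rightarrow> complex) set" and V S +
  assumes open_Int_nonempty:
    "openin (zar V) U \<Longrightarrow> openin (zar V) W \<Longrightarrow> U \<noteq> {} \<Longrightarrow> W \<noteq> {} \<Longrightarrow> U \<inter> W \<noteq> {}"
begin

text \<open>The identity principle: the locus where \<open>k\<close> is nonzero is open, so if it
  had a point it would meet \<open>B \<inter> W\<close> by irreducibility.\<close>

lemma identity_open:
  assumes "openin (zar V) W" "k \<in> reg V W" "openin (zar V) B" "B \<inter> W \<noteq> {}"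
    and zero: "\<And>y. y \<in> B \<inter> W \<Longrightarrow> k y = 0" and x: "x \<in> W"
  shows "k x = 0"
proof (rule ccontr)
  assume "k x \<noteq> 0"
  then have "B \<inter> W \<inter> {y \<in> W. k y \<noteq> 0} \<noteq> {}"
    using x assms by (intro open_Int_nonempty openin_nonzero) auto
  then show False using zero by auto
qed

lemma has_value_at_unique:
  assumes "has_value_at V U g x c" "has_value_at V U g x c'" "openin (zar V) U" "U \<noteq> {}"
  shows "c = c'"
proof -
  obtain W h where 1: "openin (zar V) W" "x \<in> W" "h \<in> reg V W" "h x = c" "\<forall>y\<in>W \<inter> U. g y = h y"
    using assms(1) unfolding has_value_at_def by blast
  obtain W' h' where 2: "openin (zar V) W'" "x \<in> W'" "h' \<in> reg V W'" "h' x = c'" "\<forall>y\<in>W' \<inter> U. g y = h' y"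
    using assms(2) unfolding has_value_at_def by blast
  have W: "openin (zar V) (W \<inter> W')" using 1 2 by blast
  have "(\<lambda>y. h y - h' y) x = 0"
  proof (rule identity_open[OF W _ assms(3)])
    show "(\<lambda>y. h y - h' y) \<in> reg V (W \<inter> W')"
      by (intro reg_diff W reg_restrict[OF 1(3,1)] reg_restrict[OF 2(3,1)]) auto
    show "U \<inter> (W \<inter> W') \<noteq> {}" using 1 2 assms by (intro open_Int_nonempty) auto
    show "h y - h' y = 0" if "y \<in> U \<inter> (W \<inter> W')" for y
      using that 1(5) 2(5) by (metis Int_iff cancel_comm_monoid_add_class.diff_cancel)
  qed (use 1 2 in auto)
  then show ?thesis using 1 2 by simp
qed

lemma not_has_pole_at_if_has_value_at:
  assumes "has_value_at V U g x c" "openin (zar V) U" "U \<noteq> {}"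
  shows "\<not> has_pole_at V U g x"
proof
  assume "has_pole_at V U g x"
  then obtain W' h' where 2: "openin (zar V) W'" "x \<in> W'" "h' \<in> reg V W'" "h' x = 0" "\<forall>y\<in>W' \<inter> U. h' y * g y = 1"
    unfolding has_pole_at_def by blast
  obtain W h where 1: "openin (zar V) W" "x \<in> W" "h \<in> reg V W" "h x = c" "\<forall>y\<in>W \<inter> U. g y = h y"
    using assms(1) unfolding has_value_at_def by blast
  have W: "openin (zar V) (W \<inter> W')" using 1 2 by blast
  have "(\<lambda>y. h' y * h y - 1) x = 0"
  proof (rule identity_open[OF W _ assms(2)])
    show "(\<lambda>y. h' y * h y - 1) \<in> reg V (W \<inter> W')"
      by (intro reg_diff reg_mult reg_const W reg_restrict[OF 1(3,1)] reg_restrict[OF 2(3,1)]) auto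
    show "U \<inter> (W \<inter> W') \<noteq> {}" using 1 2 assms by (intro open_Int_nonempty) auto
    show "h' y * h y - 1 = 0" if "y \<in> U \<inter> (W \<inter> W')" for y
      using that 1(5) 2(5) by (metis Int_iff cancel_comm_monoid_add_class.diff_cancel)
  qed (use 1 2 in auto)
  then show False using 2 by simp
qed

text \<open>For reading off traces, which are rational functions of one coordinate
  \<open>\<sigma>\<close>, from the value of \<open>\<sigma>\<close>. The relation is kept free of
  division because \<open>Q\<close> may vanish somewhere on \<open>U\<close>.\<close>

lemma has_value_at_rational:
  assumes "has_value_at V U \<sigma> x c" "\<And>y. y \<in> U \<Longrightarrow> g y * poly Q (\<sigma> y) = poly P (\<sigma> y)" "poly Q c \<noteq> 0"
  shows "has_value_at V U g x (poly P c / poly Q c)"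
proof -
  obtain W h where 1: "openin (zar V) W" "x \<in> W" "h \<in> reg V W" "h x = c" "\<forall>y\<in>W \<inter> U. \<sigma> y = h y"
    using assms(1) unfolding has_value_at_def by blast
  define W' where "W' = {y \<in> W. poly Q (h y) \<noteq> 0}"
  have W': "openin (zar V) W'"
    unfolding W'_def using 1 by (intro openin_nonzero reg_poly)
  have "h \<in> reg V W'" by (rule reg_restrict[OF 1(3,1) W']) (auto simp: W'_def)
  then have "(\<lambda>y. poly P (h y) * inverse (poly Q (h y))) \<in> reg V W'"
    using W' by (intro reg_mult reg_inverse reg_poly) (auto simp: W'_def)
  moreover have "g y = poly P (h y) * inverse (poly Q (h y))" if "y \<in> W' \<inter> U" for y
  proof -
    have "\<sigma> y = h y" "poly Q (h y) \<noteq> 0" using that 1(5) by (auto simp: W'_def)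
    then show ?thesis using assms(2)[of y] that by (simp add: field_simps)
  qed
  ultimately show ?thesis
    unfolding has_value_at_def using W' 1 assms(3)
    by (intro exI[of _ W'] exI[of _ "\<lambda>y. poly P (h y) * inverse (poly Q (h y))"])
      (auto simp: W'_def field_simps)
qed

lemma has_pole_at_rational:
  assumes "has_value_at V U \<sigma> x c" "\<And>y. y \<in> U \<Longrightarrow> g y * poly Q (\<sigma> y) = poly P (\<sigma> y)"
    and "poly Q c = 0" "poly P c \<noteq> 0"
  shows "has_pole_at V U g x"
proof -
  obtain W h where 1: "openin (zar V) W" "x \<in> W" "h \<in> reg V W" "h x = c" "\<forall>y\<in>W \<inter> U. \<sigma> y = h y"
    using assms(1) unfolding has_value_at_def by blast
  define W' where "W' = {y \<in> W. poly P (h y) \<noteq> 0}"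
  have W': "openin (zar V) W'"
    unfolding W'_def using 1 by (intro openin_nonzero reg_poly)
  have "h \<in> reg V W'" by (rule reg_restrict[OF 1(3,1) W']) (auto simp: W'_def)
  then have "(\<lambda>y. poly Q (h y) * inverse (poly P (h y))) \<in> reg V W'"
    using W' by (intro reg_mult reg_inverse reg_poly) (auto simp: W'_def)
  moreover have "poly Q (h y) * inverse (poly P (h y)) * g y = 1" if "y \<in> W' \<inter> U" for y
  proof -
    have "\<sigma> y = h y" "poly P (h y) \<noteq> 0" using that 1(5) by (auto simp: W'_def)
    then show ?thesis using assms(2)[of y] that by (simp add: field_simps)
  qed
  ultimately show ?thesis
    unfolding has_pole_at_def using W' 1 assms(3,4)
    by (intro exI[of _ W'] exI[of _ "\<lambda>y. poly Q (h y) * inverse (poly P (h y))"])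
      (auto simp: W'_def)
qed

end

text \<open>The map \<open>\<gamma>\<close> plays the role of a dominant rational map from the affine line to \<open>V\<close>.\<close>

locale rational_fspace = irreducible_fspace H V S
  for H :: "nat \<Rightarrow> ('p \<Rightarrow> complex) set" and V S +
  fixes \<gamma> :: "complex \<Rightarrow> 'p"
  assumes degree_one: "x \<in> S \<Longrightarrow> \<exists>m\<in>H 1. m x \<noteq> 0"
    and pullback: "openin (zar V) W \<Longrightarrow> W \<noteq> {} \<Longrightarrow> k \<in> reg V W \<Longrightarrow>
      \<exists>P Q. \<forall>\<^sub>F s in cofinite. \<gamma> s \<in> W \<and> poly Q s \<noteq> 0 \<and> k (\<gamma> s) = poly P s / poly Q s"
begin

lemma eventually_param_in:
  assumes "openin (zar V) W" "W \<noteq> {}"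
  shows "\<forall>\<^sub>F s in cofinite. \<gamma> s \<in> W"
proof -
  obtain P Q where "\<forall>\<^sub>F s in cofinite. \<gamma> s \<in> W \<and> poly Q s \<noteq> 0 \<and> 0 = poly P s / poly Q s"
    using pullback[OF assms reg_const[OF assms(1), of 0]] by blast
  then show ?thesis by eventually_elim auto
qed

text \<open>If the open locus where \<open>k\<close> is nonzero had a point, almost every
  \<open>\<gamma> s\<close> would lie in it.\<close>

lemma identity_param:
  assumes "openin (zar V) W" "k \<in> reg V W" "\<forall>\<^sub>F s in cofinite. \<gamma> s \<in> W \<longrightarrow> k (\<gamma> s) = 0" "x \<in> W"
  shows "k x = 0"
proof (rule ccontr)
  assume "k x \<noteq> 0"
  then have "\<forall>\<^sub>F s in cofinite. \<gamma> s \<in> {y \<in> W. k y \<noteq> 0}"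
    using assms by (intro eventually_param_in openin_nonzero) auto
  with assms(3) have "\<forall>\<^sub>F s::complex in cofinite. False"
    by eventually_elim auto
  then show False using not_eventually_False_cofinite by blast
qed

text \<open>A count: along \<open>\<gamma>\<close> and after clearing denominators, the monomials in
  \<open>u\<close> and \<open>w\<close> are polynomials in \<open>s\<close> of bounded degree, and
  there are more monomials than coefficients. The relation found for almost all \<open>s\<close>
  holds on \<open>W\<close> by \<open>identity_param\<close>.\<close>

lemma algebraic_dependence:
  assumes W: "openin (zar V) W" "W \<noteq> {}" and u: "u \<in> reg V W" and w: "w \<in> reg V W"
  shows "\<exists>N a. (\<exists>j\<le>N. a j \<noteq> 0) \<and> (\<forall>y\<in>W. (\<Sum>j\<le>N. poly (a j) (u y) * w y ^ j) = 0)"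
proof -
  obtain A B where AB: "\<forall>\<^sub>F s in cofinite. \<gamma> s \<in> W \<and> poly B s \<noteq> 0 \<and> u (\<gamma> s) = poly A s / poly B s"
    using pullback[OF W u] by blast
  obtain C D where CD: "\<forall>\<^sub>F s in cofinite. \<gamma> s \<in> W \<and> poly D s \<noteq> 0 \<and> w (\<gamma> s) = poly C s / poly D s"
    using pullback[OF W w] by blast
  \<comment> \<open>With \<open>S\<close> the sum of the four degrees and \<open>N = S + 1\<close>,
    there are \<open>(N + 1)^2\<close> monomials against \<open>N * S + 1\<close>
    coefficients.\<close>
  define N where "N = Suc (degree A + degree B + degree C + degree D)"
  define p where "p = (\<lambda>(i, j). A ^ i * B ^ (N - i) * (C ^ j * D ^ (N - j)))"
  let ?I = "{..N} \<times> {..N}"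
  have deg: "degree (p x) \<le> N * (degree A + degree B + degree C + degree D)" if x: "x \<in> ?I" for x
  proof -
    obtain i j where ij: "x = (i, j)" "i \<le> N" "j \<le> N" using x by auto
    have "degree (A ^ i * B ^ (N - i) * (C ^ j * D ^ (N - j)))
        \<le> degree (A ^ i * B ^ (N - i)) + degree (C ^ j * D ^ (N - j))"
      by (rule degree_mult_le)
    also have "\<dots> \<le> (degree (A ^ i) + degree (B ^ (N - i))) + (degree (C ^ j) + degree (D ^ (N - j)))"
      by (intro add_mono degree_mult_le)
    also have "\<dots> \<le> (degree A * i + degree B * (N - i)) + (degree C * j + degree D * (N - j))"
      by (intro add_mono degree_power_le)
    also have "\<dots> \<le> (degree A * N + degree B * N) + (degree C * N + degree D * N)"
      using ij by (intro add_mono mult_le_mono2) auto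
    finally show ?thesis by (simp add: p_def ij algebra_simps)
  qed
  have "card ?I = Suc N * Suc N" by (simp add: card_cartesian_product)
  then have "card ?I > Suc (N * (degree A + degree B + degree C + degree D))"
    by (simp add: N_def algebra_simps)
  then obtain c where c: "\<exists>x\<in>?I. c x \<noteq> 0" "(\<Sum>x\<in>?I. smult (c x) (p x)) = 0"
    using poly_dependence[of ?I _ p] deg by blast
  define a where "a = (\<lambda>j. \<Sum>i\<le>N. monom (c (i, j)) i)"
  have coeff_a: "coeff (a j) i = c (i, j)" if "i \<le> N" for i j
    using that by (simp add: a_def coeff_sum if_distrib sum.delta cong: if_cong)
  obtain i j where ij: "i \<le> N" "j \<le> N" "c (i, j) \<noteq> 0" using c(1) by auto
  then have "a j \<noteq> 0" using coeff_a[of i j] by auto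
  moreover have "(\<Sum>j\<le>N. poly (a j) (u x) * w x ^ j) = 0" if x: "x \<in> W" for x
  proof (rule identity_param[OF W(1) _ _ x])
    show "(\<lambda>x. \<Sum>j\<le>N. poly (a j) (u x) * w x ^ j) \<in> reg V W"
      using W u w by (intro reg_sum reg_mult reg_poly reg_power)
    show "\<forall>\<^sub>F s in cofinite. \<gamma> s \<in> W \<longrightarrow> (\<Sum>j\<le>N. poly (a j) (u (\<gamma> s)) * w (\<gamma> s) ^ j) = 0"
      using AB CD
    proof eventually_elim
      case (elim s)
      have *: "poly (p (i, j)) s = (poly B s * poly D s) ^ N * (u (\<gamma> s) ^ i * w (\<gamma> s) ^ j)"
        if "i \<le> N" "j \<le> N" for i j
      proof -
        have "poly B s ^ N = poly B s ^ i * poly B s ^ (N - i)" "poly D s ^ N = poly D s ^ j * poly D s ^ (N - j)"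
          using that by (simp_all flip: power_add)
        then show ?thesis
          using elim by (simp add: p_def power_divide power_mult_distrib field_simps)
      qed
      have "0 = poly (\<Sum>x\<in>?I. smult (c x) (p x)) s" using c(2) by simp
      also have "\<dots> = (\<Sum>i\<le>N. \<Sum>j\<le>N. c (i, j) * poly (p (i, j)) s)"
        unfolding poly_sum sum.cartesian_product by (intro sum.cong) auto
      also have "\<dots> = (\<Sum>i\<le>N. \<Sum>j\<le>N. (poly B s * poly D s) ^ N * (c (i, j) * (u (\<gamma> s) ^ i * w (\<gamma> s) ^ j)))"
        by (intro sum.cong) (auto simp: *)
      also have "\<dots> = (poly B s * poly D s) ^ N * (\<Sum>i\<le>N. \<Sum>j\<le>N. c (i, j) * (u (\<gamma> s) ^ i * w (\<gamma> s) ^ j))"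
        by (simp add: sum_distrib_left)
      finally have "(\<Sum>i\<le>N. \<Sum>j\<le>N. c (i, j) * (u (\<gamma> s) ^ i * w (\<gamma> s) ^ j)) = 0"
        using elim by auto
      moreover have "(\<Sum>j\<le>N. poly (a j) (u (\<gamma> s)) * w (\<gamma> s) ^ j)
          = (\<Sum>j\<le>N. \<Sum>i\<le>N. c (i, j) * (u (\<gamma> s) ^ i * w (\<gamma> s) ^ j))"
        by (simp add: a_def poly_sum poly_monom sum_distrib_right mult.assoc)
      ultimately show ?case by (subst (asm) sum.swap) simp
    qed
  qed
  ultimately show ?thesis using ij by blast
qed

text \<open>In a relation of least degree in \<open>w\<close> the constant coefficient survives:
  otherwise \<open>w\<close> could be cancelled where it is nonzero, hence everywhere by the
  identity principle, leaving a shorter relation.\<close>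

lemma algebraic_dependence_minimal:
  assumes W: "openin (zar V) W" and u: "u \<in> reg V W" and w: "w \<in> reg V W"
    and z: "z \<in> W" "w z \<noteq> 0"
  shows "\<exists>N a. a 0 \<noteq> 0 \<and> (\<forall>y\<in>W. (\<Sum>j\<le>N. poly (a j) (u y) * w y ^ j) = 0)"
proof -
  define P where
    "P = (\<lambda>N. \<exists>a. (\<exists>j\<le>N. a j \<noteq> 0) \<and> (\<forall>y\<in>W. (\<Sum>j\<le>N. poly (a j) (u y) * w y ^ j) = 0))"
  have W': "W \<noteq> {}" using z by auto
  have "\<exists>N. P N"
    using algebraic_dependence[OF W W' u w] unfolding P_def .
  then have N: "P (LEAST N. P N)" by (rule LeastI_ex)
  define N where "N = (LEAST N. P N)"
  have least: "N \<le> M" if "P M" for M unfolding N_def using that by (rule Least_le)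
  obtain a where a: "\<exists>j\<le>N. a j \<noteq> 0" "\<And>y. y \<in> W \<Longrightarrow> (\<Sum>j\<le>N. poly (a j) (u y) * w y ^ j) = 0"
    using N unfolding N_def[symmetric] unfolding P_def by auto
  have "a 0 \<noteq> 0"
  proof
    assume a0: "a 0 = 0"
    then obtain M where M: "N = Suc M" using a(1) by (cases N) auto
    let ?k = "\<lambda>y. \<Sum>j\<le>M. poly (a (Suc j)) (u y) * w y ^ j"
    have "?k x = 0" if x: "x \<in> W" for x
    proof (rule identity_open[OF W _ openin_nonzero[OF w W] _ _ x])
      show "?k \<in> reg V W" using W u w by (intro reg_sum reg_mult reg_poly reg_power)
      show "{y \<in> W. w y \<noteq> 0} \<inter> W \<noteq> {}" using z by auto
      fix y assume y: "y \<in> {y \<in> W. w y \<noteq> 0} \<inter> W"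
      have "w y * ?k y = (\<Sum>j\<le>N. poly (a j) (u y) * w y ^ j)"
        unfolding M sum.atMost_Suc_shift using a0 by (simp add: sum_distrib_left algebra_simps)
      then show "?k y = 0" using a(2) y by auto
    qed
    moreover have "\<exists>j\<le>M. a (Suc j) \<noteq> 0"
      using a(1) a0 unfolding M by (metis Suc_le_mono not0_implies_Suc)
    ultimately have "P M" unfolding P_def by (intro exI[of _ "\<lambda>j. a (Suc j)"]) simp
    then show False using least[of M] M by simp
  qed
  with a(2) show ?thesis by blast
qed

text \<open>Algebraic dependence of \<open>u\<close> and \<open>w\<close> bounds the powers of \<open>u\<close> which divide \<open>w\<close>; this
  replaces the Krull intersection theorem.\<close>

lemma exists_order:
  assumes u: "uniformizer V x U u" and W: "openin (zar V) W" "x \<in> W" "W \<subseteq> U"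
    and w: "w \<in> reg V W" and z: "z \<in> W" "w z \<noteq> 0"
  shows "\<exists>k e W'. openin (zar V) W' \<and> x \<in> W' \<and> W' \<subseteq> W \<and> e \<in> reg V W' \<and> e x \<noteq> 0 \<and>
    (\<forall>y\<in>W'. w y = u y ^ k * e y)"
proof (rule ccontr)
  assume contra: "\<not> ?thesis"
  have uW: "u \<in> reg V W" and ux: "u x = 0"
    using u W unfolding uniformizer_def by (blast intro: reg_restrict)+
  \<comment> \<open>If there is no order, each cofactor vanishes at \<open>x\<close>, so the
    uniformizer splits off once more, without end.\<close>
  have divisible: "\<exists>W' e. openin (zar V) W' \<and> x \<in> W' \<and> W' \<subseteq> W \<and> e \<in> reg V W' \<and>
    (\<forall>y\<in>W'. w y = u y ^ k * e y)" for k
  proof (induction k)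
    case 0
    show ?case using W w by (intro exI[of _ W] exI[of _ w]) auto
  next
    case (Suc k)
    then obtain W' e where e: "openin (zar V) W'" "x \<in> W'" "W' \<subseteq> W" "e \<in> reg V W'"
      "\<forall>y\<in>W'. w y = u y ^ k * e y" by blast
    have "e x = 0" using contra e by blast
    from uniformizerD[OF u e(1,2,4) this] obtain W'' h where
      h: "openin (zar V) W''" "x \<in> W''" "W'' \<subseteq> U \<inter> W'" "h \<in> reg V W''" "\<forall>y\<in>W''. e y = u y * h y"
      by blast
    have "w y = u y ^ Suc k * h y" if y: "y \<in> W''" for y
      using e(5) h(3,5) y by (auto simp: algebra_simps)
    then show ?case using h e by blast
  qed
  obtain N a where a: "a 0 \<noteq> 0" "\<And>y. y \<in> W \<Longrightarrow> (\<Sum>j\<le>N. poly (a j) (u y) * w y ^ j) = 0"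
    using algebraic_dependence_minimal[OF W(1) uW w z] by blast
  obtain b where b: "a 0 = [:-0, 1:] ^ Polynomial.order 0 (a 0) * b" "\<not> [:-0, 1:] dvd b"
    using order_decomp[OF a(1), of 0] by blast
  \<comment> \<open>The constant coefficient is \<open>u^m\<close> times \<open>b(u)\<close> with
    \<open>b(0)\<close> nonzero. Once \<open>u^(m + 1)\<close> divides \<open>w\<close>, the
    relation reads \<open>u^m * E = 0\<close>, and \<open>E\<close> has the nonzero value
    \<open>b(0)\<close> at \<open>x\<close>.\<close>
  define m where "m = Polynomial.order 0 (a 0)"
  have a0: "poly (a 0) v = v ^ m * poly b v" for v
    by (subst b(1)) (simp add: m_def)
  have b0: "poly b 0 \<noteq> 0" using b(2) by (simp add: poly_eq_0_iff_dvd)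
  obtain W' e where e: "openin (zar V) W'" "x \<in> W'" "W' \<subseteq> W" "e \<in> reg V W'"
    "\<forall>y\<in>W'. w y = u y ^ Suc m * e y" using divisible[of "Suc m"] by blast
  have uW': "u \<in> reg V W'" "w \<in> reg V W'"
    using reg_restrict[OF uW W(1) e(1,3)] reg_restrict[OF w W(1) e(1,3)] by auto
  define E where "E = (\<lambda>y. poly b (u y) + u y * e y * (\<Sum>j<N. poly (a (Suc j)) (u y) * w y ^ j))"
  have E: "E \<in> reg V W'"
    unfolding E_def using uW' e by (intro reg_add reg_mult reg_sum reg_poly reg_power)
  have uE: "u y ^ m * E y = 0" if y: "y \<in> W'" for y
  proof -
    have "0 = (\<Sum>j\<le>N. poly (a j) (u y) * w y ^ j)" using a(2) y e(3) by auto
    also have "\<dots> = poly (a 0) (u y) + w y * (\<Sum>j<N. poly (a (Suc j)) (u y) * w y ^ j)"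
      unfolding sum.atMost_shift by (simp add: sum_distrib_left algebra_simps)
    also have "\<dots> = u y ^ m * E y"
      unfolding a0 E_def using e(5) y by (simp add: algebra_simps)
    finally show ?thesis by simp
  qed
  have Ex: "E x \<noteq> 0" using b0 ux by (simp add: E_def)
  have m: "m \<noteq> 0" using uE[OF e(2)] Ex by auto
  \<comment> \<open>Where \<open>E\<close> is nonzero the uniformizer vanishes, and with it
    \<open>w\<close>; the identity principle carries this to \<open>z\<close>.\<close>
  have "w z = 0"
  proof (rule identity_open[OF W(1) w openin_nonzero[OF E e(1)] _ _ z(1)])
    show "{y \<in> W'. E y \<noteq> 0} \<inter> W \<noteq> {}" using e Ex by auto
    show "w y = 0" if "y \<in> {y \<in> W'. E y \<noteq> 0} \<inter> W" for y
      using that uE[of y] e(5) m by auto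
  qed
  then show False using z by simp
qed

text \<open>A quotient of two functions of finite order at \<open>x\<close> is a power of the
  uniformizer with integer exponent, times a unit. The sign of the exponent decides between value
  and pole.\<close>

theorem has_value_or_pole_at:
  assumes smooth: "smooth_curve_at V x" and U: "openin (zar V) U" "U \<noteq> {}"
    and \<sigma>: "\<sigma> \<in> reg V U"
  shows "(\<exists>c. has_value_at V U \<sigma> x c) \<or> has_pole_at V U \<sigma> x"
proof (cases "\<forall>y\<in>U. \<sigma> y = 0")
  case True
  obtain U' where "openin (zar V) U'" "x \<in> U'"
    using smooth unfolding smooth_curve_at_def by blast
  then have "has_value_at V U \<sigma> x 0"
    unfolding has_value_at_def using True by (intro exI[of _ U'] exI[of _ "\<lambda>_. 0"]) (auto intro: reg_const)
  then show ?thesis by blast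
next
  case False
  then obtain z where z: "z \<in> U" "\<sigma> z \<noteq> 0" by blast
  obtain U0 u where u: "uniformizer V x U0 u" using smooth unfolding smooth_curve_at_iff by blast
  then have U0: "openin (zar V) U0" "x \<in> U0" "u \<in> reg V U0" "u x = 0" by (auto simp: uniformizer_def)
  have xS: "x \<in> S" using U0 openin_subset_S by blast
  from \<sigma> U(1) z(1) obtain d p q where pq: "p \<in> H d" "q \<in> H d" "q z \<noteq> 0"
    "\<And>y. y \<in> U \<Longrightarrow> q y \<noteq> 0 \<Longrightarrow> \<sigma> y = p y / q y" by (rule regE) blast
  have pz: "p z \<noteq> 0" using pq z by force
  \<comment> \<open>Dividing by powers of a function of degree one that does not vanish at
    \<open>x\<close> turns \<open>p\<close> and \<open>q\<close> of degree \<open>d\<close> into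
    regular functions near \<open>x\<close>.\<close>
  obtain m where m: "m \<in> H 1" "m x \<noteq> 0" using degree_one[OF xS] by blast
  have md: "(\<lambda>y. m y ^ d) \<in> H d" using power[OF m(1), of d] by simp
  define W0 where "W0 = U0 \<inter> {y \<in> S. m y \<noteq> 0}"
  have W0: "openin (zar V) W0" "x \<in> W0" "W0 \<subseteq> U0"
    unfolding W0_def using U0 openin_basic[OF m(1)] m xS by auto
  define \<alpha> \<beta> where "\<alpha> = (\<lambda>y. p y / m y ^ d)" and "\<beta> = (\<lambda>y. q y / m y ^ d)"
  have \<alpha>\<beta>: "\<alpha> \<in> reg V W0" "\<beta> \<in> reg V W0"
    unfolding \<alpha>_def \<beta>_def using pq(1,2) md W0 by (auto intro!: reg_quotient simp: W0_def)
  \<comment> \<open>On \<open>B\<close> the function \<open>\<sigma>\<close> is the quotient of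
    \<open>p\<close> and \<open>q\<close>, and neither vanishes. What is computed there spreads to
    \<open>W \<inter> U\<close> by the identity principle.\<close>
  define B where "B = {y \<in> S. p y * q y \<noteq> 0} \<inter> U"
  have B: "openin (zar V) B"
    unfolding B_def using openin_basic[OF mult[OF pq(1,2)]] U by blast
  have "z \<in> B" using z pq pz U openin_subset_S by (auto simp: B_def)
  then have "B \<inter> W0 \<noteq> {}" using W0 B by (intro open_Int_nonempty) auto
  then obtain y1 where y1: "y1 \<in> B" "y1 \<in> W0" by blast
  then have y1': "\<alpha> y1 \<noteq> 0" "\<beta> y1 \<noteq> 0" by (auto simp: B_def W0_def \<alpha>_def \<beta>_def)
  obtain a e W1 where 1: "openin (zar V) W1" "x \<in> W1" "W1 \<subseteq> W0" "e \<in> reg V W1" "e x \<noteq> 0"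
    "\<forall>y\<in>W1. \<alpha> y = u y ^ a * e y"
    using exists_order[OF u W0 \<alpha>\<beta>(1) y1(2) y1'(1)] by blast
  obtain b e' W2 where 2: "openin (zar V) W2" "x \<in> W2" "W2 \<subseteq> W0" "e' \<in> reg V W2" "e' x \<noteq> 0"
    "\<forall>y\<in>W2. \<beta> y = u y ^ b * e' y"
    using exists_order[OF u W0 \<alpha>\<beta>(2) y1(2) y1'(2)] by blast
  define W where "W = {y \<in> W1. e y \<noteq> 0} \<inter> {y \<in> W2. e' y \<noteq> 0}"
  have W: "openin (zar V) W" "x \<in> W"
    unfolding W_def using openin_nonzero[OF 1(4,1)] openin_nonzero[OF 2(4,1)] 1 2 by auto
  have WW: "W \<subseteq> W1" "W \<subseteq> W2" "W \<subseteq> U0" using 1 2 W0 by (auto simp: W_def)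
  have regs: "u \<in> reg V W" "e \<in> reg V W" "e' \<in> reg V W" "\<And>y. y \<in> W \<Longrightarrow> e y \<noteq> 0" "\<And>y. y \<in> W \<Longrightarrow> e' y \<noteq> 0"
    using reg_restrict[OF U0(3,1) W(1) WW(3)] reg_restrict[OF 1(4,1) W(1) WW(1)]
      reg_restrict[OF 2(4,1) W(1) WW(2)] by (auto simp: W_def)
  have WU: "openin (zar V) (W \<inter> U)" using W U by blast
  have \<sigma>WU: "\<sigma> \<in> reg V (W \<inter> U)" using reg_restrict[OF \<sigma> U(1) WU] by blast
  have BWU: "B \<inter> (W \<inter> U) \<noteq> {}"
  proof -
    have "B \<inter> W \<noteq> {}" using \<open>z \<in> B\<close> W B by (intro open_Int_nonempty) auto
    then show ?thesis by (auto simp: B_def)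
  qed
  have eq: "\<sigma> y * (u y ^ b * e' y) = u y ^ a * e y" "u y ^ a \<noteq> 0" "u y ^ b \<noteq> 0" if y: "y \<in> B \<inter> W" for y
  proof -
    have "\<alpha> y = u y ^ a * e y" "\<beta> y = u y ^ b * e' y" using y WW 1 2 by auto
    moreover have "m y \<noteq> 0" using y WW 1 by (auto simp: W0_def)
    moreover have "\<sigma> y = p y / q y" "p y \<noteq> 0" "q y \<noteq> 0" using y pq(4) by (auto simp: B_def)
    ultimately show "\<sigma> y * (u y ^ b * e' y) = u y ^ a * e y" "u y ^ a \<noteq> 0" "u y ^ b \<noteq> 0"
      unfolding \<alpha>_def \<beta>_def
      by (metis (no_types, lifting) divide_eq_0_iff nonzero_eq_divide_eq power_not_zero times_divide_eq_right,
          metis (no_types, lifting) divide_eq_0_iff mult_zero_left power_not_zero,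
          metis (no_types, lifting) divide_eq_0_iff mult_zero_left power_not_zero)
  qed
  show ?thesis
  proof (cases "b \<le> a")
    case True
    let ?h = "\<lambda>y. u y ^ (a - b) * e y * inverse (e' y)"
    have h: "?h \<in> reg V W" using regs W by (intro reg_mult reg_power reg_inverse)
    have "(\<lambda>y. \<sigma> y - ?h y) y = 0" if y: "y \<in> W \<inter> U" for y
    proof (rule identity_open[OF WU _ B BWU _ y])
      show "(\<lambda>y. \<sigma> y - ?h y) \<in> reg V (W \<inter> U)"
        by (intro reg_diff[OF \<sigma>WU] WU reg_restrict[OF h W(1) WU]) auto
      fix y assume y: "y \<in> B \<inter> (W \<inter> U)"
      have "u y ^ a = u y ^ (a - b) * u y ^ b" using True by (simp flip: power_add)
      then show "\<sigma> y - ?h y = 0" using eq[of y] y regs(5)[of y] by (auto simp: field_simps)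
    qed
    then have "has_value_at V U \<sigma> x (?h x)"
      unfolding has_value_at_def using W h by (intro exI[of _ W] exI[of _ ?h]) auto
    then show ?thesis by blast
  next
    case False
    let ?h = "\<lambda>y. u y ^ (b - a) * e' y * inverse (e y)"
    have h: "?h \<in> reg V W" using regs W by (intro reg_mult reg_power reg_inverse)
    have "(\<lambda>y. ?h y * \<sigma> y - 1) y = 0" if y: "y \<in> W \<inter> U" for y
    proof (rule identity_open[OF WU _ B BWU _ y])
      show "(\<lambda>y. ?h y * \<sigma> y - 1) \<in> reg V (W \<inter> U)"
        by (intro reg_diff[OF reg_mult[OF _ \<sigma>WU]] reg_const WU reg_restrict[OF h W(1) WU]) auto
      fix y assume y: "y \<in> B \<inter> (W \<inter> U)"
      have "u y ^ b = u y ^ (b - a) * u y ^ a" using False by (simp flip: power_add)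
      then show "?h y * \<sigma> y - 1 = 0" using eq[of y] y regs(4)[of y] by (auto simp: field_simps)
    qed
    moreover have "?h x = 0" using U0 False by simp
    ultimately have "has_pole_at V U \<sigma> x"
      unfolding has_pole_at_def using W h by (intro exI[of _ W] exI[of _ ?h]) auto
    then show ?thesis by blast
  qed
qed

end

section \<open>Projective curves\<close>

lemma irreducible_in_open_Int:
  assumes "irreducible_in T S" "openin (subtopology T S) U" "openin (subtopology T S) W" "U \<noteq> {}" "W \<noteq> {}"
  shows "U \<inter> W \<noteq> {}"
proof
  assume UW: "U \<inter> W = {}"
  obtain A where A: "openin T A" "U = A \<inter> S" using assms(2) by (auto simp: openin_subtopology)
  obtain B where B: "openin T B" "W = B \<inter> S" using assms(3) by (auto simp: openin_subtopology)
  have "closedin T (topspace T - A)" "closedin T (topspace T - B)" using A B by auto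
  moreover have "S \<subseteq> topspace T" using assms(1) by (simp add: irreducible_in_def)
  then have "S \<subseteq> (topspace T - A) \<union> (topspace T - B)" using UW A B by blast
  ultimately have "S \<subseteq> topspace T - A \<or> S \<subseteq> topspace T - B"
    using assms(1) unfolding irreducible_in_def by blast
  then show False using A B assms(4,5) by blast
qed

lemma generated_algebra_power: "f \<in> generated_algebra S \<Longrightarrow> (\<lambda>x. f x ^ n) \<in> generated_algebra S"
  by (induction n) (auto intro: generated_algebra.intros generated_algebra.const[of 1, simplified])

lemma generated_algebra_sum:
  "(\<And>i. i \<in> I \<Longrightarrow> f i \<in> generated_algebra S) \<Longrightarrow> (\<lambda>x. \<Sum>i\<in>I. f i x) \<in> generated_algebra S"
  by (induction I rule: infinite_finite_induct) (auto intro: generated_algebra.intros)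

lemma generated_algebra_diff:
  assumes "f \<in> generated_algebra S" "g \<in> generated_algebra S"
  shows "(\<lambda>x. f x - g x) \<in> generated_algebra S"
  using generated_algebra.add[OF assms(1) generated_algebra.mult[OF generated_algebra.const[of "-1"] assms(2)]]
  by simp

text \<open>The values of a single form depend on the vectors picked by \<open>proj_rep\<close>;
  only its zeros and the quotients of equal degree are intrinsic.\<close>

definition hom_functions :: "nat \<Rightarrow> ((complex^'n) set \<Rightarrow> complex) set" where
  "hom_functions d = {p \<circ> proj_rep | p. homogeneous_poly d p}"

lemma graded_functions_hom_functions: "graded_functions hom_functions"
proof
  show "(\<lambda>_. 1) \<in> hom_functions 0"
    unfolding hom_functions_def homogeneous_poly_def
    by (auto intro!: exI[of _ "\<lambda>_. 1"] generated_algebra.const)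
next
  fix f g :: "(complex^'a) set \<Rightarrow> complex" and d
  assume "f \<in> hom_functions d" "g \<in> hom_functions d"
  then obtain p q where "f = p \<circ> proj_rep" "g = q \<circ> proj_rep" "homogeneous_poly d p" "homogeneous_poly d q"
    by (auto simp: hom_functions_def)
  then show "(\<lambda>x. f x + g x) \<in> hom_functions d"
    unfolding hom_functions_def homogeneous_poly_def
    by (auto intro!: exI[of _ "\<lambda>x. p x + q x"] generated_algebra.add simp: algebra_simps)
next
  fix f :: "(complex^'a) set \<Rightarrow> complex" and d c
  assume "f \<in> hom_functions d"
  then obtain p where "f = p \<circ> proj_rep" "homogeneous_poly d p"
    by (auto simp: hom_functions_def)
  then show "(\<lambda>x. c * f x) \<in> hom_functions d"
    unfolding hom_functions_def homogeneous_poly_def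
    by (auto intro!: exI[of _ "\<lambda>x. c * p x"] generated_algebra.mult generated_algebra.const simp: algebra_simps)
next
  fix f g :: "(complex^'a) set \<Rightarrow> complex" and d e
  assume "f \<in> hom_functions d" "g \<in> hom_functions e"
  then obtain p q where "f = p \<circ> proj_rep" "g = q \<circ> proj_rep" "homogeneous_poly d p" "homogeneous_poly e q"
    by (auto simp: hom_functions_def)
  then show "(\<lambda>x. f x * g x) \<in> hom_functions (d + e)"
    unfolding hom_functions_def homogeneous_poly_def
    by (auto intro!: exI[of _ "\<lambda>x. p x * q x"] generated_algebra.mult simp: algebra_simps power_add)
qed

lemma proj_space_eq:
  "(proj_space :: (complex^'n) set fspace) = fraction_space proj_points (fractions hom_functions)"
proof -
  have "{(p \<circ> proj_rep, q \<circ> proj_rep) | p q :: complex^'n \<Rightarrow> complex.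
      \<exists>d. homogeneous_poly d p \<and> homogeneous_poly d q} = fractions hom_functions"
    unfolding fractions_def hom_functions_def by auto
  then show ?thesis unfolding proj_space_def by simp
qed

lemma fraction_fspace_proj_space:
  "fraction_fspace hom_functions (proj_space :: (complex^'n) set fspace) proj_points"
proof -
  interpret graded_functions "hom_functions :: nat \<Rightarrow> ((complex^'n) set \<Rightarrow> complex) set"
    by (rule graded_functions_hom_functions)
  show ?thesis
    by unfold_locales (simp add: proj_space_eq fraction_model_fraction_space)
qed

interpretation PS: fraction_fspace hom_functions "proj_space :: (complex^'n) set fspace" proj_points
  by (rule fraction_fspace_proj_space)

definition proj_line :: "complex^'n \<Rightarrow> (complex^'n) set" where
  "proj_line v = {c *s v | c. c \<noteq> 0}"

lemma proj_line_in_points: "v \<noteq> 0 \<Longrightarrow> proj_line v \<in> proj_points"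
  by (auto simp: proj_points_def proj_line_def)

lemma proj_line_eqI: "c \<noteq> 0 \<Longrightarrow> proj_line (c *s v) = proj_line v"
proof
  assume "c \<noteq> 0"
  then show "proj_line (c *s v) \<subseteq> proj_line v"
    unfolding proj_line_def by (auto simp: vector_smult_assoc)
  show "proj_line v \<subseteq> proj_line (c *s v)"
    unfolding proj_line_def
  proof clarify
    fix a :: complex assume "a \<noteq> 0"
    then show "\<exists>b. a *s v = b *s (c *s v) \<and> b \<noteq> 0"
      using \<open>c \<noteq> 0\<close> by (intro exI[of _ "a / c"]) (auto simp: vector_smult_assoc)
  qed
qed

lemma proj_rep_line: "\<exists>c. c \<noteq> 0 \<and> proj_rep (proj_line v) = c *s v"
proof -
  have "1 *s v \<in> proj_line v" unfolding proj_line_def by (auto intro!: exI[of _ 1])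
  then have "proj_rep (proj_line v) \<in> proj_line v" unfolding proj_rep_def by (rule someI)
  then show ?thesis by (auto simp: proj_line_def)
qed

lemma proj_points_cases:
  assumes "x \<in> proj_points"
  obtains v where "v \<noteq> 0" "x = proj_line v"
  using assms by (auto simp: proj_points_def proj_line_def)

lemma proj_line_rep: "x \<in> proj_points \<Longrightarrow> proj_line (proj_rep x) = x"
  using proj_rep_line proj_line_eqI by (metis proj_points_cases)

lemma proj_rep_nonzero: "x \<in> proj_points \<Longrightarrow> proj_rep x \<noteq> 0"
  using proj_rep_line by (metis proj_points_cases vector_mul_eq_0)

lemma homogeneous_poly_line:
  assumes "homogeneous_poly d p" "homogeneous_poly d q"
  shows "q (proj_rep (proj_line v)) \<noteq> 0 \<longleftrightarrow> q v \<noteq> 0"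
    and "p (proj_rep (proj_line v)) / q (proj_rep (proj_line v)) = p v / q v"
proof -
  obtain c where c: "c \<noteq> 0" "proj_rep (proj_line v) = c *s v" using proj_rep_line by blast
  with assms show "q (proj_rep (proj_line v)) \<noteq> 0 \<longleftrightarrow> q v \<noteq> 0"
    and "p (proj_rep (proj_line v)) / q (proj_rep (proj_line v)) = p v / q v"
    unfolding homogeneous_poly_def by auto
qed

text \<open>Proportionality is expressed by minors because the identity principle can show that
  minors vanish.\<close>

lemma proj_line_eq_if_proportional:
  assumes "v \<noteq> 0" "w \<noteq> 0" "\<And>i j. v $ i * w $ j = v $ j * w $ i"
  shows "proj_line v = proj_line w"
proof -
  obtain k where k: "w $ k \<noteq> 0" using assms(2) by (auto simp: vec_eq_iff)
  have eq: "v = (v $ k / w $ k) *s w"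
    using assms(3)[of _ k] k by (auto simp: vec_eq_iff field_simps)
  then have "v $ k / w $ k \<noteq> 0" using assms(1) by force
  then show ?thesis using proj_line_eqI[of "v $ k / w $ k" w] eq by simp
qed

lemma homogeneous_poly_coord: "homogeneous_poly 1 (\<lambda>v. v $ i)"
  unfolding homogeneous_poly_def by (auto intro: generated_algebra.gen)

lemma coord_hom_functions: "(\<lambda>x. proj_rep x $ i) \<in> hom_functions 1"
  unfolding hom_functions_def using homogeneous_poly_coord[of i] by (auto simp: comp_def)

lemma hom_functions_degree_one:
  assumes "x \<in> proj_points"
  shows "\<exists>m\<in>hom_functions 1. m x \<noteq> 0"
proof -
  obtain i where "proj_rep x $ i \<noteq> 0" using proj_rep_nonzero[OF assms] by (auto simp: vec_eq_iff)
  then show ?thesis by (rule bexI[OF _ coord_hom_functions])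
qed

lemma generated_algebra_poly:
  assumes "q \<in> generated_algebra (range (\<lambda>i v. v $ i))"
  shows "\<exists>R. \<forall>s. poly R s = q (\<chi> i. poly (p i) s)"
  using assms
proof induction
  case (const c)
  show ?case by (intro exI[of _ "[:c:]"]) auto
next
  case (gen f)
  then obtain i where "f = (\<lambda>v. v $ i)" by auto
  then show ?case by (intro exI[of _ "p i"]) auto
next
  case (add f g)
  then obtain P Q where "\<forall>s. poly P s = f (\<chi> i. poly (p i) s)" "\<forall>s. poly Q s = g (\<chi> i. poly (p i) s)"
    by blast
  then show ?case by (intro exI[of _ "P + Q"]) auto
next
  case (mult f g)
  then obtain P Q where "\<forall>s. poly P s = f (\<chi> i. poly (p i) s)" "\<forall>s. poly Q s = g (\<chi> i. poly (p i) s)"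
    by blast
  then show ?case by (intro exI[of _ "P * Q"]) auto
qed

text \<open>Cancels the full common power of the linear factor; the degree of the nonzero member
  \<open>p k\<close> drops with each factor. It serves to extend a rational curve over the parameter
  \<open>c\<close> and to reduce fractions there.\<close>

lemma divide_common_zeros:
  fixes p :: "'i \<Rightarrow> complex poly"
  assumes "p k \<noteq> 0"
  shows "\<exists>m q. (\<forall>i. p i = [:-c, 1:] ^ m * q i) \<and> (\<exists>i. poly (q i) c \<noteq> 0)"
  using assms
proof (induction "degree (p k)" arbitrary: p rule: less_induct)
  case less
  show ?case
  proof (cases "\<exists>i. poly (p i) c \<noteq> 0")
    case True
    then show ?thesis by (intro exI[of _ 0] exI[of _ p]) auto
  next
    case False
    then have "\<forall>i. \<exists>r. p i = [:-c, 1:] * r" by (auto simp: poly_eq_0_iff_dvd dvd_def)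
    then obtain r where r: "\<And>i. p i = [:-c, 1:] * r i" by metis
    have "r k \<noteq> 0" using less.prems r[of k] by auto
    then have "degree (p k) = Suc (degree (r k))"
      unfolding r[of k] by (subst degree_mult_eq) auto
    then obtain m q where q: "\<forall>i. r i = [:-c, 1:] ^ m * q i" "\<exists>i. poly (q i) c \<noteq> 0"
      using less.hyps[of r] \<open>r k \<noteq> 0\<close> by auto
    have "p i = [:-c, 1:] ^ Suc m * q i" for i
      unfolding power_Suc mult.assoc using r[of i] q(1) by metis
    with q(2) show ?thesis by blast
  qed
qed

section \<open>Smooth projective curves with a rational coordinate\<close>

text \<open>The maps \<open>\<sigma>\<close> and \<open>\<gamma>\<close> stand for inverse
  birational maps between \<open>Y\<close> and the line. This is expressed by
  \<open>\<sigma> (\<gamma> s) = s\<close> for almost all \<open>s\<close> together with the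
  rationality of pulled back functions.\<close>

locale parametrized_curve =
  fixes Y :: "(complex^'n) set set" and U and \<sigma> and \<gamma> :: "complex \<Rightarrow> (complex^'n) set"
  assumes curve: "smooth_projective_curve Y"
    and U_open: "openin (zar (sub_fspace proj_space Y)) U" and U_nonempty: "U \<noteq> {}"
    and \<sigma>_reg: "\<sigma> \<in> reg (sub_fspace proj_space Y) U"
    and \<sigma>_\<gamma>: "\<forall>\<^sub>F s in cofinite. \<sigma> (\<gamma> s) = s"
    and pull: "openin (zar (sub_fspace proj_space Y)) W \<Longrightarrow> W \<noteq> {} \<Longrightarrow> k \<in> reg (sub_fspace proj_space Y) W \<Longrightarrow>
      \<exists>P Q. \<forall>\<^sub>F s in cofinite. \<gamma> s \<in> W \<and> poly Q s \<noteq> 0 \<and> k (\<gamma> s) = poly P s / poly Q s"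
begin

lemma Y_irreducible: "irreducible_in (zar proj_space) Y" and Y_closed: "closedin (zar proj_space) Y"
  and Y_smooth: "y \<in> Y \<Longrightarrow> smooth_curve_at (sub_fspace proj_space Y) y"
  using curve by (auto simp: smooth_projective_curve_def irreducible_curve_def)

lemma Y_subset: "Y \<subseteq> proj_points"
  using Y_irreducible PS.points_eq by (auto simp: irreducible_in_def)

sublocale rational_fspace hom_functions "sub_fspace proj_space Y" Y \<gamma>
proof -
  interpret F: fraction_fspace hom_functions "sub_fspace proj_space Y" Y
    using PS.sub_fraction_fspace[of Y] Y_subset by (simp add: Int_absorb1)
  show "rational_fspace hom_functions (sub_fspace proj_space Y) Y \<gamma>"
  proof
    fix U W assume "openin (zar (sub_fspace proj_space Y)) U" "openin (zar (sub_fspace proj_space Y)) W"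
      "U \<noteq> {}" "W \<noteq> {}"
    then show "U \<inter> W \<noteq> {}"
      using irreducible_in_open_Int[OF Y_irreducible] by simp
  qed (use hom_functions_degree_one Y_subset pull in auto)
qed

abbreviation V where "V \<equiv> sub_fspace proj_space Y"

text \<open>The rational map \<open>\<gamma>\<close> extends over \<open>c\<close>: ratios of
  coordinates are rational in \<open>s\<close>, denominators are cleared, and the common power of
  \<open>s - c\<close> is cancelled so that the vector does not vanish at \<open>c\<close>.\<close>

lemma homogeneous_coordinates:
  "\<exists>p. (\<exists>i. poly (p i) c \<noteq> 0) \<and>
    (\<forall>\<^sub>F s in cofinite. \<gamma> s \<in> Y \<and> (\<exists>l. l \<noteq> 0 \<and> proj_rep (\<gamma> s) = l *s (\<chi> i. poly (p i) s)))"
proof -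
  obtain y where y: "y \<in> Y" using Y_irreducible by (auto simp: irreducible_in_def)
  then have "proj_rep y \<noteq> 0" using Y_subset proj_rep_nonzero by blast
  then obtain k where k: "proj_rep y $ k \<noteq> 0" by (auto simp: vec_eq_iff)
  define W where "W = {y \<in> Y. proj_rep y $ k \<noteq> 0}"
  have W: "openin (zar V) W" "W \<noteq> {}"
    unfolding W_def using openin_basic[OF coord_hom_functions[of k]] y k by auto
  have "(\<lambda>y. proj_rep y $ i / proj_rep y $ k) \<in> reg V W" for i
    using W by (intro reg_quotient[OF coord_hom_functions coord_hom_functions]) (auto simp: W_def)
  then have "\<forall>i. \<exists>P Q. \<forall>\<^sub>F s in cofinite. \<gamma> s \<in> W \<and> poly Q s \<noteq> 0 \<and>
      proj_rep (\<gamma> s) $ i / proj_rep (\<gamma> s) $ k = poly P s / poly Q s"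
    using pullback[OF W] by blast
  then obtain P Q where PQ: "\<And>i. \<forall>\<^sub>F s in cofinite. \<gamma> s \<in> W \<and> poly (Q i) s \<noteq> 0 \<and>
      proj_rep (\<gamma> s) $ i / proj_rep (\<gamma> s) $ k = poly (P i) s / poly (Q i) s"
    unfolding choice_iff by blast
  \<comment> \<open>Each numerator is multiplied by the denominators of all other coordinates, so
    the product of all \<open>Q j\<close> is a common denominator.\<close>
  define p where "p = (\<lambda>i. P i * (\<Prod>j\<in>UNIV - {i}. Q j))"
  have "\<forall>\<^sub>F s in cofinite. \<forall>i. \<gamma> s \<in> W \<and> poly (Q i) s \<noteq> 0 \<and>
      proj_rep (\<gamma> s) $ i / proj_rep (\<gamma> s) $ k = poly (P i) s / poly (Q i) s"
    using PQ by (intro eventually_all_finite)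
  then have p: "\<forall>\<^sub>F s in cofinite. \<gamma> s \<in> W \<and> (\<exists>l. l \<noteq> 0 \<and> proj_rep (\<gamma> s) = l *s (\<chi> i. poly (p i) s))"
  proof eventually_elim
    case (elim s)
    let ?Q = "\<Prod>j\<in>UNIV. poly (Q j) s"
    have nz: "proj_rep (\<gamma> s) $ k \<noteq> 0" "?Q \<noteq> 0" using elim by (auto simp: W_def)
    have coord: "proj_rep (\<gamma> s) $ i = proj_rep (\<gamma> s) $ k / ?Q * poly (p i) s" for i
    proof -
      define R where "R = (\<Prod>j\<in>UNIV - {i}. poly (Q j) s)"
      have Q: "?Q = poly (Q i) s * R"
        unfolding R_def by (rule prod.remove) auto
      have p: "poly (p i) s = poly (P i) s * R"
        by (simp add: p_def poly_prod R_def)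
      have "proj_rep (\<gamma> s) $ i = poly (P i) s / poly (Q i) s * proj_rep (\<gamma> s) $ k"
        using elim nz by (metis nonzero_eq_divide_eq)
      moreover have "R \<noteq> 0" using nz(2) unfolding Q by auto
      ultimately show ?thesis unfolding Q p by simp
    qed
    have "proj_rep (\<gamma> s) = (proj_rep (\<gamma> s) $ k / ?Q) *s (\<chi> i. poly (p i) s)"
      unfolding vec_eq_iff vector_smult_component vec_lambda_beta using coord by blast
    then show ?case using elim nz by (intro conjI exI[of _ "proj_rep (\<gamma> s) $ k / ?Q"]) auto
  qed
  have "p k \<noteq> 0"
  proof
    assume pk: "p k = 0"
    from p have "\<forall>\<^sub>F s::complex in cofinite. False"
    proof eventually_elim
      case (elim s)
      then obtain l where "\<gamma> s \<in> W" "proj_rep (\<gamma> s) = l *s (\<chi> i. poly (p i) s)" by blast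
      then show ?case using pk by (auto simp: W_def)
    qed
    then show False using not_eventually_False_cofinite by blast
  qed
  then obtain m q where q: "\<forall>i. p i = [:-c, 1:] ^ m * q i" "\<exists>i. poly (q i) c \<noteq> 0"
    using divide_common_zeros[of p k c] by blast
  have "\<forall>\<^sub>F s in cofinite. poly [:-c, 1:] s \<noteq> 0" by (rule eventually_poly_nonzero) auto
  with p have "\<forall>\<^sub>F s in cofinite. \<gamma> s \<in> Y \<and> (\<exists>l. l \<noteq> 0 \<and> proj_rep (\<gamma> s) = l *s (\<chi> i. poly (q i) s))"
  proof eventually_elim
    case (elim s)
    then obtain l where l: "\<gamma> s \<in> W" "l \<noteq> 0" "proj_rep (\<gamma> s) = l *s (\<chi> i. poly (p i) s)" by blast
    have "(\<chi> i. poly (p i) s) = (s - c) ^ m *s (\<chi> i. poly (q i) s)"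
      using q(1) by (simp add: vec_eq_iff)
    then have "proj_rep (\<gamma> s) = (l * (s - c) ^ m) *s (\<chi> i. poly (q i) s)"
      using l by (simp add: vector_smult_assoc)
    then show ?case using l elim by (intro conjI exI[of _ "l * (s - c) ^ m"]) (auto simp: W_def)
  qed
  with q(2) show ?thesis by blast
qed

text \<open>The point is the one that the extended curve \<open>P\<close> reaches at
  \<open>c\<close>. Its value is found by pulling a local expression of \<open>\<sigma>\<close> back
  along \<open>\<gamma>\<close>, its uniqueness by minors.\<close>

theorem unique_point_with_value: "\<exists>!x. x \<in> Y \<and> has_value_at V U \<sigma> x c"
proof -
  obtain p where p0: "\<exists>i. poly (p i) c \<noteq> 0"
    and p: "\<forall>\<^sub>F s in cofinite. \<gamma> s \<in> Y \<and> (\<exists>l. l \<noteq> 0 \<and> proj_rep (\<gamma> s) = l *s (\<chi> i. poly (p i) s))"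
    using homogeneous_coordinates by blast
  define P where "P = (\<lambda>s. \<chi> i. poly (p i) s)"
  have Pc: "P c \<noteq> 0" using p0 by (auto simp: P_def vec_eq_iff)
  define x where "x = proj_line (P c)"
  have x: "x \<in> proj_points" unfolding x_def using Pc by (rule proj_line_in_points)
  \<comment> \<open>Otherwise some form is nonzero at \<open>x\<close> but zero on the closed set
    \<open>Y\<close>; it would vanish at \<open>P s\<close> for almost all \<open>s\<close>, hence
    at \<open>P c\<close>.\<close>
  have xY: "x \<in> Y"
  proof (rule ccontr)
    assume "x \<notin> Y"
    then have "x \<in> proj_points - Y" using x by blast
    moreover have "openin (zar proj_space) (proj_points - Y)"
      using Y_closed PS.points_eq by (metis closedin_def)
    ultimately obtain d q where q: "q \<in> hom_functions d" "q x \<noteq> 0" "{y \<in> proj_points. q y \<noteq> 0} \<subseteq> proj_points - Y"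
      using PS.openin_basic_nbhd by blast
    then obtain r where r: "q = r \<circ> proj_rep" "homogeneous_poly d r" by (auto simp: hom_functions_def)
    obtain R where R: "\<And>s. poly R s = r (P s)"
      using generated_algebra_poly[of r p] r(2) unfolding P_def homogeneous_poly_def by blast
    have "r (P c) \<noteq> 0" using homogeneous_poly_line(1)[OF r(2,2)] q(2) r(1) unfolding x_def by auto
    then have "R \<noteq> 0" using R[of c] by auto
    from eventually_poly_nonzero[OF this] p have "\<forall>\<^sub>F s::complex in cofinite. False"
    proof eventually_elim
      case (elim s)
      then obtain l where l: "\<gamma> s \<in> Y" "l \<noteq> 0" "proj_rep (\<gamma> s) = l *s P s" by (auto simp: P_def)
      then have "q (\<gamma> s) = l ^ d * poly R s" using r R by (auto simp: homogeneous_poly_def)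
      then have "q (\<gamma> s) \<noteq> 0" using l elim by auto
      then show ?case using q(3) l(1) Y_subset by blast
    qed
    then show False using not_eventually_False_cofinite by blast
  qed
  have pull_x: "\<exists>A B. poly B c \<noteq> 0 \<and> k x = poly A c / poly B c \<and>
      (\<forall>\<^sub>F s in cofinite. poly B s \<noteq> 0 \<and> k (\<gamma> s) = poly A s / poly B s)"
    if W: "openin (zar V) W" "x \<in> W" and k: "k \<in> reg V W" for W k
  proof -
    from k W obtain d f g where fg: "f \<in> hom_functions d" "g \<in> hom_functions d" "g x \<noteq> 0"
      "\<And>y. y \<in> W \<Longrightarrow> g y \<noteq> 0 \<Longrightarrow> k y = f y / g y" by (rule regE) blast
    obtain a b where ab: "f = a \<circ> proj_rep" "g = b \<circ> proj_rep" "homogeneous_poly d a" "homogeneous_poly d b"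
      using fg(1,2) by (auto simp: hom_functions_def)
    obtain A where A: "\<And>s. poly A s = a (P s)"
      using generated_algebra_poly[of a p] ab(3) unfolding P_def homogeneous_poly_def by blast
    obtain B where B: "\<And>s. poly B s = b (P s)"
      using generated_algebra_poly[of b p] ab(4) unfolding P_def homogeneous_poly_def by blast
    have Bc: "poly B c \<noteq> 0"
      using fg(3) homogeneous_poly_line(1)[OF ab(4,4)] unfolding B x_def ab by auto
    have "k x = poly A c / poly B c"
      using fg(4)[OF W(2) fg(3)] homogeneous_poly_line(2)[OF ab(3,4)] unfolding A B ab x_def by auto
    moreover have "B \<noteq> 0" using Bc by auto
    have "\<forall>\<^sub>F s in cofinite. \<gamma> s \<in> W" using W by (intro eventually_param_in) auto
    with p eventually_poly_nonzero[OF \<open>B \<noteq> 0\<close>]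
    have "\<forall>\<^sub>F s in cofinite. poly B s \<noteq> 0 \<and> k (\<gamma> s) = poly A s / poly B s"
    proof eventually_elim
      case (elim s)
      then obtain l where l: "l \<noteq> 0" "proj_rep (\<gamma> s) = l *s P s" by (auto simp: P_def)
      then have "f (\<gamma> s) = l ^ d * poly A s" "g (\<gamma> s) = l ^ d * poly B s"
        using ab A B by (auto simp: homogeneous_poly_def)
      then show ?case using fg(4)[of "\<gamma> s"] elim l by auto
    qed
    ultimately show ?thesis using Bc by blast
  qed
  have \<gamma>U: "\<forall>\<^sub>F s in cofinite. \<gamma> s \<in> U" using U_open U_nonempty by (rule eventually_param_in)
  \<comment> \<open>A local expression of \<open>\<sigma>\<close> pulls back to the identity in
    \<open>s\<close>, so a value can only be \<open>c\<close>, while a pole would make the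
    denominator \<open>B\<close> vanish at \<open>c\<close>.\<close>
  have "has_value_at V U \<sigma> x c"
    using has_value_or_pole_at[OF Y_smooth[OF xY] U_open U_nonempty \<sigma>_reg]
  proof
    assume "\<exists>c'. has_value_at V U \<sigma> x c'"
    then obtain c' where c': "has_value_at V U \<sigma> x c'" by blast
    then obtain W h where W: "openin (zar V) W" "x \<in> W" "h \<in> reg V W" "h x = c'" "\<forall>y\<in>W \<inter> U. \<sigma> y = h y"
      unfolding has_value_at_def by blast
    obtain A B where AB: "poly B c \<noteq> 0" "h x = poly A c / poly B c"
      "\<forall>\<^sub>F s in cofinite. poly B s \<noteq> 0 \<and> h (\<gamma> s) = poly A s / poly B s"
      using pull_x[OF W(1-3)] by blast
    have "\<forall>\<^sub>F s in cofinite. \<gamma> s \<in> W" using W by (intro eventually_param_in) auto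
    with AB(3) \<sigma>_\<gamma> \<gamma>U have "\<forall>\<^sub>F s in cofinite. poly ([:0, 1:] * B) s = poly A s"
    proof eventually_elim
      case (elim s)
      then have "s = h (\<gamma> s)" using W(5) by (metis IntI)
      then show ?case using elim by (simp add: field_simps)
    qed
    then have "[:0, 1:] * B = A" by (rule eventually_cofinite_poly_eqD)
    then have "poly A c = c * poly B c" by auto
    then show ?thesis using c' AB W(4) by simp
  next
    assume "has_pole_at V U \<sigma> x"
    then obtain W h where W: "openin (zar V) W" "x \<in> W" "h \<in> reg V W" "h x = 0" "\<forall>y\<in>W \<inter> U. h y * \<sigma> y = 1"
      unfolding has_pole_at_def by blast
    obtain A B where AB: "poly B c \<noteq> 0" "h x = poly A c / poly B c"
      "\<forall>\<^sub>F s in cofinite. poly B s \<noteq> 0 \<and> h (\<gamma> s) = poly A s / poly B s"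
      using pull_x[OF W(1-3)] by blast
    have "\<forall>\<^sub>F s in cofinite. \<gamma> s \<in> W" using W by (intro eventually_param_in) auto
    with AB(3) \<sigma>_\<gamma> \<gamma>U have "\<forall>\<^sub>F s in cofinite. poly (A * [:0, 1:]) s = poly B s"
    proof eventually_elim
      case (elim s)
      then have "h (\<gamma> s) * s = 1" using W(5) by (metis IntI)
      then show ?case using elim by (simp add: field_simps)
    qed
    then have "A * [:0, 1:] = B" by (rule eventually_cofinite_poly_eqD)
    then have "poly B c = poly A c * c" by auto
    then show ?thesis using AB W(4) by simp
  qed
  moreover have "x' = x" if x': "x' \<in> Y" "has_value_at V U \<sigma> x' c" for x'
  proof -
    obtain W h where W: "openin (zar V) W" "x' \<in> W" "h \<in> reg V W" "h x' = c" "\<forall>y\<in>W \<inter> U. \<sigma> y = h y"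
      using x'(2) unfolding has_value_at_def by blast
    have x'P: "x' \<in> proj_points" using x' Y_subset by blast
    then obtain m where m: "proj_rep x' $ m \<noteq> 0" using proj_rep_nonzero[OF x'P] by (auto simp: vec_eq_iff)
    define W' where "W' = W \<inter> {y \<in> Y. proj_rep y $ m \<noteq> 0}"
    have W': "openin (zar V) W'" "x' \<in> W'"
      unfolding W'_def using W openin_basic[OF coord_hom_functions[of m]] x' m by auto
    have hW': "h \<in> reg V W'" by (rule reg_restrict[OF W(3,1) W'(1)]) (auto simp: W'_def)
    have "proj_rep x' $ i * P c $ j = proj_rep x' $ j * P c $ i" for i j
    proof -
      \<comment> \<open>A minor of the coordinates of \<open>y\<close> against
        \<open>P (h y)\<close>, where \<open>h\<close> extends \<open>\<sigma>\<close> to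
        \<open>x'\<close>. It vanishes along \<open>\<gamma>\<close>, hence at \<open>x'\<close>,
        where \<open>h\<close> has the value \<open>c\<close>.\<close>
      define F where "F = (\<lambda>y. proj_rep y $ i / proj_rep y $ m * poly (p j) (h y)
        - proj_rep y $ j / proj_rep y $ m * poly (p i) (h y))"
      have "F x' = 0"
      proof (rule identity_param[OF W'(1) _ _ W'(2)])
        show "F \<in> reg V W'"
          unfolding F_def using W' hW'
          by (intro reg_diff reg_mult reg_poly reg_quotient[OF coord_hom_functions coord_hom_functions]) (auto simp: W'_def)
        show "\<forall>\<^sub>F s in cofinite. \<gamma> s \<in> W' \<longrightarrow> F (\<gamma> s) = 0"
          using p \<sigma>_\<gamma> \<gamma>U
        proof eventually_elim
          case (elim s)
          show ?case
          proof
            assume "\<gamma> s \<in> W'"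
            then have "h (\<gamma> s) = s" using elim W(5) by (auto simp: W'_def)
            moreover obtain l where "proj_rep (\<gamma> s) = l *s P s" using elim by (auto simp: P_def)
            ultimately show "F (\<gamma> s) = 0" by (simp add: F_def P_def)
          qed
        qed
      qed
      then show ?thesis using m W(4) by (simp add: F_def P_def field_simps)
    qed
    then have "proj_line (proj_rep x') = x"
      unfolding x_def using proj_rep_nonzero[OF x'P] Pc by (intro proj_line_eq_if_proportional)
    then show ?thesis using proj_line_rep[OF x'P] by simp
  qed
  ultimately show ?thesis using xY by blast
qed

end

section \<open>The projective line\<close>

text \<open>The subspace carries the cofinite topology, so its irreducible closed proper subsets are
  points, and a longest chain consists of a point and \<open>C\<close>.\<close>

lemma cofinite_irreducible_dim_one:
  assumes C: "closedin T C" "infinite C"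
    and cases: "\<And>A. closedin T A \<Longrightarrow> C \<subseteq> A \<or> finite (A \<inter> C)"
    and points: "\<And>x. x \<in> C \<Longrightarrow> closedin T {x}"
  shows "irreducible_in T C" "krull_dim (subtopology T C) = 1"
proof -
  let ?T = "subtopology T C"
  have CT: "C \<subseteq> topspace T" using C(1) by (rule closedin_subset)
  then have top: "topspace ?T = C" by auto
  show "irreducible_in T C"
    unfolding irreducible_in_def
  proof (intro conjI allI impI)
    fix A B assume AB: "closedin T A \<and> closedin T B \<and> C \<subseteq> A \<union> B"
    show "C \<subseteq> A \<or> C \<subseteq> B"
    proof (rule ccontr)
      assume "\<not> (C \<subseteq> A \<or> C \<subseteq> B)"
      then have "finite (A \<inter> C)" "finite (B \<inter> C)" using AB cases by blast+
      then have "finite ((A \<inter> C) \<union> (B \<inter> C))" by simp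
      moreover have "(A \<inter> C) \<union> (B \<inter> C) = C" using AB by blast
      ultimately show False using C(2) by simp
    qed
  qed (use C CT in auto)
  have closed_sub: "closedin ?T A \<longleftrightarrow> closedin T A \<and> A \<subseteq> C" for A
    using closedin_closed_subtopology[OF C(1)] .
  have irr_C: "irreducible_in ?T C"
    using \<open>irreducible_in T C\<close> unfolding irreducible_in_def top closed_sub by blast
  have singleton: "\<exists>x. Z = {x}" if Z: "irreducible_in ?T Z" "closedin ?T Z" "Z \<noteq> C" for Z
  proof -
    have "Z \<subseteq> C" "closedin T Z" "Z \<noteq> {}" using Z closed_sub by (auto simp: irreducible_in_def)
    then have fin: "finite Z" using cases[of Z] Z(3) by (auto simp: Int_absorb2)
    obtain x where x: "x \<in> Z" using \<open>Z \<noteq> {}\<close> by blast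
    have sing: "closedin ?T {y}" if "y \<in> Z" for y
      using that \<open>Z \<subseteq> C\<close> points closed_sub by auto
    have "closedin ?T (\<Union>y\<in>Z - {x}. {y})" using fin sing by (intro closedin_Union) auto
    moreover have "(\<Union>y\<in>Z - {x}. {y}) = Z - {x}" by auto
    ultimately have "closedin ?T (Z - {x})" by simp
    moreover have "Z \<subseteq> {x} \<union> (Z - {x})" by blast
    ultimately have "Z \<subseteq> {x} \<or> Z \<subseteq> Z - {x}"
      using Z(1) sing[OF x] unfolding irreducible_in_def by blast
    then show ?thesis using x by blast
  qed
  let ?D = "{enat n | n Z. (\<forall>i\<le>n. closedin ?T (Z i) \<and> irreducible_in ?T (Z i)) \<and> (\<forall>i<n. Z i \<subset> Z (Suc i))}"
  have "Sup ?D \<le> 1"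
  proof (rule Sup_least)
    fix d assume "d \<in> ?D"
    then obtain n Z where n: "d = enat n" "\<forall>i\<le>n. closedin ?T (Z i) \<and> irreducible_in ?T (Z i)"
      "\<forall>i<n. Z i \<subset> Z (Suc i)" by blast
    have "n \<le> 1"
    proof (rule ccontr)
      assume "\<not> n \<le> 1"
      then have Z: "Z 0 \<subset> Z 1" "Z 1 \<subset> Z 2" "closedin ?T (Z 2)"
        "closedin ?T (Z 1)" "irreducible_in ?T (Z 1)" "irreducible_in ?T (Z 0)"
        using n(2,3) by (auto simp: numeral_2_eq_2)
      then have "Z 1 \<noteq> C" using closed_sub by blast
      then obtain x where "Z 1 = {x}" using singleton Z by blast
      then have "Z 0 = {}" using Z(1) by auto
      then show False using Z(6) by (simp add: irreducible_in_def)
    qed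
    then show "d \<le> 1" using n(1) by (simp add: one_enat_def)
  qed
  moreover have "1 \<le> Sup ?D"
  proof (rule Sup_upper)
    obtain x where x: "x \<in> C" using C(2) by (metis finite.emptyI ex_in_conv)
    define Z where "Z = (\<lambda>i::nat. if i = 0 then {x} else C)"
    have "{x} \<noteq> C" using C(2) by (metis finite.emptyI finite_insert)
    then have "\<forall>i<1. Z i \<subset> Z (Suc i)" using x by (auto simp: Z_def)
    moreover have "closedin ?T (Z i) \<and> irreducible_in ?T (Z i)" for i
      using x irr_C points closed_sub C(1) top by (auto simp: Z_def irreducible_in_def)
    ultimately show "1 \<in> ?D" unfolding one_enat_def by blast
  qed
  ultimately show "krull_dim ?T = 1" unfolding krull_dim_def by (rule antisym)
qed

lemma two_cases: "k \<noteq> l \<Longrightarrow> i = k \<or> i = l" for i k l :: 2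
  by (metis exhaust_2)

lemma exists_other: "\<exists>l. l \<noteq> k" for k :: 2
  by (cases "k = 1") (auto intro: exI[of _ 1] exI[of _ 2])

definition chart :: "2 \<Rightarrow> complex \<Rightarrow> complex^2" where
  "chart k s = (\<chi> i. if i = k then 1 else s)"

lemma chart_nonzero: "chart k s \<noteq> 0"
  by (auto simp: chart_def vec_eq_iff)

lemma chart_scale: "k \<noteq> l \<Longrightarrow> v $ k \<noteq> 0 \<Longrightarrow> v = v $ k *s chart k (v $ l / v $ k)"
  using two_cases[of k l] by (auto simp: chart_def vec_eq_iff)

lemma proj_line_chart:
  assumes "x \<in> proj_points" "proj_rep x $ k \<noteq> 0" "k \<noteq> l"
  shows "x = proj_line (chart k (proj_rep x $ l / proj_rep x $ k))"
  using proj_line_rep[OF assms(1)] chart_scale[OF assms(3,2)] proj_line_eqI[OF assms(2)] by metis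

lemma proj_points_chart_cases:
  fixes x :: "(complex^2) set"
  assumes "x \<in> proj_points"
  obtains k s where "x = proj_line (chart k s)"
proof -
  obtain k where k: "proj_rep x $ k \<noteq> 0" using proj_rep_nonzero[OF assms] by (auto simp: vec_eq_iff)
  obtain l where "k \<noteq> l" using exists_other[of k] by metis
  then show ?thesis using that proj_line_chart[OF assms k] by blast
qed

lemma homogeneous_poly_chart:
  assumes "homogeneous_poly d p"
  shows "\<exists>P. \<forall>s. poly P s = p (chart k s)"
proof -
  have "(\<chi> i. poly (if i = k then 1 else [:0, 1:]) s) = chart k s" for s
    by (simp add: chart_def vec_eq_iff)
  then show ?thesis
    using generated_algebra_poly[of p "\<lambda>i. if i = k then 1 else [:0, 1:]"] assms
    unfolding homogeneous_poly_def by metis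
qed

text \<open>The charts overlap through \<open>s \<mapsto> 1 / s\<close>, so the polynomial on the
  other chart vanishes off 0 and therefore identically.\<close>

lemma homogeneous_poly_other_chart:
  assumes p: "homogeneous_poly d p" and kl: "k \<noteq> l" and zero: "\<And>s. p (chart k s) = 0"
  shows "p (chart l s) = 0"
proof -
  obtain P where P: "\<And>s. poly P s = p (chart l s)" using homogeneous_poly_chart[OF p] by blast
  have "poly P s = poly 0 s" if "s \<noteq> 0" for s
  proof -
    have "chart l s = s *s chart k (1 / s)"
      using chart_scale[OF kl, of "chart l s"] that kl by (simp add: chart_def)
    then show ?thesis unfolding P using p zero by (simp add: homogeneous_poly_def)
  qed
  then have "{s. poly P s \<noteq> poly 0 s} \<subseteq> {0}" by blast
  then have "\<forall>\<^sub>F s in cofinite. poly P s = poly 0 s"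
    unfolding eventually_cofinite by (rule finite_subset) simp
  then have "P = 0" by (rule eventually_cofinite_poly_eqD)
  then show ?thesis using P[of s] by simp
qed

text \<open>A form restricts to a polynomial on each of the two charts, and being nonzero at one
  point makes both polynomials nonzero.\<close>

lemma finite_zeros_projective_line:
  fixes x :: "(complex^2) set"
  assumes q: "q \<in> hom_functions d" and x: "x \<in> proj_points" "q x \<noteq> 0"
  shows "finite {y \<in> proj_points. q y = 0}"
proof -
  obtain r where r: "q = r \<circ> proj_rep" "homogeneous_poly d r" using q by (auto simp: hom_functions_def)
  have q_line: "q (proj_line v) \<noteq> 0 \<longleftrightarrow> r v \<noteq> 0" for v
    using homogeneous_poly_line(1)[OF r(2,2)] r(1) by simp
  obtain k s where ks: "x = proj_line (chart k s)" using x(1) by (rule proj_points_chart_cases)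
  have nz: "\<exists>s. r (chart l s) \<noteq> 0" for l
  proof (cases "l = k")
    case True
    then show ?thesis using x(2) q_line ks by blast
  next
    case False
    then show ?thesis using homogeneous_poly_other_chart[OF r(2) False] x(2) q_line ks by blast
  qed
  have fin: "finite {s. r (chart l s) = 0}" for l
  proof -
    obtain R where R: "\<And>s. poly R s = r (chart l s)" using homogeneous_poly_chart[OF r(2)] by blast
    then have "R \<noteq> 0" using nz[of l] by (metis poly_0)
    then show ?thesis using poly_roots_finite[of R] R by simp
  qed
  have "{y \<in> proj_points. q y = 0} \<subseteq> (\<Union>l. (\<lambda>s. proj_line (chart l s)) ` {s. r (chart l s) = 0})"
  proof
    fix y :: "(complex^2) set" assume y: "y \<in> {y \<in> proj_points. q y = 0}"
    then obtain l s where "y = proj_line (chart l s)" using proj_points_chart_cases by blast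
    then show "y \<in> (\<Union>l. (\<lambda>s. proj_line (chart l s)) ` {s. r (chart l s) = 0})"
      using y q_line by blast
  qed
  then show ?thesis by (rule finite_subset) (use fin in auto)
qed

text \<open>\<open>N\<close> may exceed the degree of \<open>P\<close>, so that numerators and
  denominators can be brought to a common degree.\<close>

definition homogenize :: "2 \<Rightarrow> 2 \<Rightarrow> nat \<Rightarrow> complex poly \<Rightarrow> complex^2 \<Rightarrow> complex" where
  "homogenize k l N P v = (\<Sum>i\<le>N. coeff P i * v $ l ^ i * v $ k ^ (N - i))"

lemma homogeneous_poly_homogenize: "homogeneous_poly N (homogenize k l N P)"
  unfolding homogeneous_poly_def
proof (intro conjI allI)
  show "homogenize k l N P \<in> generated_algebra (range (\<lambda>i v. v $ i))"
    unfolding homogenize_def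
    by (intro generated_algebra_sum generated_algebra.mult generated_algebra_power generated_algebra.const
        generated_algebra.gen) auto
  fix c v
  have "coeff P i * (c *s v) $ l ^ i * (c *s v) $ k ^ (N - i)
      = c ^ N * (coeff P i * v $ l ^ i * v $ k ^ (N - i))" if "i \<le> N" for i
  proof -
    have "c ^ N = c ^ i * c ^ (N - i)" using that by (simp flip: power_add)
    then show ?thesis by (simp add: power_mult_distrib)
  qed
  then show "homogenize k l N P (c *s v) = c ^ N * homogenize k l N P v"
    unfolding homogenize_def sum_distrib_left by (intro sum.cong) auto
qed

lemma homogenize_eq:
  assumes "v $ k \<noteq> 0" "degree P \<le> N"
  shows "homogenize k l N P v = v $ k ^ N * poly P (v $ l / v $ k)"
proof -
  have "poly P (v $ l / v $ k) = (\<Sum>i\<le>N. coeff P i * (v $ l / v $ k) ^ i)"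
    unfolding poly_altdef using assms(2)
    by (intro sum.mono_neutral_left) (auto simp: coeff_eq_0)
  moreover have "v $ l ^ i * v $ k ^ (N - i) = v $ k ^ N * (v $ l / v $ k) ^ i" if "i \<le> N" for i
  proof -
    have "v $ k ^ N = v $ k ^ i * v $ k ^ (N - i)" using that by (simp flip: power_add)
    then show ?thesis using assms(1) by (simp add: power_divide)
  qed
  ultimately show ?thesis
    unfolding homogenize_def by (simp add: sum_distrib_left mult.assoc mult.left_commute)
qed

lemma homogenize_hom_functions: "homogenize k l N P \<circ> proj_rep \<in> hom_functions N"
  unfolding hom_functions_def using homogeneous_poly_homogenize by blast

text \<open>The uniformizer is the affine coordinate minus its value \<open>a\<close> at
  \<open>x\<close>. A form vanishing at \<open>x\<close> restricts to a polynomial divisible by the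
  corresponding linear factor, and the cofactor is homogenized to become a fraction again.\<close>

lemma smooth_projective_line:
  fixes x :: "(complex^2) set"
  assumes x: "x \<in> proj_points"
  shows "smooth_curve_at (sub_fspace proj_space proj_points) x"
proof -
  let ?V = "sub_fspace proj_space (proj_points :: (complex^2) set set)"
  interpret F: fraction_fspace hom_functions ?V "proj_points :: (complex^2) set set"
    using PS.sub_fraction_fspace[of proj_points] by simp
  obtain k where k: "proj_rep x $ k \<noteq> 0" using proj_rep_nonzero[OF x] by (auto simp: vec_eq_iff)
  obtain l where kl: "k \<noteq> l" using exists_other[of k] by metis
  define a where "a = proj_rep x $ l / proj_rep x $ k"
  define U :: "(complex^2) set set" where "U = {y \<in> proj_points. proj_rep y $ k \<noteq> 0}"
  define u where "u = (\<lambda>y::(complex^2) set. proj_rep y $ l / proj_rep y $ k - a)"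
  have U: "openin (zar ?V) U" "x \<in> U"
    unfolding U_def using F.openin_basic[OF coord_hom_functions] x k by auto
  have u: "u \<in> reg ?V U"
    unfolding u_def using U
    by (intro F.reg_diff F.reg_const F.reg_quotient[OF coord_hom_functions coord_hom_functions]) (auto simp: U_def)
  have "\<exists>W' h. openin (zar ?V) W' \<and> x \<in> W' \<and> W' \<subseteq> U \<inter> W \<and> h \<in> reg ?V W' \<and> (\<forall>y\<in>W'. g y = u y * h y)"
    if W: "openin (zar ?V) W" "x \<in> W" and g: "g \<in> reg ?V W" "g x = 0" for W g
  proof -
    from g(1) W obtain d p q where pq: "p \<in> hom_functions d" "q \<in> hom_functions d" "q x \<noteq> 0"
      "\<And>y. y \<in> W \<Longrightarrow> q y \<noteq> 0 \<Longrightarrow> g y = p y / q y" by (rule F.regE) blast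
    obtain r where r: "p = r \<circ> proj_rep" "homogeneous_poly d r"
      using pq(1) by (auto simp: hom_functions_def)
    obtain P where P: "\<And>s. poly P s = r (chart k s)" using homogeneous_poly_chart[OF r(2)] by blast
    have p_eq: "p y = proj_rep y $ k ^ d * poly P (proj_rep y $ l / proj_rep y $ k)" if "y \<in> U" for y
    proof -
      have "proj_rep y = proj_rep y $ k *s chart k (proj_rep y $ l / proj_rep y $ k)"
        using chart_scale[OF kl] that by (auto simp: U_def)
      then have "r (proj_rep y) = proj_rep y $ k ^ d * r (chart k (proj_rep y $ l / proj_rep y $ k))"
        using r(2) unfolding homogeneous_poly_def by metis
      then show ?thesis by (simp add: r(1) P)
    qed
    have "p x = 0" using g(2) pq(3) pq(4)[OF W(2) pq(3)] by auto
    then have "poly P a = 0" using p_eq[OF U(2)] k unfolding a_def by auto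
    then obtain P1 where P1: "P = [:-a, 1:] * P1" by (auto simp: poly_eq_0_iff_dvd dvd_def)
    \<comment> \<open>The successor keeps \<open>N\<close> positive, so that a nonzero
      \<open>den\<close> forces the coordinate \<open>k\<close> to be nonzero and \<open>W'\<close>
      to lie in \<open>U\<close>.\<close>
    define N where "N = Suc (degree P1)"
    define num where "num = (\<lambda>y. (proj_rep y $ k) ^ d * (homogenize k l N P1 \<circ> proj_rep) y)"
    define den where "den = (\<lambda>y. q y * (proj_rep y $ k) ^ N)"
    have num: "num \<in> hom_functions (d + N)"
      unfolding num_def using PS.mult[OF PS.power[OF coord_hom_functions] homogenize_hom_functions] by simp
    have den: "den \<in> hom_functions (d + N)"
      unfolding den_def using PS.mult[OF pq(2) PS.power[OF coord_hom_functions]] by simp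
    define W' where "W' = W \<inter> {y \<in> proj_points. den y \<noteq> 0}"
    have W': "openin (zar ?V) W'" "x \<in> W'"
      unfolding W'_def using W F.openin_basic[OF den] x k pq(3) by (auto simp: den_def)
    have W'U: "W' \<subseteq> U \<inter> W"
    proof
      fix y assume y: "y \<in> W'"
      have "proj_rep y $ k \<noteq> 0" using y by (auto simp: W'_def den_def N_def)
      then show "y \<in> U \<inter> W" using y by (auto simp: W'_def U_def)
    qed
    have "(\<lambda>y. num y / den y) \<in> reg ?V W'"
      using num den W' by (intro F.reg_quotient) (auto simp: W'_def)
    moreover have "g y = u y * (num y / den y)" if y: "y \<in> W'" for y
    proof -
      have yU: "y \<in> U" "y \<in> W" and nz: "proj_rep y $ k \<noteq> 0" "q y \<noteq> 0"
        using y W'U by (auto simp: W'_def den_def U_def)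
      have "homogenize k l N P1 (proj_rep y) = proj_rep y $ k ^ N * poly P1 (proj_rep y $ l / proj_rep y $ k)"
        using nz by (intro homogenize_eq) (auto simp: N_def)
      then have "num y / den y = proj_rep y $ k ^ d * poly P1 (proj_rep y $ l / proj_rep y $ k) / q y"
        using nz by (simp add: num_def den_def)
      then show ?thesis
        using pq(4)[OF yU(2) nz(2)] p_eq[OF yU(1)] by (simp add: P1 u_def algebra_simps)
    qed
    ultimately show ?thesis using W' W'U by blast
  qed
  moreover have "u x = 0" by (simp add: u_def a_def)
  ultimately have "uniformizer ?V x U u"
    unfolding uniformizer_def using U u by blast
  then show ?thesis unfolding smooth_curve_at_iff by blast
qed

section \<open>Traces in \<open>SL\<^sub>2\<close>\<close>

definition mat2 :: "complex \<Rightarrow> complex \<Rightarrow> complex \<Rightarrow> complex \<Rightarrow> complex^2^2" where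
  "mat2 a b c d = (\<chi> i j. if i = 1 then if j = 1 then a else b else if j = 1 then c else d)"

text \<open>The inverse for determinant one, but polynomial in the entries for all matrices, so
  trace identities become polynomial identities.\<close>

definition adj2 :: "complex^2^2 \<Rightarrow> complex^2^2" where
  "adj2 M = mat2 (M $ 2 $ 2) (- M $ 1 $ 2) (- M $ 2 $ 1) (M $ 1 $ 1)"

definition smat :: "complex \<Rightarrow> complex^2^2 \<Rightarrow> complex^2^2" where
  "smat c M = (\<chi> i j. c * M $ i $ j)"

lemma mat2_component [simp]:
  "mat2 a b c d $ 1 $ 1 = a" "mat2 a b c d $ 1 $ 2 = b" "mat2 a b c d $ 2 $ 1 = c" "mat2 a b c d $ 2 $ 2 = d"
  by (simp_all add: mat2_def)

lemma mat2_cases: obtains a b c d where "M = mat2 a b c d"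
proof
  show "M = mat2 (M $ 1 $ 1) (M $ 1 $ 2) (M $ 2 $ 1) (M $ 2 $ 2)"
    by (simp add: vec_eq_iff forall_2)
qed

lemma mat2_eq_iff [simp]: "mat2 a b c d = mat2 a' b' c' d' \<longleftrightarrow> a = a' \<and> b = b' \<and> c = c' \<and> d = d'"
  by (auto simp: vec_eq_iff forall_2)

lemma mat2_simps [simp]:
  "mat2 a b c d ** mat2 a' b' c' d' = mat2 (a * a' + b * c') (a * b' + b * d') (c * a' + d * c') (c * b' + d * d')"
  "mat2 a b c d + mat2 a' b' c' d' = mat2 (a + a') (b + b') (c + c') (d + d')"
  "mat2 a b c d - mat2 a' b' c' d' = mat2 (a - a') (b - b') (c - c') (d - d')"
  "- mat2 a b c d = mat2 (- a) (- b) (- c) (- d)"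
  "smat k (mat2 a b c d) = mat2 (k * a) (k * b) (k * c) (k * d)"
  "adj2 (mat2 a b c d) = mat2 d (- b) (- c) a"
  "det (mat2 a b c d) = a * d - b * c"
  "trace (mat2 a b c d) = a + d"
  by (simp_all add: vec_eq_iff forall_2 matrix_matrix_mult_def sum_2 smat_def adj2_def det_2 trace_def)

lemma mat_1_eq_mat2: "mat 1 = mat2 1 0 0 1"
  by (simp add: vec_eq_iff forall_2 mat_def)

lemma trace_smat [simp]: "trace (smat c M) = c * trace M"
  by (cases M rule: mat2_cases) (simp add: algebra_simps)

lemma trace_mat_1 [simp]: "trace (mat 1 :: complex^2^2) = 2"
  by (simp add: mat_1_eq_mat2)

lemma trace_adj2 [simp]: "trace (adj2 M) = trace M"
  by (cases M rule: mat2_cases) simp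

lemma det_adj2 [simp]: "det (adj2 M) = det M"
  by (cases M rule: mat2_cases) (simp add: algebra_simps)

lemma adj2_adj2 [simp]: "adj2 (adj2 M) = M"
  by (cases M rule: mat2_cases) simp

lemma adj2_mult: "adj2 (M ** N) = adj2 N ** adj2 M"
  by (cases M rule: mat2_cases, cases N rule: mat2_cases) (simp add: algebra_simps)

lemma adj2_inverse: "det M = 1 \<Longrightarrow> M ** adj2 M = mat 1" "det M = 1 \<Longrightarrow> adj2 M ** M = mat 1"
  by (cases M rule: mat2_cases, simp add: mat_1_eq_mat2 algebra_simps)+

lemma adj2_eq: "adj2 M = smat (trace M) (mat 1) - M"
  by (cases M rule: mat2_cases) (simp add: mat_1_eq_mat2)

lemma smat_mult: "smat c M ** N = smat c (M ** N)" "M ** smat c N = smat c (M ** N)"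
  by (cases M rule: mat2_cases, cases N rule: mat2_cases, simp add: algebra_simps)+

text \<open>The Cayley-Hamilton equation, multiplied by \<open>N\<close>.\<close>

lemma mult_self_eq:
  assumes "det M = 1"
  shows "M ** (M ** N) = smat (trace M) (M ** N) - N"
proof -
  obtain a b c d where M: "M = mat2 a b c d" by (rule mat2_cases)
  obtain e f g h where N: "N = mat2 e f g h" by (rule mat2_cases)
  have "a * d = 1 + b * c" using assms by (simp add: M algebra_simps)
  then show ?thesis unfolding M N by simp algebra
qed

text \<open>The polarized Cayley-Hamilton equation, valid for all determinants. It exchanges
  neighbouring factors in a product at the cost of shorter products.\<close>

lemma mult_swap_eq:
  "N ** (M ** X) = smat (trace M) (N ** X) + (smat (trace N) (M ** X) +
     (smat (trace (M ** N) - trace M * trace N) X - M ** (N ** X)))"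
  by (cases M rule: mat2_cases, cases N rule: mat2_cases, cases X rule: mat2_cases)
    (simp add: algebra_simps)

lemma trace_mult_comm: "trace (M ** N) = trace (N ** M)" for M N :: "complex^2^2"
  by (rule trace_mul_sym)

lemma trace_diff_2: "trace (M - N) = trace M - trace N" for M N :: "complex^2^2"
  by (cases M rule: mat2_cases, cases N rule: mat2_cases) simp


section \<open>Representations as assignments of matrices to the generators\<close>

fun eval_word :: "('g \<Rightarrow> complex^2^2) \<Rightarrow> 'g word \<Rightarrow> complex^2^2" where
  "eval_word E [] = mat 1"
| "eval_word E (x # w) = (if snd x then E (fst x) else adj2 (E (fst x))) ** eval_word E w"

lemma eval_word_append: "eval_word E (u @ v) = eval_word E u ** eval_word E v"
  by (induction u) (auto simp: matrix_mul_assoc)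

lemma det_eval_word: "(\<And>g. det (E g) = 1) \<Longrightarrow> det (eval_word E w) = 1"
  by (induction w) (auto simp: det_mul)

lemma eval_word_inv_word: "eval_word E (inv_word w) = adj2 (eval_word E w)"
proof (induction w)
  case Nil
  show ?case by (simp add: inv_word_def mat_1_eq_mat2)
next
  case (Cons x w)
  obtain g e where x: "x = (g, e)" by (cases x)
  have "eval_word E (inv_word (x # w)) = eval_word E (inv_word w) ** eval_word E [(g, \<not> e)]"
    by (simp add: inv_word_def x eval_word_append)
  then show ?case by (simp add: Cons.IH adj2_mult x)
qed

lemma eval_word_cong_word_eq:
  assumes "word_eq R u v" "\<And>g. det (E g) = 1" "\<And>u v. (u, v) \<in> R \<Longrightarrow> eval_word E u = eval_word E v"
  shows "eval_word E u = eval_word E v"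
  using assms(1)
proof induction
  case (cancel g e)
  then show ?case using assms(2)[of g] by (cases e) (auto simp: adj2_inverse)
qed (auto simp: eval_word_append assms)

definition rep_of :: "('g \<Rightarrow> complex^2^2) \<Rightarrow> 'g word set \<Rightarrow> complex^2^2" where
  "rep_of E U = eval_word E (SOME w. w \<in> U)"

lemma rep_of_word_class:
  assumes "\<And>g. det (E g) = 1" "\<And>u v. (u, v) \<in> R \<Longrightarrow> eval_word E u = eval_word E v"
  shows "rep_of E (word_class R w) = eval_word E w"
proof -
  have "w \<in> word_class R w" by (simp add: word_class_def word_eq.refl)
  then have "(SOME v. v \<in> word_class R w) \<in> word_class R w" by (rule someI)
  then have "word_eq R w (SOME v. v \<in> word_class R w)" by (simp add: word_class_def)
  from eval_word_cong_word_eq[OF this assms] show ?thesis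
    unfolding rep_of_def by simp
qed

lemma carrier_presented_group: "carrier (presented_group R) = range (word_class R)"
  by (simp add: presented_group_def)

lemma rep_of_hom:
  assumes "\<And>g. det (E g) = 1" "\<And>u v. (u, v) \<in> R \<Longrightarrow> eval_word E u = eval_word E v"
  shows "rep_of E \<in> hom (presented_group R) SL2C"
proof (rule homI)
  note rep = rep_of_word_class[OF assms, simplified]
  fix x assume "x \<in> carrier (presented_group R)"
  then obtain u where u: "x = word_class R u" by (auto simp: carrier_presented_group)
  show "rep_of E x \<in> carrier SL2C"
    using det_eval_word[of E u] assms(1) by (simp add: SL2C_def u rep)
  fix y assume "y \<in> carrier (presented_group R)"
  then obtain v where v: "y = word_class R v" by (auto simp: carrier_presented_group)
  show "rep_of E (x \<otimes>\<^bsub>presented_group R\<^esub> y) = rep_of E x \<otimes>\<^bsub>SL2C\<^esub> rep_of E y"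
    by (simp add: SL2C_def u v presented_group_mult rep eval_word_append)
qed

definition gen_matrix :: "('g word \<times> 'g word) set \<Rightarrow> ('g word set \<Rightarrow> complex^2^2) \<Rightarrow> 'g \<Rightarrow> complex^2^2" where
  "gen_matrix R \<rho> g = \<rho> (word_class R [(g, True)])"

lemma hom_word_class:
  assumes "\<rho> \<in> hom (presented_group R) SL2C"
  shows "det (gen_matrix R \<rho> g) = 1" "\<rho> (word_class R w) = eval_word (gen_matrix R \<rho>) w"
proof -
  interpret group "presented_group R" by (rule group_presented_group)
  interpret S: group SL2C by (rule group_SL2C)
  interpret group_hom "presented_group R" SL2C \<rho>
    using assms by unfold_locales
  have det: "det (\<rho> (word_class R w)) = 1" for w
    using hom_closed[of "word_class R w"] by (simp add: SL2C_def carrier_presented_group)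
  then show "det (gen_matrix R \<rho> g) = 1" by (simp add: gen_matrix_def)
  have mult: "\<rho> (word_class R (u @ v)) = \<rho> (word_class R u) ** \<rho> (word_class R v)" for u v
    using hom_mult[of "word_class R u" "word_class R v"]
    by (simp add: carrier_presented_group presented_group_mult SL2C_def)
  have one: "\<rho> (word_class R []) = mat 1"
    using hom_one by (simp add: presented_group_def SL2C_def)
  have letter: "\<rho> (word_class R [(g, e)]) = (if e then gen_matrix R \<rho> g else adj2 (gen_matrix R \<rho> g))" for g e
  proof (cases e)
    case False
    have "word_class R ([(g, True)] @ [(g, False)]) = word_class R []"
      using word_eq.cancel[of R g True] by (simp add: word_class_eq_iff)
    then have inv: "gen_matrix R \<rho> g ** \<rho> (word_class R [(g, False)]) = mat 1"
      unfolding gen_matrix_def using mult[of "[(g, True)]" "[(g, False)]"] one by simp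
    have "\<rho> (word_class R [(g, False)]) =
        (adj2 (gen_matrix R \<rho> g) ** gen_matrix R \<rho> g) ** \<rho> (word_class R [(g, False)])"
      using det by (simp add: adj2_inverse gen_matrix_def)
    also have "\<dots> = adj2 (gen_matrix R \<rho> g)"
      by (simp add: inv flip: matrix_mul_assoc)
    finally show ?thesis using False by simp
  qed (simp add: gen_matrix_def)
  show "\<rho> (word_class R w) = eval_word (gen_matrix R \<rho>) w"
  proof (induction w)
    case (Cons x w)
    then show ?case using mult[of "[x]" w] letter[of "fst x" "snd x"] by simp
  qed (simp add: one)
qed

lemma hom_relation:
  assumes "\<rho> \<in> hom (presented_group R) SL2C" "(u, v) \<in> R"
  shows "eval_word (gen_matrix R \<rho>) u = eval_word (gen_matrix R \<rho>) v"
  using hom_word_class(2)[OF assms(1), of u] hom_word_class(2)[OF assms(1), of v]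
    word_class_eq_iff[of R u v] word_eq.relation[OF assms(2)] by simp


section \<open>The ring of trace functions\<close>

text \<open>The classical traces that generate the ring of trace functions of the free group of rank
  three.\<close>

definition basic_traces :: "((gen \<Rightarrow> complex^2^2) \<Rightarrow> complex) set" where
  "basic_traces = {\<lambda>E. trace (E Gen_a), \<lambda>E. trace (E Gen_b), \<lambda>E. trace (E Gen_t),
     \<lambda>E. trace (E Gen_a ** E Gen_b), \<lambda>E. trace (E Gen_a ** E Gen_t), \<lambda>E. trace (E Gen_b ** E Gen_t),
     \<lambda>E. trace (E Gen_a ** (E Gen_b ** E Gen_t))}"

abbreviation trace_ring :: "((gen \<Rightarrow> complex^2^2) \<Rightarrow> complex) set" where
  "trace_ring \<equiv> generated_algebra basic_traces"

text \<open>The module over the ring of trace functions generated by the products \<open>A\<^sup>iB\<^sup>jT\<^sup>k\<close> with exponents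
  in \<open>{0, 1}\<close>. It is closed under multiplication by the generators, by the relations
  \<open>M\<^sup>2 = tr(M) M - 1\<close> and \<open>NM = - MN + tr(M) N + tr(N) M + (tr(MN) - tr(M) tr(N))\<close>.\<close>

definition trace_basis :: "((gen \<Rightarrow> complex^2^2) \<Rightarrow> complex^2^2) set" where
  "trace_basis = {\<lambda>E. mat 1, \<lambda>E. E Gen_t, \<lambda>E. E Gen_b, \<lambda>E. E Gen_b ** E Gen_t, \<lambda>E. E Gen_a,
     \<lambda>E. E Gen_a ** E Gen_t, \<lambda>E. E Gen_a ** E Gen_b, \<lambda>E. E Gen_a ** (E Gen_b ** E Gen_t)}"

text \<open>The clause \<open>cong\<close> identifies functions that agree for determinant one,
  where Cayley-Hamilton reads \<open>M^2 = tr(M) M - 1\<close>.\<close>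

inductive_set trace_module :: "((gen \<Rightarrow> complex^2^2) \<Rightarrow> complex^2^2) set" where
  basis: "f \<in> trace_basis \<Longrightarrow> f \<in> trace_module"
| add: "f \<in> trace_module \<Longrightarrow> g \<in> trace_module \<Longrightarrow> (\<lambda>E. f E + g E) \<in> trace_module"
| scale: "c \<in> trace_ring \<Longrightarrow> f \<in> trace_module \<Longrightarrow> (\<lambda>E. smat (c E) (f E)) \<in> trace_module"
| cong: "f \<in> trace_module \<Longrightarrow> \<forall>E. (\<forall>g. det (E g) = 1) \<longrightarrow> f E = h E \<Longrightarrow> h \<in> trace_module"

lemma trace_module_basis:
  "(\<lambda>E. mat 1) \<in> trace_module" "(\<lambda>E. E Gen_t) \<in> trace_module" "(\<lambda>E. E Gen_b) \<in> trace_module"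
  "(\<lambda>E. E Gen_b ** E Gen_t) \<in> trace_module" "(\<lambda>E. E Gen_a) \<in> trace_module"
  "(\<lambda>E. E Gen_a ** E Gen_t) \<in> trace_module" "(\<lambda>E. E Gen_a ** E Gen_b) \<in> trace_module"
  "(\<lambda>E. E Gen_a ** (E Gen_b ** E Gen_t)) \<in> trace_module"
  by (rule trace_module.basis, simp add: trace_basis_def)+

lemma trace_module_diff:
  assumes "f \<in> trace_module" "g \<in> trace_module"
  shows "(\<lambda>E. f E - g E) \<in> trace_module"
proof -
  have "(\<lambda>E. f E + smat (-1) (g E)) \<in> trace_module"
    by (intro trace_module.add trace_module.scale generated_algebra.const assms)
  moreover have "f E + smat (-1) (g E) = f E - g E" for E
    by (cases "f E" rule: mat2_cases, cases "g E" rule: mat2_cases) simp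
  ultimately show ?thesis by simp
qed

lemma basic_traces_in_ring:
  "(\<lambda>E. trace (E g)) \<in> trace_ring"
  "(\<lambda>E. trace (E Gen_a ** E Gen_b)) \<in> trace_ring"
  "(\<lambda>E. trace (E Gen_a ** E Gen_t)) \<in> trace_ring"
  "(\<lambda>E. trace (E Gen_b ** E Gen_t)) \<in> trace_ring"
  by (cases g; rule generated_algebra.gen, simp add: basic_traces_def)
    (rule generated_algebra.gen, simp add: basic_traces_def)+

lemma trace_module_self:
  assumes "f \<in> trace_module" "(\<lambda>E. E g ** f E) \<in> trace_module"
  shows "(\<lambda>E. E g ** (E g ** f E)) \<in> trace_module"
proof (rule trace_module.cong)
  show "(\<lambda>E. smat (trace (E g)) (E g ** f E) - f E) \<in> trace_module"
    by (intro trace_module_diff trace_module.scale basic_traces_in_ring assms)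
  show "\<forall>E. (\<forall>g. det (E g) = 1) \<longrightarrow> smat (trace (E g)) (E g ** f E) - f E = E g ** (E g ** f E)"
    using mult_self_eq by metis
qed

lemma trace_module_swap:
  assumes "f \<in> trace_module" "(\<lambda>E. E g ** f E) \<in> trace_module" "(\<lambda>E. E h ** f E) \<in> trace_module"
    "(\<lambda>E. E g ** (E h ** f E)) \<in> trace_module" "(\<lambda>E. trace (E g ** E h)) \<in> trace_ring"
  shows "(\<lambda>E. E h ** (E g ** f E)) \<in> trace_module"
proof (rule trace_module.cong)
  show "(\<lambda>E. smat (trace (E g)) (E h ** f E) + (smat (trace (E h)) (E g ** f E) +
     (smat (trace (E g ** E h) - trace (E g) * trace (E h)) (f E) - E g ** (E h ** f E)))) \<in> trace_module"
    by (intro trace_module_diff trace_module.add trace_module.scale basic_traces_in_ring assms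
        generated_algebra_diff generated_algebra.mult)
  show "\<forall>E. (\<forall>g. det (E g) = 1) \<longrightarrow>
     smat (trace (E g)) (E h ** f E) + (smat (trace (E h)) (E g ** f E) +
     (smat (trace (E g ** E h) - trace (E g) * trace (E h)) (f E) - E g ** (E h ** f E)))
     = E h ** (E g ** f E)"
    using mult_swap_eq by metis
qed

lemma trace_module_mult_induct:
  assumes "f \<in> trace_module"
    and "(\<lambda>E. E g ** mat 1) \<in> trace_module" "(\<lambda>E. E g ** E Gen_t) \<in> trace_module"
      "(\<lambda>E. E g ** E Gen_b) \<in> trace_module" "(\<lambda>E. E g ** (E Gen_b ** E Gen_t)) \<in> trace_module"
      "(\<lambda>E. E g ** E Gen_a) \<in> trace_module" "(\<lambda>E. E g ** (E Gen_a ** E Gen_t)) \<in> trace_module"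
      "(\<lambda>E. E g ** (E Gen_a ** E Gen_b)) \<in> trace_module"
      "(\<lambda>E. E g ** (E Gen_a ** (E Gen_b ** E Gen_t))) \<in> trace_module"
  shows "(\<lambda>E. E g ** f E) \<in> trace_module"
  using assms(1)
proof induction
  case (add f h)
  then show ?case by (simp add: matrix_add_ldistrib trace_module.add)
next
  case (scale c f)
  then show ?case by (simp add: smat_mult trace_module.scale)
next
  case (cong f h)
  then show ?case by (intro trace_module.cong[OF cong.IH]) simp
next
  case (basis f)
  then show ?case using assms(2-) by (auto simp: trace_basis_def simp del: matrix_mul_rid)
qed

lemma trace_module_mult_a: "f \<in> trace_module \<Longrightarrow> (\<lambda>E. E Gen_a ** f E) \<in> trace_module"
  using trace_module_self[of "\<lambda>_. mat 1" Gen_a] trace_module_self[of "\<lambda>E. E Gen_t" Gen_a]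
    trace_module_self[of "\<lambda>E. E Gen_b" Gen_a] trace_module_self[of "\<lambda>E. E Gen_b ** E Gen_t" Gen_a]
  by (elim trace_module_mult_induct) (simp_all add: trace_module_basis)

text \<open>The generators are treated in the order \<open>a\<close>, \<open>b\<close>,
  \<open>t\<close> in which they stand in the basis products: a factor \<open>b\<close> in front of
  \<open>a\<close> is swapped behind it, which uses the closure under \<open>a\<close> already
  known.\<close>

lemma trace_module_mult_b: "f \<in> trace_module \<Longrightarrow> (\<lambda>E. E Gen_b ** f E) \<in> trace_module"
proof (elim trace_module_mult_induct)
  note intros = trace_module_basis
  have 1: "(\<lambda>E. E Gen_b ** E Gen_b) \<in> trace_module" "(\<lambda>E. E Gen_b ** (E Gen_b ** E Gen_t)) \<in> trace_module"
    using trace_module_self[of "\<lambda>_. mat 1" Gen_b] trace_module_self[of "\<lambda>E. E Gen_t" Gen_b] intros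
    by simp_all
  then show "(\<lambda>E. E Gen_b ** E Gen_b) \<in> trace_module" "(\<lambda>E. E Gen_b ** (E Gen_b ** E Gen_t)) \<in> trace_module" .
  have swap: "(\<lambda>E. E Gen_b ** (E Gen_a ** f E)) \<in> trace_module"
    if "f \<in> trace_module" "(\<lambda>E. E Gen_b ** f E) \<in> trace_module" for f
    by (rule trace_module_swap[OF that(1) trace_module_mult_a[OF that(1)] that(2) trace_module_mult_a[OF that(2)]
        basic_traces_in_ring(2)])
  show "(\<lambda>E. E Gen_b ** E Gen_a) \<in> trace_module"
    using swap[of "\<lambda>_. mat 1"] intros by simp
  show "(\<lambda>E. E Gen_b ** (E Gen_a ** E Gen_t)) \<in> trace_module"
    "(\<lambda>E. E Gen_b ** (E Gen_a ** E Gen_b)) \<in> trace_module"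
    "(\<lambda>E. E Gen_b ** (E Gen_a ** (E Gen_b ** E Gen_t))) \<in> trace_module"
    by (rule swap, (rule intros 1)+)+
qed (simp_all add: trace_module_basis)

lemma trace_module_mult_t: "f \<in> trace_module \<Longrightarrow> (\<lambda>E. E Gen_t ** f E) \<in> trace_module"
proof (elim trace_module_mult_induct)
  note intros = trace_module_basis
  show 1: "(\<lambda>E. E Gen_t ** E Gen_t) \<in> trace_module"
    using trace_module_self[of "\<lambda>_. mat 1" Gen_t] intros by simp
  have swap_b: "(\<lambda>E. E Gen_t ** (E Gen_b ** f E)) \<in> trace_module"
    if "f \<in> trace_module" "(\<lambda>E. E Gen_t ** f E) \<in> trace_module" for f
    by (rule trace_module_swap[OF that(1) trace_module_mult_b[OF that(1)] that(2) trace_module_mult_b[OF that(2)]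
        basic_traces_in_ring(4)])
  have swap_a: "(\<lambda>E. E Gen_t ** (E Gen_a ** f E)) \<in> trace_module"
    if "f \<in> trace_module" "(\<lambda>E. E Gen_t ** f E) \<in> trace_module" for f
    by (rule trace_module_swap[OF that(1) trace_module_mult_a[OF that(1)] that(2) trace_module_mult_a[OF that(2)]
        basic_traces_in_ring(3)])
  show 2: "(\<lambda>E. E Gen_t ** E Gen_b) \<in> trace_module"
    using swap_b[of "\<lambda>_. mat 1"] intros by simp
  show 3: "(\<lambda>E. E Gen_t ** (E Gen_b ** E Gen_t)) \<in> trace_module"
    by (rule swap_b, (rule intros 1)+)
  show "(\<lambda>E. E Gen_t ** E Gen_a) \<in> trace_module"
    using swap_a[of "\<lambda>_. mat 1"] intros by simp
  show "(\<lambda>E. E Gen_t ** (E Gen_a ** E Gen_t)) \<in> trace_module"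
    "(\<lambda>E. E Gen_t ** (E Gen_a ** E Gen_b)) \<in> trace_module"
    "(\<lambda>E. E Gen_t ** (E Gen_a ** (E Gen_b ** E Gen_t))) \<in> trace_module"
    by (rule swap_a, (rule intros 1 2 3)+)+
qed (simp_all add: trace_module_basis)

lemma eval_word_trace_module: "(\<lambda>E. eval_word E w) \<in> trace_module"
proof (induction w)
  case Nil
  then show ?case by (simp add: trace_module_basis)
next
  case (Cons x w)
  obtain g e where x: "x = (g, e)" by (cases x)
  have g: "(\<lambda>E. E g ** eval_word E w) \<in> trace_module"
    using Cons.IH by (cases g) (auto intro: trace_module_mult_a trace_module_mult_b trace_module_mult_t)
  show ?case
  proof (cases e)
    case False
    have "(\<lambda>E. smat (trace (E g)) (eval_word E w) - E g ** eval_word E w) \<in> trace_module"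
      by (intro trace_module_diff trace_module.scale basic_traces_in_ring g Cons.IH)
    moreover have "adj2 M ** N = smat (trace M) N - M ** N" for M N
      by (cases M rule: mat2_cases, cases N rule: mat2_cases) (simp add: algebra_simps)
    ultimately show ?thesis using False x by simp
  qed (use g x in simp)
qed

text \<open>The word is a combination of the basis products with coefficients in the trace ring, and
  each basis product has trace 2 or one of the seven traces.\<close>

lemma trace_eval_word_in_ring:
  "\<exists>g\<in>trace_ring. \<forall>E. (\<forall>x. det (E x) = 1) \<longrightarrow> trace (eval_word E w) = g E"
proof -
  have "\<exists>g\<in>trace_ring. \<forall>E. (\<forall>x. det (E x) = 1) \<longrightarrow> trace (f E) = g E" if "f \<in> trace_module" for f
    using that
  proof induction
    case (basis f)
    then have "f = (\<lambda>E. mat 1) \<or> (\<lambda>E. trace (f E)) \<in> basic_traces"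
      by (auto simp: trace_basis_def basic_traces_def)
    then show ?case
    proof
      assume "f = (\<lambda>E. mat 1)"
      then show ?thesis by (intro bexI[OF _ generated_algebra.const[of 2]]) simp
    next
      assume "(\<lambda>E. trace (f E)) \<in> basic_traces"
      then show ?thesis by (intro bexI[OF _ generated_algebra.gen]) auto
    qed
  next
    case (add f h)
    then obtain g k where "g \<in> trace_ring" "k \<in> trace_ring"
      "\<forall>E. (\<forall>x. det (E x) = 1) \<longrightarrow> trace (f E) = g E" "\<forall>E. (\<forall>x. det (E x) = 1) \<longrightarrow> trace (h E) = k E" by blast
    then show ?case by (intro bexI[OF _ generated_algebra.add[of g _ k]]) (auto simp: trace_add)
  next
    case (scale c f)
    then obtain g where "g \<in> trace_ring" "\<forall>E. (\<forall>x. det (E x) = 1) \<longrightarrow> trace (f E) = g E" by blast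
    then show ?case using scale by (intro bexI[OF _ generated_algebra.mult[of c _ g]]) auto
  next
    case (cong f h)
    then obtain g where g: "g \<in> trace_ring" "\<forall>E. (\<forall>x. det (E x) = 1) \<longrightarrow> trace (f E) = g E" by blast
    then show ?case using cong.hyps by (intro bexI[OF _ g(1)]) simp
  qed
  then show ?thesis using eval_word_trace_module by blast
qed

lemma trace_ring_determined:
  assumes "g \<in> trace_ring" "\<And>f. f \<in> basic_traces \<Longrightarrow> f E = f E'"
  shows "g E = g E'"
  using assms(1) by induction (auto simp: assms(2))

lemma trace_eval_word_determined:
  assumes "\<And>x. det (E x) = 1" "\<And>x. det (E' x) = 1" "\<And>f. f \<in> basic_traces \<Longrightarrow> f E = f E'"
  shows "trace (eval_word E w) = trace (eval_word E' w)"
proof -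
  obtain g where "g \<in> trace_ring" "\<forall>E. (\<forall>x. det (E x) = 1) \<longrightarrow> trace (eval_word E w) = g E"
    using trace_eval_word_in_ring by blast
  then show ?thesis using trace_ring_determined[of g E E'] assms by auto
qed

section \<open>Trace equations for the bundle group\<close>

text \<open>\<open>U\<close> is the image of \<open>a\<close> under the monodromy. With
  \<open>T\<close> moved to the other side the relations contain no inverse of
  \<open>T\<close>.\<close>

definition bundle_rep :: "(gen \<Rightarrow> complex^2^2) \<Rightarrow> bool" where
  "bundle_rep E \<longleftrightarrow> (\<forall>g. det (E g) = 1) \<and>
     (let A = E Gen_a; B = E Gen_b; T = E Gen_t; U = adj2 B ** (adj2 A ** adj2 B)
      in T ** A = U ** T \<and> T ** B = B ** (A ** (U ** (U ** (U ** T)))))"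

lemma mult_adj2_eq_iff: "det T = 1 \<Longrightarrow> T ** (A ** adj2 T) = U \<longleftrightarrow> T ** A = U ** T"
  by (metis adj2_inverse matrix_mul_assoc matrix_mul_rid)

lemma bundle_rep_iff:
  "bundle_rep E \<longleftrightarrow> (\<forall>g. det (E g) = 1) \<and> (\<forall>(u, v)\<in>bundle_relations. eval_word E u = eval_word E v)"
proof (cases "\<forall>g. det (E g) = 1")
  case True
  let ?A = "E Gen_a" and ?B = "E Gen_b" and ?T = "E Gen_t"
  let ?U = "adj2 ?B ** (adj2 ?A ** adj2 ?B)"
  have "eval_word E wa = ?A" "eval_word E wb = ?B" "eval_word E wt = ?T"
    by (simp_all add: wa_def wb_def wt_def)
  then have "(\<forall>(u, v)\<in>bundle_relations. eval_word E u = eval_word E v) \<longleftrightarrow>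
      ?T ** (?A ** adj2 ?T) = ?U \<and> ?T ** (?B ** adj2 ?T) = ?B ** (?A ** (?U ** (?U ** ?U)))"
    by (simp add: bundle_relations_def Let_def eval_word_append eval_word_inv_word flip: matrix_mul_assoc)
  also have "\<dots> \<longleftrightarrow> bundle_rep E"
    unfolding mult_adj2_eq_iff[OF True[rule_format]]
    using True by (simp add: bundle_rep_def Let_def flip: matrix_mul_assoc)
  finally show ?thesis using True by blast
qed (auto simp: bundle_rep_def)

lemma mat_mult_diff:
  fixes M N P :: "complex^2^2"
  shows "(M - N) ** P = M ** P - N ** P" "P ** (M - N) = P ** M - P ** N"
  by (cases M rule: mat2_cases, cases N rule: mat2_cases, cases P rule: mat2_cases, simp add: algebra_simps)+

lemma trace_cyclic: "trace (M ** (N ** P)) = trace (N ** (P ** M))" for M N P :: "complex^2^2"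
  by (metis matrix_mul_assoc trace_mult_comm)

text \<open>The polarized Cayley-Hamilton equation multiplied by \<open>B\<close>. It makes
  \<open>BAB\<close>, the inverse of the image of \<open>a\<close> under the monodromy, a linear
  combination of \<open>A\<close>, \<open>B\<close> and 1.\<close>

lemma conj_sandwich:
  assumes "det B = 1"
  shows "B ** (A ** B) = A + smat (trace (A ** B)) B - smat (trace A) (mat 1)"
proof -
  obtain a b c d where A: "A = mat2 a b c d" by (rule mat2_cases)
  obtain e f g h where B: "B = mat2 e f g h" by (rule mat2_cases)
  have "e * h = 1 + f * g" using assms by (simp add: B algebra_simps)
  then show ?thesis unfolding A B by (simp add: mat_1_eq_mat2) algebra
qed

lemma trace_square_mult:
  fixes A T :: "complex^2^2"
  assumes "det A = 1"
  shows "trace (T ** (A ** A)) = trace A * trace (A ** T) - trace T"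
  using mult_self_eq[OF assms, of "mat 1"] by (simp add: mat_mult_diff smat_mult trace_diff_2 trace_mult_comm)

lemma trace_swap_mult:
  fixes A B T :: "complex^2^2"
  shows "trace (T ** (B ** A)) = trace A * trace (B ** T) + trace B * trace (A ** T)
     + (trace (A ** B) - trace A * trace B) * trace T - trace (A ** (B ** T))"
  by (cases A rule: mat2_cases, cases B rule: mat2_cases, cases T rule: mat2_cases) (simp add: algebra_simps)

lemma mult_cube_eq:
  assumes "det A = 1"
  shows "A ** (A ** A) = smat (trace A ^ 2 - 1) A - smat (trace A) (mat 1)"
proof -
  obtain a b c d where A: "A = mat2 a b c d" by (rule mat2_cases)
  have "a * d = 1 + b * c" using assms by (simp add: A algebra_simps)
  then show ?thesis unfolding A by (simp add: mat_1_eq_mat2) algebra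
qed

lemma trace_square:
  fixes M :: "complex^2^2"
  assumes "det M = 1"
  shows "trace (M ** M) = trace M ^ 2 - 2"
  using mult_self_eq[OF assms, of "mat 1"] by (simp add: trace_diff_2 power2_eq_square)

context
  fixes A B T U :: "complex^2^2" and x y z t p q m :: complex
  assumes det: "det A = 1" "det B = 1" "det T = 1"
    and U: "U = adj2 B ** (adj2 A ** adj2 B)"
    and relA: "T ** A = U ** T"
    and relB: "T ** B = B ** (A ** (U ** (U ** (U ** T))))"
    and traces: "x = trace A" "y = trace B" "z = trace (A ** B)" "t = trace T"
      "p = trace (A ** T)" "q = trace (B ** T)" "m = trace (A ** (B ** T))"
begin

lemma U_adj2: "U = adj2 (B ** (A ** B))"
  unfolding U by (simp add: adj2_mult matrix_mul_assoc)

lemma trace_U: "trace U = x"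
proof -
  have "T ** (A ** adj2 T) = U" using mult_adj2_eq_iff[OF det(3)] relA by blast
  then have "trace U = trace (A ** (adj2 T ** T))" using trace_cyclic by metis
  then show ?thesis by (simp add: adj2_inverse det traces)
qed

text \<open>The matrix \<open>U\<close> is conjugate to \<open>A\<close>, so \<open>BAB\<close> has
  trace \<open>x\<close>, while its linear form has trace \<open>y * z - x\<close>.\<close>

lemma yz_eq: "y * z = 2 * x"
proof -
  have "trace U = x + z * y - x * 2"
    unfolding U_adj2 trace_adj2 conj_sandwich[OF det(2)]
    by (simp add: trace_diff_2 trace_add traces)
  then show ?thesis using trace_U by (simp add: algebra_simps)
qed

text \<open>With \<open>U\<close> linear in \<open>A\<close> and \<open>B\<close>, traces of
  products with \<open>U\<close> reduce to the basic ones.\<close>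

lemma U_eq: "U = smat (2 * x) (mat 1) - A - smat z B"
proof -
  have "trace (B ** (A ** B)) = x" using trace_U unfolding U_adj2 by simp
  then have "U = smat x (mat 1) - (A + smat z B - smat x (mat 1))"
    unfolding U_adj2 adj2_eq conj_sandwich[OF det(2)] using conj_sandwich[OF det(2)] by (simp add: traces)
  then show ?thesis
    by (cases A rule: mat2_cases, cases B rule: mat2_cases) (simp add: mat_1_eq_mat2)
qed

lemma trace_U_mult: "trace (U ** X) = 2 * x * trace X - trace (A ** X) - z * trace (B ** X)"
  unfolding U_eq by (simp add: mat_mult_diff trace_diff_2 smat_mult)

lemma eq_p_q: "2 * p + z * q = 2 * x * t"
proof -
  have "p = trace (U ** T)" unfolding traces(5) trace_mult_comm[of A] relA ..
  then show ?thesis unfolding trace_U_mult using traces by (simp add: algebra_simps)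
qed

text \<open>The trace of \<open>T A^2 = U T A\<close>, which is the first relation multiplied by
  \<open>A\<close> from the right.\<close>

lemma eq_m: "z * m = 2 * t"
proof -
  have "T ** (A ** A) = U ** (T ** A)" using relA by (metis matrix_mul_assoc)
  then have "trace (T ** (A ** A)) = 2 * x * trace (T ** A) - trace (A ** (T ** A)) - z * trace (B ** (T ** A))"
    unfolding trace_U_mult[symmetric] by simp
  moreover have "trace (A ** (T ** A)) = trace (T ** (A ** A))" "trace (B ** (T ** A)) = m" "trace (T ** A) = p"
    unfolding traces by (metis trace_cyclic, metis trace_cyclic, rule trace_mult_comm)
  ultimately show ?thesis
    using trace_square_mult[OF det(1), of T] traces by (simp add: algebra_simps)
qed

text \<open>Conjugation by \<open>T\<close> gives \<open>tr(B A U^3) = y\<close>. Since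
  \<open>U\<close> is inverse to \<open>B A B\<close>, also \<open>tr(B A U) = y\<close>, and
  Cayley-Hamilton for \<open>U\<close> yields \<open>x * y - z\<close> with \<open>U^2\<close> and
  \<open>x * (x * y - z) - y\<close> with \<open>U^3\<close>.\<close>

lemma eq_y: "x * (x * y - z) = 2 * y"
proof -
  have "T ** (B ** adj2 T) = B ** (A ** (U ** (U ** U)))"
    unfolding mult_adj2_eq_iff[OF det(3)] relB by (simp flip: matrix_mul_assoc)
  then have "trace (B ** (A ** (U ** (U ** U)))) = trace (B ** (adj2 T ** T))" using trace_cyclic by metis
  then have 1: "trace (B ** (A ** (U ** (U ** U)))) = y" by (simp add: adj2_inverse det traces)
  have detU: "det U = 1" unfolding U by (simp add: det_mul det)
  have "U = adj2 B ** adj2 (B ** A)" unfolding U by (simp add: adj2_mult matrix_mul_assoc)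
  then have "trace ((B ** A) ** U) = trace (adj2 B ** (adj2 (B ** A) ** (B ** A)))"
    using trace_cyclic by metis
  moreover have "adj2 (B ** A) ** (B ** A) = mat 1" by (rule adj2_inverse) (simp add: det_mul det)
  ultimately have "trace ((B ** A) ** U) = y" by (simp add: traces)
  then have 2: "trace (B ** (A ** U)) = y" by (simp add: matrix_mul_assoc)
  have 3: "trace (B ** (A ** (U ** U))) = x * y - z"
    using mult_self_eq[OF detU, of "mat 1"] 2
    by (simp add: trace_U mat_mult_diff smat_mult trace_diff_2 traces trace_mult_comm)
  have "trace (B ** (A ** (U ** (U ** U)))) = x * (x * y - z) - y"
    using mult_self_eq[OF detU, of U] 2 3 by (simp add: trace_U mat_mult_diff smat_mult trace_diff_2)
  with 1 show ?thesis by simp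
qed

text \<open>Multiplying the second relation by \<open>A^(-2)\<close> from the right and using
  \<open>U^3 T = T A^3\<close> gives \<open>T B A^(-2) = B A T A\<close>, whose traces are linear in
  \<open>p\<close>, \<open>q\<close>, \<open>m\<close>, \<open>t\<close>.\<close>

lemma eq_q: "2 * q + (x * y + z) * p = x * m + 3 * y * t"
proof -
  have UT: "U ** (U ** (U ** T)) = T ** (A ** (A ** A))"
    using relA by (metis matrix_mul_assoc)
  have AA: "A ** (A ** (A ** (adj2 A ** adj2 A))) = A"
    using adj2_inverse(1)[OF det(1)] by (metis matrix_mul_assoc matrix_mul_rid)
  have "T ** (B ** (adj2 A ** adj2 A)) = (T ** B) ** (adj2 A ** adj2 A)"
    by (simp add: matrix_mul_assoc)
  also have "\<dots> = B ** (A ** (T ** (A ** (A ** (A ** (adj2 A ** adj2 A))))))"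
    unfolding relB UT by (simp add: matrix_mul_assoc)
  finally have "trace (T ** (B ** (adj2 A ** adj2 A))) = trace (B ** (A ** (T ** A)))"
    unfolding AA by simp
  moreover have "trace (T ** (B ** (adj2 A ** adj2 A))) = (x ^ 2 - 1) * q - x * trace (T ** (B ** A))"
  proof -
    have "adj2 A ** adj2 A = smat (x ^ 2 - 1) (mat 1) - smat x A"
    proof -
      obtain a b c d where A: "A = mat2 a b c d" by (rule mat2_cases)
      have "a * d = 1 + b * c" using det(1) by (simp add: A algebra_simps)
      then show ?thesis unfolding traces A by (simp add: mat_1_eq_mat2) algebra
    qed
    then show ?thesis by (simp add: mat_mult_diff smat_mult trace_diff_2 traces trace_mult_comm)
  qed
  moreover have "trace (B ** (A ** (T ** A))) = q + z * p - y * t"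
  proof -
    have "trace (B ** (A ** (T ** A))) = trace (T ** (A ** (B ** A)))"
      by (metis matrix_mul_assoc trace_mult_comm)
    moreover have "trace (B ** A) = z" by (simp add: traces trace_mult_comm)
    ultimately show ?thesis
      unfolding conj_sandwich[OF det(1)]
      by (simp add: mat_mult_diff matrix_add_ldistrib smat_mult trace_add trace_diff_2 traces trace_mult_comm)
  qed
  moreover have "trace (T ** (B ** A)) = x * q + y * p + (z - x * y) * t - m"
    unfolding traces by (rule trace_swap_mult)
  ultimately have "(x ^ 2 - 1) * q - x * (x * q + y * p + (z - x * y) * t - m) = q + z * p - y * t"
    by metis
  then show ?thesis using eq_y by algebra
qed

text \<open>The trace of \<open>U A\<close> in two ways: by the linear form of \<open>U\<close>, and
  by \<open>U = T A T^(-1)\<close> with \<open>T^(-1) = t - T\<close>. Among the six equations it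
  alone is not linear in \<open>t\<close>, \<open>p\<close>, \<open>q\<close>,
  \<open>m\<close>.\<close>

lemma eq_quadratic: "x * t * p - t ^ 2 - p ^ 2 = x ^ 2 - z ^ 2"
proof -
  have TU: "T ** (A ** adj2 T) = U" using mult_adj2_eq_iff[OF det(3)] relA by blast
  have "trace (U ** A) = 2 * x * x - (x ^ 2 - 2) - z * z"
    unfolding trace_U_mult using trace_square[OF det(1)] by (simp add: traces trace_mult_comm)
  moreover have "trace (U ** A) = t * trace (T ** (A ** A)) - trace ((T ** A) ** (T ** A))"
    unfolding TU[symmetric] adj2_eq
    by (simp add: mat_mult_diff smat_mult trace_diff_2 traces matrix_mul_assoc)
  moreover have "trace ((T ** A) ** (T ** A)) = p ^ 2 - 2"
    using trace_square[of "T ** A"] det by (simp add: det_mul traces trace_mult_comm)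
  ultimately show ?thesis
    using trace_square_mult[OF det(1), of T] by (simp add: traces power2_eq_square algebra_simps)
qed

end

lemma bundle_rep_trace_equations:
  assumes "bundle_rep E"
  defines "A \<equiv> E Gen_a" and "B \<equiv> E Gen_b" and "T \<equiv> E Gen_t"
  defines "x \<equiv> trace A" and "y \<equiv> trace B" and "z \<equiv> trace (A ** B)" and "t \<equiv> trace T"
    and "p \<equiv> trace (A ** T)" and "q \<equiv> trace (B ** T)" and "m \<equiv> trace (A ** (B ** T))"
  shows "y * z = 2 * x" "2 * p + z * q = 2 * x * t" "z * m = 2 * t" "x * (x * y - z) = 2 * y"
    "2 * q + (x * y + z) * p = x * m + 3 * y * t" "x * t * p - t ^ 2 - p ^ 2 = x ^ 2 - z ^ 2"
proof -
  have *: "det A = 1" "det B = 1" "det T = 1" "T ** A = (adj2 B ** (adj2 A ** adj2 B)) ** T"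
    "T ** B = B ** (A ** ((adj2 B ** (adj2 A ** adj2 B)) ** ((adj2 B ** (adj2 A ** adj2 B)) ** ((adj2 B ** (adj2 A ** adj2 B)) ** T))))"
    using assms(1) by (simp_all add: bundle_rep_def Let_def A_def B_def T_def)
  note facts = *(1-3) HOL.refl *(4,5) x_def[THEN meta_eq_to_obj_eq] y_def[THEN meta_eq_to_obj_eq] z_def[THEN meta_eq_to_obj_eq]
    t_def[THEN meta_eq_to_obj_eq] p_def[THEN meta_eq_to_obj_eq] q_def[THEN meta_eq_to_obj_eq] m_def[THEN meta_eq_to_obj_eq]
  show "y * z = 2 * x" "2 * p + z * q = 2 * x * t" "z * m = 2 * t" "x * (x * y - z) = 2 * y"
    "2 * q + (x * y + z) * p = x * m + 3 * y * t" "x * t * p - t ^ 2 - p ^ 2 = x ^ 2 - z ^ 2"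
    using yz_eq[OF facts] eq_p_q[OF facts] eq_m[OF facts] eq_y[OF facts] eq_q[OF facts] eq_quadratic[OF facts]
    by blast+
qed

section \<open>Solving the trace equations\<close>

text \<open>Fricke's formula for the trace of a commutator.\<close>

lemma trace_commutator:
  assumes "det A = 1" "det B = 1"
  shows "trace (A ** (B ** (adj2 A ** adj2 B))) =
    trace A ^ 2 + trace B ^ 2 + trace (A ** B) ^ 2 - trace A * trace B * trace (A ** B) - 2"
proof -
  obtain a b c d where A: "A = mat2 a b c d" by (rule mat2_cases)
  obtain e f g h where B: "B = mat2 e f g h" by (rule mat2_cases)
  have "a * d = 1 + b * c" "e * h = 1 + f * g" using assms by (simp_all add: A B algebra_simps)
  then show ?thesis unfolding A B by simp algebra
qed

text \<open>The linear equations express \<open>t\<close>, \<open>p\<close>, \<open>q\<close>,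
  \<open>m\<close> as multiples of one scalar \<open>c\<close> by functions of \<open>x\<close>,
  \<open>y\<close>, \<open>z\<close>; the quadratic one then leaves only
  \<open>c^2 = -1\<close>.\<close>

lemma curve_equations:
  fixes x y z t p q m :: complex
  assumes eqs: "y * z = 2 * x" "2 * p + z * q = 2 * x * t" "z * m = 2 * t" "x * (x * y - z) = 2 * y"
      "2 * q + (x * y + z) * p = x * m + 3 * y * t" "x * t * p - t ^ 2 - p ^ 2 = x ^ 2 - z ^ 2"
    and y: "y \<noteq> 0" and \<kappa>: "x ^ 2 + y ^ 2 + z ^ 2 - x * y * z - 2 \<noteq> 2"
  shows "2 * x ^ 2 = z ^ 2 + 4"
    "\<exists>c\<in>{\<i>, -\<i>}. t = c * z ^ 2 / 2 \<and> p = c * x \<and> q = c * (x * z - y) \<and> m = c * z"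
proof -
  have yz: "y ^ 2 * z ^ 2 = 2 * z ^ 2 + 8"
  proof -
    \<comment> \<open>Substitute \<open>x = y * z / 2\<close> into
      \<open>x * (x * y - z) = 2 * y\<close>.\<close>
    have "y * (y ^ 2 * z ^ 2 - 2 * z ^ 2 - 8) = 0" using eqs(1,4) by algebra
    then have "y ^ 2 * z ^ 2 - 2 * z ^ 2 - 8 = 0" using y by simp
    then show ?thesis by algebra
  qed
  show x2: "2 * x ^ 2 = z ^ 2 + 4"
  proof -
    have "2 * (2 * x ^ 2) = 2 * (z ^ 2 + 4)" using yz eqs(1) by algebra
    then show ?thesis by (simp only: mult_cancel_left) simp
  qed
  have z: "z \<noteq> 0" using yz by auto
  define c where "c = m / z"
  have m: "m = c * z" using z by (simp add: c_def)
  have t2: "2 * t = c * z ^ 2" using eqs(3) m by algebra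
  then have t: "t = c * z ^ 2 / 2" by (metis nonzero_mult_div_cancel_left zero_neq_numeral)
  have p: "p = c * x"
  proof -
    have "z ^ 2 * (p - c * x) = 0"
      using eqs(1,2,4,5) x2 m t2 by algebra
    then show ?thesis using z by simp
  qed
  have q: "q = c * (x * z - y)"
  proof -
    have "z * (q - c * (x * z - y)) = 0" using eqs(1,2) p t2 by algebra
    then show ?thesis using z by simp
  qed
  have "(c ^ 2 + 1) * (z ^ 2 - 4) = 0"
    using eqs(6) x2 p t by algebra
  \<comment> \<open>On the curve \<open>z^2 = 4\<close> forces the commutator of \<open>a\<close>
    and \<open>b\<close> to have trace 2, which is excluded.\<close>
  moreover have "z ^ 2 \<noteq> 4"
  proof
    assume z4: "z ^ 2 = 4"
    then have "x ^ 2 = 4" using x2 by simp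
    moreover have "y ^ 2 = 4" using yz z4 by simp
    moreover have "x * y * z = 8" using eqs(1) \<open>x ^ 2 = 4\<close> by algebra
    ultimately show False using \<kappa> z4 by simp
  qed
  ultimately have "c ^ 2 = -1" by (simp add: add_eq_0_iff2)
  then have "(c - \<i>) * (c + \<i>) = 0" by (simp add: algebra_simps power2_eq_square)
  then have "c \<in> {\<i>, -\<i>}" by (auto simp: eq_neg_iff_add_eq_0)
  with m t p q show "\<exists>c\<in>{\<i>, -\<i>}. t = c * z ^ 2 / 2 \<and> p = c * x \<and> q = c * (x * z - y) \<and> m = c * z"
    by blast
qed


section \<open>The curve of representations\<close>

text \<open>The root is needed twice: the eigenvalues of \<open>AB - BA\<close> have square
  \<open>tr l - 2 = (z - 4 / z)^2 / 2\<close>, and the conic splits as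
  \<open>(sqrt2 x + z) (sqrt2 x - z) = 4\<close>.\<close>

definition sqrt2 :: complex where "sqrt2 = complex_of_real (sqrt 2)"

lemma sqrt2_square: "sqrt2 ^ 2 = 2"
  unfolding sqrt2_def by (simp flip: of_real_power)

text \<open>The basis consists of eigenvectors of \<open>AB - BA\<close>, and \<open>w\<close> stands for \<open>1 / z\<close>, where
  \<open>z = tr(AB)\<close>.\<close>

definition curve_matrices :: "complex \<Rightarrow> complex \<Rightarrow> complex \<Rightarrow> complex \<Rightarrow> gen \<Rightarrow> complex^2^2" where
  "curve_matrices j x z w g = (case g of
     Gen_a \<Rightarrow> mat2 (x / 2) 1 ((z ^ 2 - 4) / 8) (x / 2)
   | Gen_b \<Rightarrow> mat2 (x * w) (2 * (1 - sqrt2) * w) ((1 + sqrt2) * (z ^ 2 - 4) * w / 4) (x * w)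
   | Gen_t \<Rightarrow> mat2 (j * z ^ 2 * (1 - sqrt2) / 4) (j * x * (sqrt2 - 1))
       (- j * x * (z ^ 2 - 4) * (1 + sqrt2) / 8) (j * z ^ 2 * (1 + sqrt2) / 4))"

context
  fixes j x z w :: complex
  assumes j: "j ^ 2 = -1" and xz: "2 * x ^ 2 = z ^ 2 + 4" and zw: "z * w = 1"
begin

lemma det_curve_matrices: "det (curve_matrices j x z w g) = 1"
proof (cases g)
  case Gen_a
  show ?thesis unfolding Gen_a using xz by (simp add: curve_matrices_def field_simps) algebra
next
  case Gen_b
  show ?thesis unfolding Gen_b using xz zw sqrt2_square by (simp add: curve_matrices_def field_simps) algebra
next
  case Gen_t
  show ?thesis unfolding Gen_t using xz zw sqrt2_square j by (simp add: curve_matrices_def field_simps) algebra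
qed

lemma traces_curve_matrices:
  defines "A \<equiv> curve_matrices j x z w Gen_a" and "B \<equiv> curve_matrices j x z w Gen_b"
    and "T \<equiv> curve_matrices j x z w Gen_t"
  shows "trace A = x" "trace B = 2 * x * w" "trace (A ** B) = z" "trace T = j * z ^ 2 / 2"
    "trace (A ** T) = j * x" "trace (B ** T) = j * (x * z - 2 * x * w)" "trace (A ** (B ** T)) = j * z"
proof -
  show "trace A = x" "trace B = 2 * x * w" "trace T = j * z ^ 2 / 2"
    by (simp_all add: A_def B_def T_def curve_matrices_def field_simps)
  show "trace (A ** B) = z" "trace (A ** T) = j * x"
    "trace (B ** T) = j * (x * z - 2 * x * w)" "trace (A ** (B ** T)) = j * z"
    using xz zw sqrt2_square
    by (simp_all add: A_def B_def T_def curve_matrices_def field_simps) algebra+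
qed

lemma bundle_rep_curve_matrices: "bundle_rep (curve_matrices j x z w)"
proof -
  define A B T where "A = curve_matrices j x z w Gen_a" and "B = curve_matrices j x z w Gen_b"
    and "T = curve_matrices j x z w Gen_t"
  note det = det_curve_matrices[of Gen_a, folded A_def] det_curve_matrices[of Gen_b, folded B_def]
  define U where "U = adj2 B ** (adj2 A ** adj2 B)"
  note tr = traces_curve_matrices[folded A_def B_def T_def]
  have "B ** (A ** B) = A + smat z B - smat x (mat 1)"
    using conj_sandwich[OF det(2), of A] tr by simp
  moreover have "U = adj2 (B ** (A ** B))" unfolding U_def by (simp add: adj2_mult matrix_mul_assoc)
  ultimately have U: "U = adj2 (A + smat z B - smat x (mat 1))" by simp
  have relA: "T ** A = U ** T"
    unfolding U using xz zw sqrt2_square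
    by (simp add: A_def B_def T_def curve_matrices_def mat_1_eq_mat2 field_simps) algebra
  \<comment> \<open>The cube of \<open>U\<close> is avoided: the first relation gives
    \<open>U^3 T = T A^3\<close>, and \<open>A^3\<close> is linear in \<open>A\<close>.\<close>
  have AAA: "A ** (A ** A) = smat (x ^ 2 - 1) A - smat x (mat 1)"
    using mult_cube_eq[OF det(1)] tr(1) by simp
  have "T ** B = B ** (A ** (T ** (smat (x ^ 2 - 1) A - smat x (mat 1))))"
    using xz zw sqrt2_square
    by (simp add: A_def B_def T_def curve_matrices_def mat_1_eq_mat2 field_simps) algebra
  also have "T ** (smat (x ^ 2 - 1) A - smat x (mat 1)) = U ** (U ** (U ** T))"
    unfolding AAA[symmetric] using relA by (metis matrix_mul_assoc)
  finally show ?thesis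
    using relA det_curve_matrices by (simp add: bundle_rep_def Let_def A_def B_def T_def U_def)
qed

end

text \<open>Write \<open>l\<close> as \<open>AB\<close> times the inverse of \<open>BA\<close>. In
  the chosen basis \<open>AB - BA\<close> is diagonal of trace zero, so \<open>AB\<close> and
  \<open>BA\<close> agree off the diagonal and have exchanged diagonal entries.\<close>

lemma trace_lt_curve_matrices:
  fixes j x z w :: complex
  assumes xz: "2 * x ^ 2 = z ^ 2 + 4" and zw: "z * w = 1"
  defines "A \<equiv> curve_matrices j x z w Gen_a" and "B \<equiv> curve_matrices j x z w Gen_b"
    and "T \<equiv> curve_matrices j x z w Gen_t"
  shows "trace (A ** (B ** (adj2 A ** (adj2 B ** T)))) = 8 * j * w ^ 2"
proof -
  \<comment> \<open>This is \<open>z - 4 / z\<close>, which is \<open>sqrt2\<close> times the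
    eigenvalue \<open>h1 - h2\<close> of \<open>AB - BA\<close>.\<close>
  define e where "e = z - 4 * w"
  define h1 h2 g k where "h1 = (2 * z + sqrt2 * e) / 4" and "h2 = (2 * z - sqrt2 * e) / 4"
    and "g = x * (2 - sqrt2) * w" and "k = x * e * (2 + sqrt2) / 8"
  have AB: "A ** B = mat2 h1 g k h2"
    using xz zw sqrt2_square
    by (simp add: A_def B_def curve_matrices_def h1_def h2_def g_def k_def e_def field_simps) algebra
  have BA: "B ** A = mat2 h2 g k h1"
    using xz zw sqrt2_square
    by (simp add: A_def B_def curve_matrices_def h1_def h2_def g_def k_def e_def field_simps) algebra
  have ze: "z ^ 2 - 4 = z * e" using zw unfolding e_def by algebra
  have sums: "h1 ^ 2 + h2 ^ 2 = z ^ 2 / 2 + e ^ 2 / 4" "h1 ^ 2 - h2 ^ 2 = sqrt2 * e * z / 2"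
    using sqrt2_square by (simp_all add: h1_def h2_def field_simps power2_eq_square)
  have gk: "g * k = (z + 4 * w) * e / 8"
    using xz zw sqrt2_square by (simp add: g_def k_def field_simps) algebra
  have gx: "g * (h2 - h1) * (- j * x * (z ^ 2 - 4) * (1 + sqrt2) / 8) = j * x ^ 2 * e ^ 2 / 8"
    unfolding ze using zw sqrt2_square by (simp add: g_def h1_def h2_def field_simps) algebra
  have "(2 + sqrt2) * sqrt2 * (sqrt2 - 1) - 2 = (sqrt2 ^ 2 - 2) * (sqrt2 + 1)"
    by (simp add: power2_eq_square algebra_simps)
  then have "(2 + sqrt2) * sqrt2 * (sqrt2 - 1) = 2" using sqrt2_square by simp
  moreover have "k * (h1 - h2) * (j * x * (sqrt2 - 1)) =
      (2 + sqrt2) * sqrt2 * (sqrt2 - 1) * (j * x ^ 2 * e ^ 2 / 16)"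
    by (simp add: k_def h1_def h2_def field_simps power2_eq_square)
  moreover have "2 * (j * x ^ 2 * e ^ 2 / 16) = j * x ^ 2 * e ^ 2 / 8" by (simp add: field_simps)
  ultimately have kx: "k * (h1 - h2) * (j * x * (sqrt2 - 1)) = j * x ^ 2 * e ^ 2 / 8" by metis
  have "A ** (B ** (adj2 A ** (adj2 B ** T))) = ((A ** B) ** adj2 (B ** A)) ** T"
    by (simp add: adj2_mult matrix_mul_assoc)
  also have "(A ** B) ** adj2 (B ** A) =
      mat2 (h1 ^ 2 - g * k) (g * (h2 - h1)) (k * (h1 - h2)) (h2 ^ 2 - g * k)"
    unfolding AB BA by (simp add: power2_eq_square algebra_simps)
  finally have "trace (A ** (B ** (adj2 A ** (adj2 B ** T)))) =
      (h1 ^ 2 - g * k) * (j * z ^ 2 * (1 - sqrt2) / 4) + g * (h2 - h1) * (- j * x * (z ^ 2 - 4) * (1 + sqrt2) / 8)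
      + (k * (h1 - h2) * (j * x * (sqrt2 - 1)) + (h2 ^ 2 - g * k) * (j * z ^ 2 * (1 + sqrt2) / 4))"
    by (simp add: T_def curve_matrices_def)
  also have "\<dots> = j * z ^ 2 / 4 * ((h1 ^ 2 + h2 ^ 2) - sqrt2 * (h1 ^ 2 - h2 ^ 2) - 2 * (g * k)) + j * x ^ 2 * e ^ 2 / 4"
    unfolding gx kx by (simp add: field_simps)
  also have "\<dots> = 8 * j * w ^ 2"
    unfolding sums gk using xz zw sqrt2_square by (simp add: e_def field_simps) algebra
  finally show ?thesis .
qed

lemma matrix_add_rdistrib': "(M + N) ** P = M ** P + N ** P" for M N P :: "complex^2^2"
  by (cases M rule: mat2_cases, cases N rule: mat2_cases, cases P rule: mat2_cases) (simp add: algebra_simps)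

text \<open>Trace 2 means that \<open>A\<close> and \<open>B\<close> are simultaneously triangular,
  and then commutators are unipotent and commute. Without choosing a basis:
  \<open>N = AB - BA\<close> has trace 0 and determinant 0, hence square 0, and
  \<open>N A = A^(-1) N\<close>, \<open>N B = B^(-1) N\<close>. The two commutators are
  \<open>1 + P\<close> and \<open>1 - Q\<close>, and \<open>P Q = Q P = 0\<close> because both
  products contain \<open>N^2\<close> once the factors are moved past \<open>N\<close>.\<close>

lemma reducible_commutators_commute:
  assumes det: "det A = 1" "det B = 1" and tr: "trace (A ** (B ** (adj2 A ** adj2 B))) = 2"
  shows "(A ** (B ** (adj2 A ** adj2 B))) ** (adj2 A ** (B ** (A ** adj2 B))) =
    (adj2 A ** (B ** (A ** adj2 B))) ** (A ** (B ** (adj2 A ** adj2 B)))"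
proof -
  define N where "N = A ** B - B ** A"
  have swap: "N ** A = adj2 A ** N" "N ** B = adj2 B ** N" "N ** adj2 A = A ** N" "N ** adj2 B = B ** N"
    unfolding N_def
    by (cases A rule: mat2_cases, cases B rule: mat2_cases, simp add: algebra_simps)+
  have NN: "N ** N = smat 0 (mat 1)"
  proof -
    obtain a b c d where A: "A = mat2 a b c d" by (rule mat2_cases)
    obtain e f g h where B: "B = mat2 e f g h" by (rule mat2_cases)
    have "a * d = 1 + b * c" "e * h = 1 + f * g" using det by (simp_all add: A B algebra_simps)
    then have "det N = 2 - trace (A ** (B ** (adj2 A ** adj2 B)))"
      unfolding N_def A B by simp algebra
    then have "det N = 0" using tr by simp
    moreover have "trace N = 0" unfolding N_def by (simp add: trace_diff_2 trace_mult_comm)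
    moreover obtain n1 n2 n3 n4 where n: "N = mat2 n1 n2 n3 n4" by (rule mat2_cases)
    ultimately have d: "n1 * n4 - n2 * n3 = 0" "n1 + n4 = 0" by simp_all
    have "n1 * n1 + n2 * n3 = 0" "n1 * n2 + n2 * n4 = 0" "n3 * n1 + n4 * n3 = 0" "n3 * n2 + n4 * n4 = 0"
      using d by algebra+
    then show ?thesis by (simp add: n mat_1_eq_mat2)
  qed
  have zero: "smat 0 X = 0" "X + 0 = X" "0 ** X = 0" "X ** 0 = 0" for X :: "complex^2^2"
    by (simp_all add: vec_eq_iff smat_def matrix_matrix_mult_def)
  define P Q where "P = N ** (adj2 A ** adj2 B)" and "Q = N ** (A ** adj2 B)"
  have "N ** (adj2 A ** (adj2 B ** N)) = A ** (B ** (N ** N))" "N ** (A ** (adj2 B ** N)) = adj2 A ** (B ** (N ** N))"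
    using swap by (metis matrix_mul_assoc)+
  then have "N ** (adj2 A ** (adj2 B ** N)) = 0" "N ** (A ** (adj2 B ** N)) = 0"
    by (simp_all add: NN zero)
  then have PQ: "P ** Q = 0" "Q ** P = 0"
    unfolding P_def Q_def by (metis matrix_mul_assoc zero(3))+
  have unit: "B ** (A ** (adj2 A ** adj2 B)) = mat 1" "B ** (adj2 A ** (A ** adj2 B)) = mat 1"
    using adj2_inverse[OF det(1)] adj2_inverse[OF det(2)] by (metis matrix_mul_assoc matrix_mul_rid)+
  have K1: "A ** (B ** (adj2 A ** adj2 B)) = mat 1 + P"
    unfolding P_def N_def mat_mult_diff(1) using unit(1) by (simp flip: matrix_mul_assoc)
  have "adj2 A ** B - B ** adj2 A = - N"
    unfolding N_def by (cases A rule: mat2_cases, cases B rule: mat2_cases) (simp add: algebra_simps)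
  then have "(adj2 A ** B - B ** adj2 A) ** (A ** adj2 B) = - Q"
    unfolding Q_def by (cases N rule: mat2_cases, cases "A ** adj2 B" rule: mat2_cases) (simp add: algebra_simps)
  then have K2: "adj2 A ** (B ** (A ** adj2 B)) = mat 1 - Q"
    unfolding mat_mult_diff(1) using unit(2) by (simp add: algebra_simps flip: matrix_mul_assoc)
  show ?thesis
    unfolding K1 K2 by (simp add: mat_mult_diff matrix_add_ldistrib matrix_add_rdistrib' PQ)
qed


section \<open>The characters of the bundle group\<close>

definition gen_rep :: "(gen word set \<Rightarrow> complex^2^2) \<Rightarrow> gen \<Rightarrow> complex^2^2" where
  "gen_rep = gen_matrix bundle_relations"

definition chi :: "(gen \<Rightarrow> complex^2^2) \<Rightarrow> gen word set \<Rightarrow> complex" where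
  "chi E = character piN (rep_of E)"

definition characters :: "(gen word set \<Rightarrow> complex) set" where
  "characters = character piN ` hom piN SL2C"

abbreviation wc :: "gen word \<Rightarrow> gen word set" where
  "wc \<equiv> word_class bundle_relations"

lemma bundle_repD:
  assumes "bundle_rep E"
  shows "det (E g) = 1" "(u, v) \<in> bundle_relations \<Longrightarrow> eval_word E u = eval_word E v"
  using assms unfolding bundle_rep_iff by auto

lemma carrier_piN: "carrier piN = range wc"
  by (simp add: piN_def carrier_presented_group)

lemma rep_of_hom_piN: "bundle_rep E \<Longrightarrow> rep_of E \<in> hom piN SL2C"
  unfolding piN_def by (rule rep_of_hom) (auto dest: bundle_repD)

lemma rep_of_wc: "bundle_rep E \<Longrightarrow> rep_of E (wc w) = eval_word E w"
  by (rule rep_of_word_class) (auto dest: bundle_repD)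

lemma chi_wc: "bundle_rep E \<Longrightarrow> chi E (wc w) = trace (eval_word E w)"
  by (simp add: chi_def character_def carrier_piN rep_of_wc)

lemma bundle_rep_gen_rep: "\<rho> \<in> hom piN SL2C \<Longrightarrow> bundle_rep (gen_rep \<rho>)"
  unfolding bundle_rep_iff gen_rep_def piN_def by (auto dest: hom_word_class(1) hom_relation)

lemma hom_wc: "\<rho> \<in> hom piN SL2C \<Longrightarrow> \<rho> (wc w) = eval_word (gen_rep \<rho>) w"
  unfolding gen_rep_def piN_def by (rule hom_word_class(2))

lemma character_eq_chi:
  assumes "\<rho> \<in> hom piN SL2C"
  shows "character piN \<rho> = chi (gen_rep \<rho>)"
proof
  fix \<gamma>
  show "character piN \<rho> \<gamma> = chi (gen_rep \<rho>) \<gamma>"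
  proof (cases "\<gamma> \<in> carrier piN")
    case True
    then obtain w where "\<gamma> = wc w" by (auto simp: carrier_piN)
    then show ?thesis
      using True chi_wc[OF bundle_rep_gen_rep[OF assms]] hom_wc[OF assms] by (simp add: character_def)
  qed (simp add: character_def chi_def)
qed

lemma characters_eq: "characters = chi ` {E. bundle_rep E}"
  unfolding characters_def
proof (intro equalityI image_subsetI)
  show "character piN \<rho> \<in> chi ` {E. bundle_rep E}" if "\<rho> \<in> hom piN SL2C" for \<rho>
    using that character_eq_chi bundle_rep_gen_rep by blast
  show "chi E \<in> character piN ` hom piN SL2C" if "E \<in> {E. bundle_rep E}" for E
    using that rep_of_hom_piN unfolding chi_def by blast
qed

lemma chi_eqI:
  assumes "bundle_rep E" "bundle_rep E'" "\<And>f. f \<in> basic_traces \<Longrightarrow> f E = f E'"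
  shows "chi E = chi E'"
proof
  fix \<gamma>
  show "chi E \<gamma> = chi E' \<gamma>"
  proof (cases "\<gamma> \<in> carrier piN")
    case True
    then obtain w where "\<gamma> = wc w" by (auto simp: carrier_piN)
    then show ?thesis
      using assms bundle_repD(1) trace_eval_word_determined[of E E' w] by (simp add: chi_wc)
  qed (simp add: character_def chi_def)
qed

lemma graded_functions_trace_algebra: "graded_functions (\<lambda>_. trace_algebra piN)"
  by unfold_locales (auto simp: trace_algebra_def intro: generated_algebra.intros)

interpretation CV: fraction_fspace "\<lambda>_. trace_algebra piN" "char_variety piN" characters
proof -
  interpret graded_functions "\<lambda>_. trace_algebra piN" by (rule graded_functions_trace_algebra)
  have "fractions (\<lambda>_. trace_algebra piN) = trace_algebra piN \<times> trace_algebra piN"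
    by (simp add: fractions_def)
  then show "fraction_fspace (\<lambda>_. trace_algebra piN) (char_variety piN) characters"
    by unfold_locales
      (metis char_variety_def characters_def fraction_model_fraction_space)
qed

lemma trace_algebra_word: "(\<lambda>ch. ch (wc w)) \<in> trace_algebra piN"
  unfolding trace_algebra_def by (rule generated_algebra.gen) (auto simp: carrier_piN)

lemma trace_algebra_in_ring:
  assumes "q \<in> trace_algebra piN"
  shows "\<exists>g\<in>trace_ring. \<forall>E. bundle_rep E \<longrightarrow> q (chi E) = g E"
  using assms unfolding trace_algebra_def
proof induction
  case (const c)
  show ?case by (rule bexI[OF _ generated_algebra.const[of c]]) simp
next
  case (gen f)
  then obtain w where "f = (\<lambda>ch. ch (wc w))" by (auto simp: carrier_piN)
  moreover obtain g where "g \<in> trace_ring" "\<forall>E. (\<forall>x. det (E x) = 1) \<longrightarrow> trace (eval_word E w) = g E"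
    using trace_eval_word_in_ring by blast
  ultimately show ?case using bundle_repD(1) by (intro bexI[of _ g]) (auto simp: chi_wc)
next
  case (add f h)
  then obtain g k where "g \<in> trace_ring" "k \<in> trace_ring"
    "\<forall>E. bundle_rep E \<longrightarrow> f (chi E) = g E" "\<forall>E. bundle_rep E \<longrightarrow> h (chi E) = k E" by blast
  then show ?case by (intro bexI[OF _ generated_algebra.add[of g _ k]]) auto
next
  case (mult f h)
  then obtain g k where "g \<in> trace_ring" "k \<in> trace_ring"
    "\<forall>E. bundle_rep E \<longrightarrow> f (chi E) = g E" "\<forall>E. bundle_rep E \<longrightarrow> h (chi E) = k E" by blast
  then show ?case by (intro bexI[OF _ generated_algebra.mult[of g _ k]]) auto
qed

lemma closedin_zeros: "q \<in> trace_algebra piN \<Longrightarrow> closedin (zar (char_variety piN)) {ch \<in> characters. q ch = 0}"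
proof -
  assume "q \<in> trace_algebra piN"
  then have "openin (zar (char_variety piN)) {ch \<in> characters. q ch \<noteq> 0}" by (rule CV.openin_basic)
  moreover have "characters - {ch \<in> characters. q ch = 0} = {ch \<in> characters. q ch \<noteq> 0}" by blast
  ultimately show ?thesis using CV.points_eq unfolding closedin_def by auto
qed

abbreviation "tr_a ch \<equiv> ch (wc wa)"
abbreviation "tr_b ch \<equiv> ch (wc wb)"
abbreviation "tr_ab ch \<equiv> ch (wc (wa @ wb))"
abbreviation "tr_t ch \<equiv> ch (wc wt)"
abbreviation "tr_at ch \<equiv> ch (wc (wa @ wt))"
abbreviation "tr_bt ch \<equiv> ch (wc (wb @ wt))"
abbreviation "tr_abt ch \<equiv> ch (wc (wa @ wb @ wt))"
abbreviation "tr_l ch \<equiv> ch (wc (wa @ wb @ inv_word wa @ inv_word wb))"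

lemma chi_traces:
  assumes "bundle_rep E"
  shows "tr_a (chi E) = trace (E Gen_a)" "tr_b (chi E) = trace (E Gen_b)" "tr_t (chi E) = trace (E Gen_t)"
    "tr_ab (chi E) = trace (E Gen_a ** E Gen_b)" "tr_at (chi E) = trace (E Gen_a ** E Gen_t)"
    "tr_bt (chi E) = trace (E Gen_b ** E Gen_t)" "tr_abt (chi E) = trace (E Gen_a ** (E Gen_b ** E Gen_t))"
    "tr_l (chi E) = trace (E Gen_a) ^ 2 + trace (E Gen_b) ^ 2 + trace (E Gen_a ** E Gen_b) ^ 2
       - trace (E Gen_a) * trace (E Gen_b) * trace (E Gen_a ** E Gen_b) - 2"
proof -
  have "eval_word E wa = E Gen_a" "eval_word E wb = E Gen_b" "eval_word E wt = E Gen_t"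
    by (simp_all add: wa_def wb_def wt_def)
  then show "tr_a (chi E) = trace (E Gen_a)" "tr_b (chi E) = trace (E Gen_b)" "tr_t (chi E) = trace (E Gen_t)"
    "tr_ab (chi E) = trace (E Gen_a ** E Gen_b)" "tr_at (chi E) = trace (E Gen_a ** E Gen_t)"
    "tr_bt (chi E) = trace (E Gen_b ** E Gen_t)" "tr_abt (chi E) = trace (E Gen_a ** (E Gen_b ** E Gen_t))"
    "tr_l (chi E) = trace (E Gen_a) ^ 2 + trace (E Gen_b) ^ 2 + trace (E Gen_a ** E Gen_b) ^ 2
       - trace (E Gen_a) * trace (E Gen_b) * trace (E Gen_a ** E Gen_b) - 2"
    using trace_commutator[OF bundle_repD(1)[OF assms] bundle_repD(1)[OF assms], of Gen_a Gen_b]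
    by (simp_all add: chi_wc[OF assms] eval_word_append eval_word_inv_word)
qed

section \<open>The two rational curves of characters\<close>

text \<open>The finite parameters at which \<open>z = s - 1 / s\<close> has a pole or a
  zero.\<close>

definition excluded :: "complex set" where
  "excluded = {0, 1, -1}"

definition curve_rep :: "complex \<Rightarrow> complex \<Rightarrow> gen \<Rightarrow> complex^2^2" where
  "curve_rep j s = curve_matrices j ((s + 1 / s) / sqrt2) (s - 1 / s) (1 / (s - 1 / s))"

lemma sqrt2_nonzero: "sqrt2 \<noteq> 0"
  using sqrt2_square by auto

lemma curve_parameter:
  assumes "s \<notin> excluded"
  defines "x \<equiv> (s + 1 / s) / sqrt2" and "z \<equiv> s - 1 / s"
  shows "2 * x ^ 2 = z ^ 2 + 4" "z * (1 / z) = 1" "z \<noteq> 0" "s = (sqrt2 * x + z) / 2"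
proof -
  have s: "s \<noteq> 0" "s ^ 2 \<noteq> 1" using assms(1) by (auto simp: excluded_def power2_eq_1_iff)
  show "z \<noteq> 0" using s by (auto simp: z_def field_simps power2_eq_square)
  then show "z * (1 / z) = 1" by simp
  have "2 * x ^ 2 = (s + 1 / s) ^ 2" using sqrt2_square by (simp add: x_def power_divide)
  also have "\<dots> = z ^ 2 + 4" using s by (simp add: z_def power2_eq_square field_simps)
  finally show "2 * x ^ 2 = z ^ 2 + 4" .
  show "s = (sqrt2 * x + z) / 2" using sqrt2_nonzero by (simp add: x_def z_def)
qed

lemma curve_parameter_exists:
  assumes "2 * x ^ 2 = z ^ 2 + 4" "z \<noteq> 0"
  defines "s \<equiv> (sqrt2 * x + z) / 2"
  shows "s \<notin> excluded" "(s + 1 / s) / sqrt2 = x" "s - 1 / s = z"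
proof -
  have eq: "s * ((sqrt2 * x - z) / 2) = 1"
    using assms(1) sqrt2_square by (simp add: s_def field_simps) algebra
  then have s: "s \<noteq> 0" by auto
  then have inv: "1 / s = (sqrt2 * x - z) / 2" using eq by (simp add: field_simps)
  show z: "s - 1 / s = z" unfolding inv by (simp add: s_def field_simps)
  show "(s + 1 / s) / sqrt2 = x" unfolding inv using sqrt2_nonzero by (simp add: s_def field_simps)
  show "s \<notin> excluded" using s z assms(2) by (auto simp: excluded_def)
qed

context
  fixes j s :: complex
  assumes j: "j ^ 2 = -1" and s: "s \<notin> excluded"
begin

lemma bundle_rep_curve_rep: "bundle_rep (curve_rep j s)"
  unfolding curve_rep_def using curve_parameter[OF s] j by (intro bundle_rep_curve_matrices)

lemma traces_curve_rep:
  fixes x y z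
  defines "x \<equiv> (s + 1 / s) / sqrt2" and "z \<equiv> s - 1 / s"
  defines "y \<equiv> 2 * x / z"
  shows "tr_a (chi (curve_rep j s)) = x" "tr_b (chi (curve_rep j s)) = y" "tr_ab (chi (curve_rep j s)) = z"
    "tr_t (chi (curve_rep j s)) = j * z ^ 2 / 2" "tr_at (chi (curve_rep j s)) = j * x"
    "tr_bt (chi (curve_rep j s)) = j * (x * z - y)" "tr_abt (chi (curve_rep j s)) = j * z"
  using traces_curve_matrices[OF j curve_parameter(1,2)[OF s]]
  unfolding chi_traces[OF bundle_rep_curve_rep] by (simp_all add: curve_rep_def x_def y_def z_def)

end

definition curve :: "complex \<Rightarrow> (gen word set \<Rightarrow> complex) set" where
  "curve j = (\<lambda>s. chi (curve_rep j s)) ` (- excluded)"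

text \<open>The inverse of the parametrization. Being linear in two traces, it is regular on the
  whole character variety.\<close>

definition curve_coord :: "(gen word set \<Rightarrow> complex) \<Rightarrow> complex" where
  "curve_coord ch = (sqrt2 * tr_a ch + tr_ab ch) / 2"

lemma curve_coord_chi: "j ^ 2 = -1 \<Longrightarrow> s \<notin> excluded \<Longrightarrow> curve_coord (chi (curve_rep j s)) = s"
  unfolding curve_coord_def using traces_curve_rep curve_parameter(4) by simp

lemma curve_coord_in: "curve_coord \<in> trace_algebra piN"
proof -
  have "(\<lambda>ch. (sqrt2 / 2) * tr_a ch + (1 / 2) * tr_ab ch) \<in> trace_algebra piN"
    unfolding trace_algebra_def
    by (intro generated_algebra.add generated_algebra.mult generated_algebra.const)
      (use trace_algebra_word in \<open>auto simp: trace_algebra_def\<close>)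
  moreover have "curve_coord = (\<lambda>ch. (sqrt2 / 2) * tr_a ch + (1 / 2) * tr_ab ch)"
    by (auto simp: curve_coord_def fun_eq_iff add_divide_distrib)
  ultimately show ?thesis by simp
qed

lemma basic_traces_chi:
  assumes "bundle_rep E" "bundle_rep E'"
    and "tr_a (chi E) = tr_a (chi E')" "tr_b (chi E) = tr_b (chi E')" "tr_t (chi E) = tr_t (chi E')"
    "tr_ab (chi E) = tr_ab (chi E')" "tr_at (chi E) = tr_at (chi E')" "tr_bt (chi E) = tr_bt (chi E')"
    "tr_abt (chi E) = tr_abt (chi E')"
  shows "chi E = chi E'"
  using assms by (intro chi_eqI) (auto simp: basic_traces_def chi_traces)

text \<open>The equations make the curve closed. A solution determines \<open>s\<close> through the
  conic, and the seven traces determine the character.\<close>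

lemma curve_eq:
  assumes j: "j ^ 2 = -1"
  shows "curve j = {ch \<in> characters. 2 * tr_a ch ^ 2 = tr_ab ch ^ 2 + 4 \<and> tr_b ch * tr_ab ch = 2 * tr_a ch \<and>
    tr_t ch = j * tr_ab ch ^ 2 / 2 \<and> tr_at ch = j * tr_a ch \<and>
    tr_bt ch = j * (tr_a ch * tr_ab ch - tr_b ch) \<and> tr_abt ch = j * tr_ab ch}" (is "_ = ?R")
proof
  show "curve j \<subseteq> ?R"
    unfolding curve_def
  proof (rule image_subsetI)
    fix s assume "s \<in> - excluded"
    then have s: "s \<notin> excluded" by simp
    show "chi (curve_rep j s) \<in> ?R"
      using bundle_rep_curve_rep[OF j s] curve_parameter[OF s]
      by (simp add: traces_curve_rep[OF j s] characters_eq)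
  qed
  show "?R \<subseteq> curve j"
  proof
    fix ch assume ch: "ch \<in> ?R"
    then obtain E where E: "bundle_rep E" "ch = chi E" by (auto simp: characters_eq)
    have z: "tr_ab ch \<noteq> 0" using ch by auto
    define s where "s = (sqrt2 * tr_a ch + tr_ab ch) / 2"
    have s: "s \<notin> excluded" "(s + 1 / s) / sqrt2 = tr_a ch" "s - 1 / s = tr_ab ch"
      using curve_parameter_exists[of "tr_a ch" "tr_ab ch"] ch z by (auto simp: s_def)
    have y: "tr_b ch = 2 * tr_a ch / tr_ab ch" using ch z by (simp add: field_simps)
    have "chi E = chi (curve_rep j s)"
      using ch y unfolding E(2)[symmetric]
      by (intro basic_traces_chi[OF E(1) bundle_rep_curve_rep[OF j s(1)], unfolded E(2)[symmetric]])
        (simp_all add: traces_curve_rep[OF j s(1)] s)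
    then show "ch \<in> curve j" using s E unfolding curve_def by blast
  qed
qed

lemma trace_algebra_closure:
  "(\<lambda>_. c) \<in> trace_algebra piN"
  "f \<in> trace_algebra piN \<Longrightarrow> g \<in> trace_algebra piN \<Longrightarrow> (\<lambda>x. f x + g x) \<in> trace_algebra piN"
  "f \<in> trace_algebra piN \<Longrightarrow> g \<in> trace_algebra piN \<Longrightarrow> (\<lambda>x. f x - g x) \<in> trace_algebra piN"
  "f \<in> trace_algebra piN \<Longrightarrow> g \<in> trace_algebra piN \<Longrightarrow> (\<lambda>x. f x * g x) \<in> trace_algebra piN"
  "f \<in> trace_algebra piN \<Longrightarrow> (\<lambda>x. f x ^ n) \<in> trace_algebra piN"
  unfolding trace_algebra_def
  by (auto intro: generated_algebra.intros generated_algebra_diff generated_algebra_power)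

lemma closed_curve:
  assumes j: "j ^ 2 = -1"
  shows "closedin (zar (char_variety piN)) (curve j)"
proof -
  let ?Z = "\<lambda>q. {ch \<in> characters. q ch = 0}"
  have "curve j = ?Z (\<lambda>ch. 2 * tr_a ch ^ 2 - (tr_ab ch ^ 2 + 4)) \<inter> ?Z (\<lambda>ch. tr_b ch * tr_ab ch - 2 * tr_a ch) \<inter>
    ?Z (\<lambda>ch. tr_t ch - (j / 2) * tr_ab ch ^ 2) \<inter> ?Z (\<lambda>ch. tr_at ch - j * tr_a ch) \<inter>
    ?Z (\<lambda>ch. tr_bt ch - j * (tr_a ch * tr_ab ch - tr_b ch)) \<inter> ?Z (\<lambda>ch. tr_abt ch - j * tr_ab ch)"
    unfolding curve_eq[OF j] by auto
  also have "closedin (zar (char_variety piN)) \<dots>"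
    by (intro closedin_Int closedin_zeros trace_algebra_closure trace_algebra_word)
  finally show ?thesis .
qed

lemma characters_decomposition:
  "characters \<subseteq> {ch \<in> characters. tr_l ch - 2 = 0} \<union> {ch \<in> characters. tr_b ch = 0} \<union> curve \<i> \<union> curve (-\<i>)"
proof
  fix ch assume ch: "ch \<in> characters"
  then obtain E where E: "bundle_rep E" "ch = chi E" by (auto simp: characters_eq)
  note tr = chi_traces[OF E(1), folded E(2)]
  note eqs = bundle_rep_trace_equations[OF E(1), folded tr]
  show "ch \<in> {ch \<in> characters. tr_l ch - 2 = 0} \<union> {ch \<in> characters. tr_b ch = 0} \<union> curve \<i> \<union> curve (-\<i>)"
  proof (cases "tr_l ch = 2 \<or> tr_b ch = 0")
    case False
    then have "tr_a ch ^ 2 + tr_b ch ^ 2 + tr_ab ch ^ 2 - tr_a ch * tr_b ch * tr_ab ch - 2 \<noteq> 2"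
      unfolding tr by simp
    note curve_equations[OF eqs _ this]
    then obtain c where "c \<in> {\<i>, -\<i>}" "2 * tr_a ch ^ 2 = tr_ab ch ^ 2 + 4"
      "tr_t ch = c * tr_ab ch ^ 2 / 2 \<and> tr_at ch = c * tr_a ch \<and>
       tr_bt ch = c * (tr_a ch * tr_ab ch - tr_b ch) \<and> tr_abt ch = c * tr_ab ch"
      using False by blast
    moreover have "c ^ 2 = -1" using calculation(1) by auto
    ultimately have "ch \<in> curve c" unfolding curve_eq[OF \<open>c ^ 2 = -1\<close>] using ch eqs(1) by simp
    then show ?thesis using \<open>c \<in> {\<i>, -\<i>}\<close> by auto
  qed (use ch in auto)
qed

section \<open>Faithful characters avoid the degenerate pieces\<close>

text \<open>A relation between the matrices of a faithful representation is a relation of the group,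
  hence holds in every representation. One test representation suffices to refute it.\<close>

lemma faithful_eval_word:
  assumes \<rho>: "\<rho> \<in> hom piN SL2C" "inj_on \<rho> (carrier piN)"
    and eq: "eval_word (gen_rep \<rho>) u = eval_word (gen_rep \<rho>) v" and E: "bundle_rep E"
  shows "eval_word E u = eval_word E v"
proof -
  have "\<rho> (wc u) = \<rho> (wc v)" using eq hom_wc[OF \<rho>(1)] by simp
  then have "wc u = wc v" using \<rho>(2) by (auto simp: inj_on_def carrier_piN)
  then have "word_eq bundle_relations u v" by (simp add: word_class_eq_iff)
  then show ?thesis by (rule eval_word_cong_word_eq) (use bundle_repD[OF E] in auto)
qed

text \<open>The point \<open>x = 10\<close>, \<open>z = 14\<close> of the conic is integral, as
  \<open>2 * 100 = 196 + 4\<close>, and \<open>(z^2 - 4) / 8 = 24\<close> makes the matrix of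
  \<open>a\<close> integral too.\<close>

definition test_rep :: "gen \<Rightarrow> complex^2^2" where
  "test_rep = curve_matrices \<i> 10 14 (1 / 14)"

lemma bundle_rep_test_rep: "bundle_rep test_rep"
  unfolding test_rep_def by (rule bundle_rep_curve_matrices) auto

lemma faithful_not_excluded:
  assumes "discrete_faithful piN \<rho>"
  shows "tr_b (character piN \<rho>) \<noteq> 0" "tr_l (character piN \<rho>) \<noteq> 2"
proof -
  have \<rho>: "\<rho> \<in> hom piN SL2C" "inj_on \<rho> (carrier piN)" using assms by (auto simp: discrete_faithful_def)
  define E where "E = gen_rep \<rho>"
  have E: "bundle_rep E" "character piN \<rho> = chi E"
    unfolding E_def using bundle_rep_gen_rep character_eq_chi \<rho> by auto
  note faithful = faithful_eval_word[OF \<rho> _ bundle_rep_test_rep, folded E_def]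
  note det = bundle_repD(1)[OF E(1)]
  have ev: "eval_word F wa = F Gen_a" "eval_word F wb = F Gen_b" for F
    by (simp_all add: wa_def wb_def)
  let ?B = "test_rep Gen_b" and ?A = "test_rep Gen_a"
  have detT: "det ?A = 1" "det ?B = 1" using bundle_repD(1)[OF bundle_rep_test_rep] by auto
  have trB: "trace ?B = 10 / 7" by (simp add: test_rep_def curve_matrices_def)
  show "tr_b (character piN \<rho>) \<noteq> 0"
  proof
    assume "tr_b (character piN \<rho>) = 0"
    then have "trace (E Gen_b) = 0" using chi_traces[OF E(1)] E(2) by simp
    then have "E Gen_b ** (E Gen_b ** N) = - N" for N :: "complex^2^2"
      using mult_self_eq[OF det[of Gen_b], of N]
      by (cases "E Gen_b ** N" rule: mat2_cases, cases N rule: mat2_cases) simp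
    note square = this[of "E Gen_b ** E Gen_b"] this[of "mat 1"]
    have "eval_word E (wb @ wb @ wb @ wb) = eval_word E []"
      using square by (simp add: eval_word_append ev)
    then have "eval_word test_rep (wb @ wb @ wb @ wb) = eval_word test_rep []" by (rule faithful)
    then have "?B ** (?B ** (?B ** ?B)) = mat 1" by (simp add: eval_word_append ev)
    \<comment> \<open>The matrix \<open>?B\<close> has trace \<open>10 / 7\<close>, its square
      \<open>2 / 49\<close>, so its fourth power does not have trace 2.\<close>
    moreover have "trace (?B ** (?B ** (?B ** ?B))) = trace (?B ** ?B) ^ 2 - 2"
      using trace_square[of "?B ** ?B"] detT by (simp add: det_mul matrix_mul_assoc)
    ultimately show False
      using trace_square[OF detT(2)] trB by (simp add: power2_eq_square field_simps)
  qed
  show "tr_l (character piN \<rho>) \<noteq> 2"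
  proof
    assume "tr_l (character piN \<rho>) = 2"
    then have "trace (E Gen_a ** (E Gen_b ** (adj2 (E Gen_a) ** adj2 (E Gen_b)))) = 2"
      using chi_wc[OF E(1)] E(2) by (simp add: eval_word_append eval_word_inv_word ev)
    note reducible_commutators_commute[OF det det this]
    then have "eval_word E ((wa @ wb @ inv_word wa @ inv_word wb) @ (inv_word wa @ wb @ wa @ inv_word wb)) =
        eval_word E ((inv_word wa @ wb @ wa @ inv_word wb) @ (wa @ wb @ inv_word wa @ inv_word wb))"
      unfolding eval_word_append eval_word_inv_word ev .
    from faithful[OF this] have eq: "(?A ** (?B ** (adj2 ?A ** adj2 ?B))) ** (adj2 ?A ** (?B ** (?A ** adj2 ?B))) =
        (adj2 ?A ** (?B ** (?A ** adj2 ?B))) ** (?A ** (?B ** (adj2 ?A ** adj2 ?B)))"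
      unfolding eval_word_append eval_word_inv_word ev .
    have A: "?A = mat2 5 1 24 5"
      and B: "?B = mat2 (5 / 7) ((1 - sqrt2) / 7) (24 * (1 + sqrt2) / 7) (5 / 7)"
      by (simp_all add: test_rep_def curve_matrices_def)
    have K1: "?A ** (?B ** (adj2 ?A ** adj2 ?B)) = mat2 ((2353 + 2352 * sqrt2) / 49) (480 * (1 - sqrt2) / 49)
        (11520 * (1 + sqrt2) / 49) ((2353 - 2352 * sqrt2) / 49)"
      unfolding A B using sqrt2_square by (simp add: field_simps power2_eq_square)
    have K2: "adj2 ?A ** (?B ** (?A ** adj2 ?B)) = mat2 ((2353 - 48 * sqrt2) / 49) (- 480 / 49)
        (- 11520 / 49) ((2353 + 48 * sqrt2) / 49)"
      unfolding A B using sqrt2_square by (simp add: field_simps power2_eq_square)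
    \<comment> \<open>The difference of the upper left entries of the two products, times
      \<open>49^2\<close>; only the entries off the diagonals contribute.\<close>
    have "11520 * sqrt2 * 960 = 0"
      using eq sqrt2_square unfolding K1 K2 by (simp add: field_simps)
    then show False using sqrt2_nonzero by simp
  qed
qed

section \<open>The geometry of the curve of characters\<close>

definition excluded_poly :: "complex poly" where
  "excluded_poly = [:0, 1:] * [:-1, 0, 1:]"

lemma poly_excluded_poly: "poly excluded_poly s = s * (s ^ 2 - 1)"
  by (simp add: excluded_poly_def power2_eq_square algebra_simps)

lemma poly_excluded_poly_nonzero: "s \<notin> excluded \<Longrightarrow> poly excluded_poly s \<noteq> 0"
  by (auto simp: poly_excluded_poly excluded_def power2_eq_1_iff)

lemma eventually_not_excluded: "\<forall>\<^sub>F s in cofinite. s \<notin> excluded"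
  by (simp add: eventually_cofinite excluded_def)

text \<open>Regular functions on the line without 0, 1, -1: polynomials divided by a power of
  \<open>s (s^2 - 1)\<close>. The values at excluded \<open>s\<close> are left free.\<close>

definition laurent :: "(complex \<Rightarrow> complex) \<Rightarrow> bool" where
  "laurent f \<longleftrightarrow> (\<exists>N k. \<forall>s. s \<notin> excluded \<longrightarrow> f s * poly excluded_poly s ^ k = poly N s)"

lemma laurent_const: "laurent (\<lambda>_. c)"
  unfolding laurent_def by (intro exI[of _ "[:c:]"] exI[of _ 0]) simp

lemma laurent_add:
  assumes "laurent f" "laurent g"
  shows "laurent (\<lambda>s. f s + g s)"
proof -
  obtain M k where f: "\<And>s. s \<notin> excluded \<Longrightarrow> f s * poly excluded_poly s ^ k = poly M s"
    using assms(1) unfolding laurent_def by blast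
  obtain N l where g: "\<And>s. s \<notin> excluded \<Longrightarrow> g s * poly excluded_poly s ^ l = poly N s"
    using assms(2) unfolding laurent_def by blast
  have "(f s + g s) * poly excluded_poly s ^ (k + l) = poly (M * excluded_poly ^ l + N * excluded_poly ^ k) s"
    if "s \<notin> excluded" for s
    using f[OF that, symmetric] g[OF that, symmetric] by (simp add: power_add algebra_simps)
  then show ?thesis unfolding laurent_def by blast
qed

lemma laurent_mult:
  assumes "laurent f" "laurent g"
  shows "laurent (\<lambda>s. f s * g s)"
proof -
  obtain M k where f: "\<And>s. s \<notin> excluded \<Longrightarrow> f s * poly excluded_poly s ^ k = poly M s"
    using assms(1) unfolding laurent_def by blast
  obtain N l where g: "\<And>s. s \<notin> excluded \<Longrightarrow> g s * poly excluded_poly s ^ l = poly N s"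
    using assms(2) unfolding laurent_def by blast
  have "(f s * g s) * poly excluded_poly s ^ (k + l) = poly (M * N) s" if "s \<notin> excluded" for s
    using f[OF that, symmetric] g[OF that, symmetric] by (simp add: power_add algebra_simps)
  then show ?thesis unfolding laurent_def by blast
qed

lemma laurent_cong: "laurent f \<Longrightarrow> (\<And>s. s \<notin> excluded \<Longrightarrow> f s = g s) \<Longrightarrow> laurent g"
  unfolding laurent_def by auto

lemma laurent_basic: "laurent (\<lambda>s. s)" "laurent (\<lambda>s. 1 / s)" "laurent (\<lambda>s. 1 / (s ^ 2 - 1))"
proof -
  show "laurent (\<lambda>s. s)"
    unfolding laurent_def by (intro exI[of _ "[:0, 1:]"] exI[of _ 0]) simp
  have "1 / s * poly excluded_poly s ^ 1 = poly [:-1, 0, 1:] s" if "s \<notin> excluded" for s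
    using that by (simp add: excluded_poly_def excluded_def)
  then show "laurent (\<lambda>s. 1 / s)" unfolding laurent_def by blast
  have "1 / (s ^ 2 - 1) * poly excluded_poly s ^ 1 = poly [:0, 1:] s" if "s \<notin> excluded" for s
    using poly_excluded_poly_nonzero[OF that] by (simp add: poly_excluded_poly)
  then show "laurent (\<lambda>s. 1 / (s ^ 2 - 1))" unfolding laurent_def by blast
qed

lemma laurent_traces:
  defines "x \<equiv> \<lambda>s. (s + 1 / s) / sqrt2" and "z \<equiv> \<lambda>s. s - 1 / s"
  shows "laurent x" "laurent z" "laurent (\<lambda>s. 2 * x s / z s)"
proof -
  have "laurent (\<lambda>s. (s + 1 / s) * (1 / sqrt2))"
    by (intro laurent_add laurent_mult laurent_const laurent_basic)
  then show x: "laurent x" unfolding x_def by simp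
  have "laurent (\<lambda>s. s + (-1) * (1 / s))"
    by (intro laurent_add laurent_mult laurent_const laurent_basic)
  then show "laurent z" unfolding z_def by simp
  have "laurent (\<lambda>s. 2 * x s * (s * (1 / (s ^ 2 - 1))))"
    by (intro laurent_mult laurent_const laurent_basic x)
  then show "laurent (\<lambda>s. 2 * x s / z s)"
  proof (rule laurent_cong)
    fix s :: complex assume "s \<notin> excluded"
    then have "s \<noteq> 0" "s ^ 2 - 1 \<noteq> 0" by (auto simp: excluded_def power2_eq_1_iff)
    moreover from this have "1 / z s = s * (1 / (s ^ 2 - 1))"
      unfolding z_def by (simp add: field_simps power2_eq_square)
    ultimately show "2 * x s * (s * (1 / (s ^ 2 - 1))) = 2 * x s / z s"
      by (metis mult.right_neutral times_divide_eq_right)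
  qed
qed

lemma trace_ring_laurent:
  assumes j: "j ^ 2 = -1" and g: "g \<in> trace_ring"
  shows "laurent (\<lambda>s. g (curve_rep j s))"
  using g
proof induction
  case (gen f)
  note chi = chi_traces[OF bundle_rep_curve_rep[OF j], symmetric]
  note tr = traces_curve_rep[OF j]
  have diff: "laurent (\<lambda>s. f s - g s)" if "laurent f" "laurent g" for f g
    using laurent_add[OF that(1) laurent_mult[OF laurent_const[of "-1"] that(2)]] by simp
  define x z where "x = (\<lambda>s. (s + 1 / s) / sqrt2)" and "z = (\<lambda>s::complex. s - 1 / s)"
  have base: "laurent x" "laurent z" "laurent (\<lambda>s. 2 * x s / z s)"
    using laurent_traces unfolding x_def z_def by auto
  have "laurent (\<lambda>s. j * (z s * z s) * (1 / 2))" "laurent (\<lambda>s. j * x s)" "laurent (\<lambda>s. j * z s)"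
    "laurent (\<lambda>s. j * (x s * z s - 2 * x s / z s))"
    by (intro laurent_mult laurent_const base diff)+
  note lau = base this
  have "laurent (\<lambda>s. trace (curve_rep j s Gen_a))" "laurent (\<lambda>s. trace (curve_rep j s Gen_b))"
    "laurent (\<lambda>s. trace (curve_rep j s Gen_a ** curve_rep j s Gen_b))"
    "laurent (\<lambda>s. trace (curve_rep j s Gen_t))" "laurent (\<lambda>s. trace (curve_rep j s Gen_a ** curve_rep j s Gen_t))"
    "laurent (\<lambda>s. trace (curve_rep j s Gen_b ** curve_rep j s Gen_t))"
    "laurent (\<lambda>s. trace (curve_rep j s Gen_a ** (curve_rep j s Gen_b ** curve_rep j s Gen_t)))"
    by (rule laurent_cong[OF lau(1)] laurent_cong[OF lau(3)] laurent_cong[OF lau(2)] laurent_cong[OF lau(4)]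
        laurent_cong[OF lau(5)] laurent_cong[OF lau(7)] laurent_cong[OF lau(6)],
        simp add: chi tr x_def z_def power2_eq_square; fail)+
  then show ?case using gen unfolding basic_traces_def by auto
qed (auto intro: laurent_const laurent_add laurent_mult)

lemma trace_algebra_laurent:
  assumes j: "j ^ 2 = -1" and q: "q \<in> trace_algebra piN"
  shows "laurent (\<lambda>s. q (chi (curve_rep j s)))"
proof -
  obtain g where g: "g \<in> trace_ring" "\<forall>E. bundle_rep E \<longrightarrow> q (chi E) = g E"
    using trace_algebra_in_ring[OF q] by blast
  show ?thesis
    using trace_ring_laurent[OF j g(1)] by (rule laurent_cong) (simp add: g(2) bundle_rep_curve_rep[OF j])
qed

lemma curve_subset: "j ^ 2 = -1 \<Longrightarrow> curve j \<subseteq> characters"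
  using curve_eq by blast

lemma curveE:
  assumes "ch \<in> curve j" "j ^ 2 = -1"
  shows "curve_coord ch \<notin> excluded" "ch = chi (curve_rep j (curve_coord ch))"
  using assms curve_coord_chi by (auto simp: curve_def)

lemma sub_curve_fspace:
  "j ^ 2 = -1 \<Longrightarrow> fraction_fspace (\<lambda>_. trace_algebra piN) (sub_fspace (char_variety piN) (curve j)) (curve j)"
  using CV.sub_fraction_fspace[of "curve j"] curve_subset by (simp add: Int_absorb1)

text \<open>A trace function that is nonzero at one point of the curve has a nonzero numerator in
  \<open>s\<close>, hence only finitely many zeros.\<close>

lemma curve_open_cofinite:
  assumes j: "j ^ 2 = -1" and U: "openin (zar (sub_fspace (char_variety piN) (curve j))) U" "U \<noteq> {}"
  shows "\<forall>\<^sub>F s in cofinite. s \<notin> excluded \<and> chi (curve_rep j s) \<in> U"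
proof -
  interpret F: fraction_fspace "\<lambda>_. trace_algebra piN" "sub_fspace (char_variety piN) (curve j)" "curve j"
    by (rule sub_curve_fspace[OF j])
  obtain ch where ch: "ch \<in> U" using U by blast
  then obtain q where q: "q \<in> trace_algebra piN" "q ch \<noteq> 0" "{y \<in> curve j. q y \<noteq> 0} \<subseteq> U"
    using F.openin_basic_nbhd[OF U(1)] by blast
  obtain N k where N: "\<And>s. s \<notin> excluded \<Longrightarrow> q (chi (curve_rep j s)) * poly excluded_poly s ^ k = poly N s"
    using trace_algebra_laurent[OF j q(1)] unfolding laurent_def by blast
  have "ch \<in> curve j" using F.openin_subset_S[OF U(1)] ch by blast
  note s = curveE[OF this j]
  have "poly N (curve_coord ch) \<noteq> 0"
    using N[OF s(1)] s(2) q(2) poly_excluded_poly_nonzero[OF s(1)] by auto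
  then have "N \<noteq> 0" by auto
  from eventually_poly_nonzero[OF this] eventually_not_excluded show ?thesis
  proof eventually_elim
    case (elim s)
    then have "q (chi (curve_rep j s)) \<noteq> 0" using N[of s] by auto
    then show ?case using elim q(3) unfolding curve_def by blast
  qed
qed

lemma infinite_curve: "j ^ 2 = -1 \<Longrightarrow> infinite (curve j)"
proof
  assume j: "j ^ 2 = -1" and "finite (curve j)"
  then have "finite (curve_coord ` curve j)" by simp
  moreover have "- excluded \<subseteq> curve_coord ` curve j"
  proof
    fix s assume s: "s \<in> - excluded"
    then have "curve_coord (chi (curve_rep j s)) = s" using curve_coord_chi[OF j] by simp
    then show "s \<in> curve_coord ` curve j" using s unfolding curve_def by (metis imageI)
  qed
  ultimately have "finite (- excluded)" by (rule finite_subset[rotated])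
  moreover have "finite excluded" by (simp add: excluded_def)
  ultimately have "finite (UNIV :: complex set)" by (metis Compl_partition finite_UnI)
  then show False using infinite_UNIV_char_0 by blast
qed

lemma irreducible_curveI:
  assumes "closedin (zar V) C" "infinite C" "\<And>A. closedin (zar V) A \<Longrightarrow> C \<subseteq> A \<or> finite (A \<inter> C)"
    "\<And>x. x \<in> C \<Longrightarrow> closedin (zar V) {x}"
  shows "irreducible_curve V C"
  unfolding irreducible_curve_def using cofinite_irreducible_dim_one[OF assms] assms(1) by blast

lemma irreducible_curve_curve:
  assumes j: "j ^ 2 = -1"
  shows "irreducible_curve (char_variety piN) (curve j)"
proof (rule irreducible_curveI[OF closed_curve[OF j] infinite_curve[OF j]])
    fix A assume A: "closedin (zar (char_variety piN)) A"
    show "curve j \<subseteq> A \<or> finite (A \<inter> curve j)"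
    proof (cases "curve j \<subseteq> A")
      case False
      let ?U = "(characters - A) \<inter> curve j"
      have "openin (zar (char_variety piN)) (characters - A)"
        using A CV.points_eq by (metis closedin_def)
      then have "openin (zar (sub_fspace (char_variety piN) (curve j))) ?U"
        by (auto simp: openin_subtopology)
      moreover have "?U \<noteq> {}" using False curve_subset[OF j] by blast
      ultimately have "\<forall>\<^sub>F s in cofinite. s \<notin> excluded \<and> chi (curve_rep j s) \<in> ?U"
        by (rule curve_open_cofinite[OF j])
      then have fin: "finite {s. \<not> (s \<notin> excluded \<and> chi (curve_rep j s) \<in> ?U)}"
        by (simp add: eventually_cofinite)
      have "A \<inter> curve j \<subseteq> (\<lambda>s. chi (curve_rep j s)) ` {s. \<not> (s \<notin> excluded \<and> chi (curve_rep j s) \<in> ?U)}"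
        unfolding curve_def by blast
      then show ?thesis using fin finite_surj by blast
    qed simp
  next
    fix ch assume ch: "ch \<in> curve j"
    have "(\<lambda>ch'. curve_coord ch' - curve_coord ch) \<in> trace_algebra piN"
      by (intro trace_algebra_closure curve_coord_in)
    then have "closedin (zar (char_variety piN)) ({ch' \<in> characters. curve_coord ch' - curve_coord ch = 0} \<inter> curve j)"
      by (intro closedin_Int closedin_zeros closed_curve[OF j])
    moreover have "{ch' \<in> characters. curve_coord ch' - curve_coord ch = 0} \<inter> curve j = {ch}"
      using ch curve_subset[OF j] curveE(2)[OF _ j] by (auto, metis)
    ultimately show "closedin (zar (char_variety piN)) {ch}" by simp
qed

text \<open>An irreducible set covered by finitely many closed sets lies in one of them. The
  faithful character rules out the degenerate pieces, and maximality turns containment in an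
  irreducible curve into equality.\<close>

lemma component_eq_curve:
  assumes "irreducible_component (char_variety piN) X0" "discrete_faithful piN \<rho>" "character piN \<rho> \<in> X0"
  shows "X0 = curve \<i> \<or> X0 = curve (-\<i>)"
proof -
  let ?T = "zar (char_variety piN)"
  have irr: "irreducible_in ?T X0" and max: "\<And>S. irreducible_in ?T S \<Longrightarrow> X0 \<subseteq> S \<Longrightarrow> S = X0"
    using assms(1) unfolding irreducible_component_def by auto
  have sub: "X0 \<subseteq> characters" using irr CV.points_eq by (auto simp: irreducible_in_def)
  have split: "S \<union> S' \<supseteq> X0 \<Longrightarrow> closedin ?T S \<Longrightarrow> closedin ?T S' \<Longrightarrow> X0 \<subseteq> S \<or> X0 \<subseteq> S'" for S S'
    using irr unfolding irreducible_in_def by blast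
  let ?R = "{ch \<in> characters. tr_l ch - 2 = 0}" and ?Y = "{ch \<in> characters. tr_b ch = 0}"
  have closed: "closedin ?T ?R" "closedin ?T ?Y" "closedin ?T (curve \<i>)" "closedin ?T (curve (-\<i>))"
    by (intro closedin_zeros trace_algebra_closure trace_algebra_word closed_curve; simp)+
  have "X0 \<subseteq> (?R \<union> ?Y) \<union> (curve \<i> \<union> curve (-\<i>))" using sub characters_decomposition by blast
  then have "X0 \<subseteq> ?R \<union> ?Y \<or> X0 \<subseteq> curve \<i> \<union> curve (-\<i>)"
    using closed by (intro split) auto
  moreover have "\<not> X0 \<subseteq> ?R \<union> ?Y"
    using faithful_not_excluded[OF assms(2)] assms(3) by auto
  ultimately have "X0 \<subseteq> curve \<i> \<union> curve (-\<i>)" by blast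
  then have "X0 \<subseteq> curve \<i> \<or> X0 \<subseteq> curve (-\<i>)"
    using closed by (intro split) auto
  moreover have "irreducible_in ?T (curve \<i>)" "irreducible_in ?T (curve (-\<i>))"
    using irreducible_curve_curve[of \<i>] irreducible_curve_curve[of "-\<i>"] by (auto simp: irreducible_curve_def)
  ultimately show ?thesis using max by blast
qed


section \<open>The curve of characters and the projective line\<close>

definition affine_point :: "complex \<Rightarrow> (complex^2) set" where
  "affine_point s = proj_line (chart 2 s)"

definition proj_coord :: "(complex^2) set \<Rightarrow> complex" where
  "proj_coord P = proj_rep P $ 1 / proj_rep P $ 2"

definition affine_part :: "(complex^2) set set" where
  "affine_part = affine_point ` (- excluded)"

lemma two_neq_one: "(2::2) \<noteq> 1"
  by simp

lemma proj_rep_affine_point: "\<exists>c. c \<noteq> 0 \<and> proj_rep (affine_point s) $ 1 = c * s \<and> proj_rep (affine_point s) $ 2 = c"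
proof -
  obtain c where "c \<noteq> 0" "proj_rep (proj_line (chart 2 s)) = c *s chart 2 s" using proj_rep_line by blast
  then show ?thesis using two_neq_one by (intro exI[of _ c]) (auto simp: affine_point_def chart_def)
qed

lemma proj_coord_affine_point: "proj_coord (affine_point s) = s"
  using proj_rep_affine_point[of s] by (auto simp: proj_coord_def)

lemma affine_point_in: "affine_point s \<in> proj_points"
  unfolding affine_point_def by (rule proj_line_in_points[OF chart_nonzero])

lemma affine_part_subset: "affine_part \<subseteq> proj_points"
  using affine_point_in by (auto simp: affine_part_def)

lemma affine_partE:
  assumes "P \<in> affine_part"
  shows "proj_coord P \<notin> excluded" "P = affine_point (proj_coord P)" "proj_rep P $ 2 \<noteq> 0"
  using assms proj_coord_affine_point proj_rep_affine_point by (auto simp: affine_part_def)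

lemma openin_affine_part: "openin (zar proj_space) affine_part"
proof -
  let ?X = "\<lambda>P::(complex^2) set. proj_rep P $ 1" and ?Y = "\<lambda>P::(complex^2) set. proj_rep P $ 2"
  \<comment> \<open>The form \<open>X Y (X^2 - Y^2)\<close> vanishes exactly at 0, infinity, 1 and
    -1.\<close>
  let ?q = "\<lambda>P. ?X P * (?Y P * (?X P * ?X P + (- 1) * (?Y P * ?Y P)))"
  have q: "?q \<in> hom_functions (1 + (1 + (1 + 1)))"
    by (intro PS.mult PS.add PS.scale coord_hom_functions)
  have "affine_part = {P \<in> proj_points. ?q P \<noteq> 0}"
  proof (intro equalityI subsetI)
    fix P assume "P \<in> affine_part"
    then obtain s where s: "s \<notin> excluded" "P = affine_point s" by (auto simp: affine_part_def)
    obtain c where c: "c \<noteq> 0" "?X P = c * s" "?Y P = c" using proj_rep_affine_point[of s] s by blast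
    have "?q P = c ^ 4 * poly excluded_poly s"
      unfolding c poly_excluded_poly by (simp add: power2_eq_square power4_eq_xxxx algebra_simps)
    also have "\<dots> \<noteq> 0" using c poly_excluded_poly_nonzero[OF s(1)] by simp
    finally show "P \<in> {P \<in> proj_points. ?q P \<noteq> 0}"
      unfolding mem_Collect_eq using s(2) affine_point_in by blast
  next
    fix P assume P: "P \<in> {P \<in> proj_points. ?q P \<noteq> 0}"
    then have nz: "?X P \<noteq> 0" "?Y P \<noteq> 0" "?X P * ?X P \<noteq> ?Y P * ?Y P" by auto
    then have "P = affine_point (proj_coord P)"
      using proj_line_chart[of P 2 1] P unfolding affine_point_def proj_coord_def by auto
    moreover have "proj_coord P \<notin> excluded"
      using nz by (auto simp: excluded_def proj_coord_def divide_eq_eq)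
    ultimately show "P \<in> affine_part" unfolding affine_part_def by blast
  qed
  then show ?thesis using PS.openin_basic[OF q] by simp
qed

lemma trace_algebra_poly: "f \<in> trace_algebra piN \<Longrightarrow> (\<lambda>x. poly p (f x)) \<in> trace_algebra piN"
  by (induction p) (auto intro: trace_algebra_closure)

lemma curve_to_line_morphism:
  assumes j: "j ^ 2 = -1" and V: "fraction_fspace (\<lambda>_. trace_algebra piN) V (curve j)"
    and W: "fraction_fspace hom_functions W affine_part"
  shows "morphism V W (\<lambda>ch. affine_point (curve_coord ch))"
proof (rule morphismI[OF V W])
  show "affine_point (curve_coord ch) \<in> affine_part" if "ch \<in> curve j" for ch
    using curveE(1)[OF that j] by (auto simp: affine_part_def)
  fix d and p q :: "(complex^2) set \<Rightarrow> complex"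
  assume "p \<in> hom_functions d" "q \<in> hom_functions d"
  then obtain a b where ab: "p = a \<circ> proj_rep" "q = b \<circ> proj_rep" "homogeneous_poly d a" "homogeneous_poly d b"
    by (auto simp: hom_functions_def)
  obtain A B where "\<And>s. poly A s = a (chart 2 s)" "\<And>s. poly B s = b (chart 2 s)"
    using homogeneous_poly_chart[OF ab(3)] homogeneous_poly_chart[OF ab(4)] by metis
  then have "(q (affine_point s) \<noteq> 0 \<longleftrightarrow> poly B s \<noteq> 0) \<and> p (affine_point s) / q (affine_point s) = poly A s / poly B s" for s
    using homogeneous_poly_line[OF ab(3,4)] by (simp add: affine_point_def ab(1,2))
  then show "\<exists>e. \<exists>p'\<in>trace_algebra piN. \<exists>q'\<in>trace_algebra piN. \<forall>ch\<in>curve j.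
      (q (affine_point (curve_coord ch)) \<noteq> 0 \<longleftrightarrow> q' ch \<noteq> 0) \<and>
      (q' ch \<noteq> 0 \<longrightarrow> p (affine_point (curve_coord ch)) / q (affine_point (curve_coord ch)) = p' ch / q' ch)"
    by (intro exI bexI[OF _ trace_algebra_poly[OF curve_coord_in, of A]]
        bexI[OF _ trace_algebra_poly[OF curve_coord_in, of B]]) blast
qed

text \<open>The powers of \<open>excluded_poly\<close> in the denominators are nonzero at all other
  \<open>s\<close>, so cross multiplication changes neither the quotient nor the zeros of its
  denominator.\<close>

lemma trace_algebra_quotient:
  assumes j: "j ^ 2 = -1" and pq: "p \<in> trace_algebra piN" "q \<in> trace_algebra piN"
  shows "\<exists>P Q. \<forall>s. s \<notin> excluded \<longrightarrow> (q (chi (curve_rep j s)) \<noteq> 0 \<longleftrightarrow> poly Q s \<noteq> 0) \<and>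
    p (chi (curve_rep j s)) / q (chi (curve_rep j s)) = poly P s / poly Q s"
proof -
  obtain M k where M: "\<And>s. s \<notin> excluded \<Longrightarrow> p (chi (curve_rep j s)) * poly excluded_poly s ^ k = poly M s"
    using trace_algebra_laurent[OF j pq(1)] unfolding laurent_def by blast
  obtain N l where N: "\<And>s. s \<notin> excluded \<Longrightarrow> q (chi (curve_rep j s)) * poly excluded_poly s ^ l = poly N s"
    using trace_algebra_laurent[OF j pq(2)] unfolding laurent_def by blast
  show ?thesis
  proof (intro exI allI impI conjI)
    fix s assume s: "s \<notin> excluded"
    note nz = poly_excluded_poly_nonzero[OF s]
    show "q (chi (curve_rep j s)) \<noteq> 0 \<longleftrightarrow> poly (N * excluded_poly ^ k) s \<noteq> 0"
      using N[OF s, symmetric] nz by simp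
    show "p (chi (curve_rep j s)) / q (chi (curve_rep j s)) =
        poly (M * excluded_poly ^ l) s / poly (N * excluded_poly ^ k) s"
      using N[OF s, symmetric] M[OF s, symmetric] nz by simp
  qed
qed

lemma line_to_curve_morphism:
  assumes j: "j ^ 2 = -1" and V: "fraction_fspace (\<lambda>_. trace_algebra piN) V (curve j)"
    and W: "fraction_fspace hom_functions W affine_part"
  shows "morphism W V (\<lambda>P. chi (curve_rep j (proj_coord P)))"
proof (rule morphismI[OF W V])
  show "chi (curve_rep j (proj_coord P)) \<in> curve j" if "P \<in> affine_part" for P
    using affine_partE(1)[OF that] by (auto simp: curve_def)
  fix d and p q :: "(gen word set \<Rightarrow> complex) \<Rightarrow> complex"
  assume pq: "p \<in> trace_algebra piN" "q \<in> trace_algebra piN"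
  obtain A B where AB: "\<And>s. s \<notin> excluded \<Longrightarrow> (q (chi (curve_rep j s)) \<noteq> 0 \<longleftrightarrow> poly B s \<noteq> 0) \<and>
      p (chi (curve_rep j s)) / q (chi (curve_rep j s)) = poly A s / poly B s"
    using trace_algebra_quotient[OF j pq] by blast
  define N where "N = max (degree A) (degree B)"
  have hom: "homogenize 2 1 N A (proj_rep P) = proj_rep P $ 2 ^ N * poly A (proj_coord P)"
    "homogenize 2 1 N B (proj_rep P) = proj_rep P $ 2 ^ N * poly B (proj_coord P)" if "P \<in> affine_part" for P
    using affine_partE(3)[OF that] unfolding proj_coord_def N_def by (auto intro!: homogenize_eq)
  have "\<forall>P\<in>affine_part. (q (chi (curve_rep j (proj_coord P))) \<noteq> 0 \<longleftrightarrow> (homogenize 2 1 N B \<circ> proj_rep) P \<noteq> 0) \<and>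
      ((homogenize 2 1 N B \<circ> proj_rep) P \<noteq> 0 \<longrightarrow> p (chi (curve_rep j (proj_coord P))) / q (chi (curve_rep j (proj_coord P)))
        = (homogenize 2 1 N A \<circ> proj_rep) P / (homogenize 2 1 N B \<circ> proj_rep) P)"
    using AB[OF affine_partE(1)] affine_partE(3) hom by simp
  then show "\<exists>e. \<exists>p'\<in>hom_functions e. \<exists>q'\<in>hom_functions e. \<forall>P\<in>affine_part.
      (q (chi (curve_rep j (proj_coord P))) \<noteq> 0 \<longleftrightarrow> q' P \<noteq> 0) \<and>
      (q' P \<noteq> 0 \<longrightarrow> p (chi (curve_rep j (proj_coord P))) / q (chi (curve_rep j (proj_coord P))) = p' P / q' P)"
    by (intro exI[of _ N] bexI[OF _ homogenize_hom_functions[of 2 1 N A]]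
        bexI[OF _ homogenize_hom_functions[of 2 1 N B]])
qed

lemma curve_line_isomorphisms:
  assumes j: "j ^ 2 = -1" and V: "fraction_fspace (\<lambda>_. trace_algebra piN) V (curve j)"
    and W: "fraction_fspace hom_functions W affine_part"
  shows "isomorphism V W (\<lambda>ch. affine_point (curve_coord ch))"
    "isomorphism W V (\<lambda>P. chi (curve_rep j (proj_coord P)))"
proof -
  interpret V: fraction_fspace "\<lambda>_. trace_algebra piN" V "curve j" by fact
  interpret W: fraction_fspace hom_functions W affine_part by fact
  have "chi (curve_rep j (proj_coord (affine_point (curve_coord ch)))) = ch" if "ch \<in> curve j" for ch
    using curveE(2)[OF that j] by (simp add: proj_coord_affine_point)
  moreover have "affine_point (curve_coord (chi (curve_rep j (proj_coord P)))) = P" if "P \<in> affine_part" for P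
    using affine_partE[OF that] curve_coord_chi[OF j] by simp
  ultimately show "isomorphism V W (\<lambda>ch. affine_point (curve_coord ch))"
    "isomorphism W V (\<lambda>P. chi (curve_rep j (proj_coord P)))"
    unfolding isomorphism_def V.points_eq W.points_eq
    using curve_to_line_morphism[OF j V W] line_to_curve_morphism[OF j V W] by blast+
qed

lemma image_curve: "j ^ 2 = -1 \<Longrightarrow> (\<lambda>ch. affine_point (curve_coord ch)) ` curve j = affine_part"
  unfolding curve_def affine_part_def image_image by (intro image_cong) (auto simp: curve_coord_chi)

lemma image_affine_part: "(\<lambda>P. chi (curve_rep j (proj_coord P))) ` affine_part = curve j"
  unfolding curve_def affine_part_def image_image by (simp add: proj_coord_affine_point)

lemma birational_curve:
  assumes j: "j ^ 2 = -1"
  shows "birational (sub_fspace (char_variety piN) (curve j)) (proj_space :: (complex^2) set fspace)"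
proof -
  interpret F: fraction_fspace "\<lambda>_. trace_algebra piN" "sub_fspace (char_variety piN) (curve j)" "curve j"
    by (rule sub_curve_fspace[OF j])
  have "fraction_fspace (\<lambda>_. trace_algebra piN) (sub_fspace (sub_fspace (char_variety piN) (curve j)) (curve j)) (curve j)"
    using F.sub_fraction_fspace[of "curve j"] by simp
  moreover have "fraction_fspace hom_functions (sub_fspace proj_space affine_part) affine_part"
    using PS.sub_fraction_fspace[of affine_part] affine_part_subset by (simp add: Int_absorb1)
  ultimately have "isomorphism (sub_fspace (sub_fspace (char_variety piN) (curve j)) (curve j))
      (sub_fspace proj_space affine_part) (\<lambda>ch. affine_point (curve_coord ch))"
    by (rule curve_line_isomorphisms(1)[OF j])
  moreover have "openin (zar (sub_fspace (char_variety piN) (curve j))) (curve j)"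
    using openin_topspace[of "zar (sub_fspace (char_variety piN) (curve j))"] F.points_eq by simp
  moreover have "curve j \<noteq> {}" using infinite_curve[OF j] by auto
  ultimately show ?thesis
    unfolding birational_def birational_map_def using openin_affine_part image_curve[OF j]
    by (intro exI[of _ "curve j"] exI[of _ "\<lambda>ch. affine_point (curve_coord ch)"]) simp
qed

lemma smooth_projective_curve_line: "smooth_projective_curve (proj_points :: (complex^2) set set)"
proof -
  let ?P = "proj_points :: (complex^2) set set"
  have closed: "closedin (zar proj_space) ?P"
    using closedin_topspace[of "zar (proj_space :: (complex^2) set fspace)"] unfolding PS.points_eq .
  have inf: "infinite ?P"
  proof
    assume "finite ?P"
    then have "finite (range affine_point)" by (rule finite_subset[rotated]) (auto simp: affine_point_in)
    moreover have "inj affine_point" by (metis injI proj_coord_affine_point)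
    ultimately have "finite (UNIV :: complex set)" by (rule finite_imageD)
    then show False using infinite_UNIV_char_0 by blast
  qed
  have "irreducible_curve proj_space ?P"
  proof (rule irreducible_curveI[OF closed inf])
    fix A assume A: "closedin (zar (proj_space :: (complex^2) set fspace)) A"
    show "?P \<subseteq> A \<or> finite (A \<inter> ?P)"
    proof (cases "?P \<subseteq> A")
      case False
      then obtain x where x: "x \<in> ?P - A" by blast
      have "openin (zar proj_space) (?P - A)" using A PS.points_eq by (metis closedin_def)
      then obtain d q where q: "q \<in> hom_functions d" "q x \<noteq> 0" "{y \<in> ?P. q y \<noteq> 0} \<subseteq> ?P - A"
        using PS.openin_basic_nbhd[OF _ x] by blast
      have "finite {y \<in> ?P. q y = 0}" using finite_zeros_projective_line[OF q(1) _ q(2)] x by blast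
      moreover have "A \<inter> ?P \<subseteq> {y \<in> ?P. q y = 0}" using q(3) by blast
      ultimately show ?thesis using finite_subset by blast
    qed simp
  next
    fix x assume x: "x \<in> ?P"
    define q where "q = (\<lambda>y::(complex^2) set. proj_rep x $ 2 * proj_rep y $ 1 + (- proj_rep x $ 1) * proj_rep y $ 2)"
    have "q \<in> hom_functions 1"
      unfolding q_def by (intro PS.add PS.scale coord_hom_functions)
    then have "openin (zar proj_space) {y \<in> ?P. q y \<noteq> 0}" by (rule PS.openin_basic)
    moreover have "{y \<in> ?P. q y \<noteq> 0} = ?P - {x}"
    proof -
      have "y = x" if "y \<in> ?P" "q y = 0" for y
      proof -
        have "proj_rep y $ i * proj_rep x $ k = proj_rep y $ k * proj_rep x $ i" for i k
          using two_cases[OF two_neq_one, of i] two_cases[OF two_neq_one, of k] that(2)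
          by (auto simp: q_def algebra_simps)
        then have "proj_line (proj_rep y) = proj_line (proj_rep x)"
          using that(1) x by (intro proj_line_eq_if_proportional proj_rep_nonzero)
        then show ?thesis using that(1) x proj_line_rep by metis
      qed
      moreover have "q x = 0" by (simp add: q_def)
      ultimately show ?thesis by blast
    qed
    ultimately show "closedin (zar proj_space) {x}"
      unfolding closedin_def PS.points_eq using x by simp
  qed
  then show ?thesis
    unfolding smooth_projective_curve_def using smooth_projective_line by blast
qed

text \<open>A concrete model, which turns the assertion about all models into the existence of ideal
  points.\<close>

lemma smooth_model_line:
  assumes j: "j ^ 2 = -1"
  shows "smooth_model (char_variety piN) (curve j) (proj_points :: (complex^2) set set) affine_part
    (\<lambda>P. chi (curve_rep j (proj_coord P)))"
proof -
  interpret F: fraction_fspace "\<lambda>_. trace_algebra piN" "sub_fspace (char_variety piN) (curve j)" "curve j"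
    by (rule sub_curve_fspace[OF j])
  let ?W = "sub_fspace proj_space (proj_points :: (complex^2) set set)"
  interpret W: fraction_fspace hom_functions ?W proj_points
    using PS.sub_fraction_fspace[of proj_points] by simp
  have "fraction_fspace (\<lambda>_. trace_algebra piN) (sub_fspace (sub_fspace (char_variety piN) (curve j)) (curve j)) (curve j)"
    using F.sub_fraction_fspace[of "curve j"] by simp
  moreover have "fraction_fspace hom_functions (sub_fspace ?W affine_part) affine_part"
    using W.sub_fraction_fspace[of affine_part] affine_part_subset by (simp add: Int_absorb1)
  ultimately have "isomorphism (sub_fspace ?W affine_part)
      (sub_fspace (sub_fspace (char_variety piN) (curve j)) (curve j)) (\<lambda>P. chi (curve_rep j (proj_coord P)))"
    by (rule curve_line_isomorphisms(2)[OF j])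
  moreover have "openin (zar (sub_fspace (char_variety piN) (curve j))) (curve j)"
    using openin_topspace[of "zar (sub_fspace (char_variety piN) (curve j))"] F.points_eq by simp
  moreover have "openin (zar ?W) affine_part"
    using openin_affine_part affine_part_subset by (auto simp: openin_subtopology)
  moreover have "affine_part \<noteq> {}" using image_affine_part[of j] infinite_curve[OF j] by auto
  ultimately show ?thesis
    unfolding smooth_model_def birational_map_def image_affine_part
    using smooth_projective_curve_line by blast
qed


section \<open>Parametrizing a smooth model\<close>

lemma (in fraction_fspace) reg_sub_iff:
  assumes "openin (zar V) U" "openin (zar V) A" "A \<subseteq> U"
  shows "openin (zar (sub_fspace V U)) A" "g \<in> reg (sub_fspace V U) A \<longleftrightarrow> g \<in> reg V A"
proof -
  interpret F: fraction_fspace H "sub_fspace V U" "S \<inter> U" by (rule sub_fraction_fspace)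
  show A: "openin (zar (sub_fspace V U)) A"
    using assms by (auto simp: openin_subtopology)
  show "g \<in> reg (sub_fspace V U) A \<longleftrightarrow> g \<in> reg V A"
    using reg_iff[OF assms(2)] F.reg_iff[OF A] by simp
qed

text \<open>With \<open>1 / 0 = 0\<close> the map \<open>s \<mapsto> 1 / s\<close> is an involution
  of all complex numbers, so it preserves finite exceptional sets.\<close>

lemma eventually_cofinite_inverse:
  assumes "\<forall>\<^sub>F s::complex in cofinite. P s"
  shows "\<forall>\<^sub>F s in cofinite. P (1 / s)"
proof -
  have fin: "finite {s. \<not> P s}" using assms by (simp add: eventually_cofinite)
  have "{s. \<not> P (1 / s)} \<subseteq> (\<lambda>s. 1 / s) ` {s. \<not> P s}"
  proof
    fix s assume "s \<in> {s. \<not> P (1 / s)}"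
    then show "s \<in> (\<lambda>s. 1 / s) ` {s. \<not> P s}" by (intro image_eqI[of _ _ "1 / s"]) auto
  qed
  then show ?thesis using fin unfolding eventually_cofinite by (metis finite_surj)
qed

text \<open>Both reflected polynomials are padded to the common degree
  \<open>degree P + degree Q\<close>, so the factor \<open>c\<close> is the same for both and the
  quotient is preserved.\<close>

lemma rational_inverse:
  fixes P Q :: "complex poly"
  shows "\<exists>P' Q'. \<forall>s. s \<noteq> 0 \<longrightarrow> (\<exists>c. c \<noteq> 0 \<and> poly P' s = c * poly P (1 / s) \<and> poly Q' s = c * poly Q (1 / s))"
proof (intro exI allI impI)
  fix s :: complex assume s: "s \<noteq> 0"
  show "s ^ (degree P + degree Q) \<noteq> 0 \<and>
      poly (reflect_poly P * monom 1 (degree Q)) s = s ^ (degree P + degree Q) * poly P (1 / s) \<and>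
      poly (reflect_poly Q * monom 1 (degree P)) s = s ^ (degree P + degree Q) * poly Q (1 / s)"
    using s by (simp add: poly_reflect_poly_nz poly_monom power_add divide_inverse)
qed

text \<open>Here \<open>\<gamma>\<close> is the parametrization of the curve of characters followed
  by the inverse of \<open>f\<close>. The second parametrization uses \<open>1 / s\<close>, so that
  points over infinity become points of value 0.\<close>

lemma smooth_model_parametrized:
  assumes j: "j ^ 2 = -1" and sm: "smooth_model (char_variety piN) (curve j) Y U f"
  shows "\<exists>\<gamma>. parametrized_curve Y U (curve_coord \<circ> f) \<gamma> \<and> parametrized_curve Y U (\<lambda>y. 1 / curve_coord (f y)) (\<lambda>s. \<gamma> (1 / s))"
    "y \<in> U \<Longrightarrow> f y \<in> curve j"
proof -
  let ?V = "sub_fspace proj_space Y" and ?C = "sub_fspace (char_variety piN) (curve j)"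
  have curve: "smooth_projective_curve Y" and U: "openin (zar ?V) U" "U \<noteq> {}" and fU: "openin (zar ?C) (f ` U)"
    and iso: "isomorphism (sub_fspace ?V U) (sub_fspace ?C (f ` U)) f"
    using sm by (auto simp: smooth_model_def birational_map_def)
  have Y: "irreducible_in (zar proj_space) Y" "Y \<subseteq> proj_points"
    using curve PS.points_eq by (auto simp: smooth_projective_curve_def irreducible_curve_def irreducible_in_def)
  interpret C: fraction_fspace "\<lambda>_. trace_algebra piN" ?C "curve j"
    by (rule sub_curve_fspace[OF j])
  interpret V: fraction_fspace hom_functions ?V Y
    using PS.sub_fraction_fspace[of Y] Y(2) by (simp add: Int_absorb1)
  have fUC: "f ` U \<subseteq> curve j" and UY: "U \<subseteq> Y" using C.openin_subset_S[OF fU] V.openin_subset_S[OF U(1)] by auto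
  then show "y \<in> U \<Longrightarrow> f y \<in> curve j" by blast
  interpret CU: fraction_fspace "\<lambda>_. trace_algebra piN" "sub_fspace ?C (f ` U)" "f ` U"
    using C.sub_fraction_fspace[of "f ` U"] unfolding Int_absorb1[OF fUC] .
  interpret VU: fraction_fspace hom_functions "sub_fspace ?V U" U
    using V.sub_fraction_fspace[of U] unfolding Int_absorb1[OF UY] .
  have mf: "morphism (sub_fspace ?V U) (sub_fspace ?C (f ` U)) f"
    using iso unfolding isomorphism_def by (rule conjunct1)
  have "\<exists>g. morphism (sub_fspace ?C (f ` U)) (sub_fspace ?V U) g \<and> (\<forall>y\<in>U. g (f y) = y) \<and> (\<forall>ch\<in>f ` U. f (g ch) = ch)"
    using iso unfolding isomorphism_def VU.points_eq CU.points_eq by (rule conjunct2)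
  then obtain g where mg: "morphism (sub_fspace ?C (f ` U)) (sub_fspace ?V U) g"
    and gf: "\<And>y. y \<in> U \<Longrightarrow> g (f y) = y" and fg: "\<And>ch. ch \<in> f ` U \<Longrightarrow> f (g ch) = ch"
    by metis
  have "(\<lambda>ch. curve_coord ch / 1) \<in> reg (sub_fspace ?C (f ` U)) (f ` U)"
    using C.reg_sub_iff(1)[OF fU fU] CU.reg_quotient[OF curve_coord_in trace_algebra_closure(1)[of 1]] by simp
  then have coord: "curve_coord \<in> reg (sub_fspace ?C (f ` U)) (f ` U)" by simp
  have "curve_coord \<circ> f \<in> reg (sub_fspace ?V U) {y \<in> U. f y \<in> f ` U}"
    using mf coord C.reg_sub_iff(1)[OF fU fU] unfolding morphism_def VU.points_eq by blast
  moreover have "{y \<in> U. f y \<in> f ` U} = U" by blast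
  ultimately have \<sigma>: "curve_coord \<circ> f \<in> reg ?V U" using V.reg_sub_iff(2)[OF U(1) U(1)] by simp
  define \<gamma> where "\<gamma> = (\<lambda>s. g (chi (curve_rep j s)))"
  have ev: "\<forall>\<^sub>F s in cofinite. s \<notin> excluded \<and> chi (curve_rep j s) \<in> f ` U"
    using U(2) by (intro curve_open_cofinite[OF j fU]) auto
  have \<sigma>\<gamma>: "\<forall>\<^sub>F s in cofinite. (curve_coord \<circ> f) (\<gamma> s) = s"
    using ev by eventually_elim (simp add: \<gamma>_def fg curve_coord_chi[OF j])
  have pull: "\<exists>P Q. \<forall>\<^sub>F s in cofinite. \<gamma> s \<in> W \<and> poly Q s \<noteq> 0 \<and> k (\<gamma> s) = poly P s / poly Q s"
    if W: "openin (zar ?V) W" "W \<noteq> {}" and k: "k \<in> reg ?V W" for W k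
  proof -
    \<comment> \<open>The birational map is invertible only on \<open>U\<close>. So \<open>k\<close>
      is restricted there, moved by the inverse \<open>g\<close> to an open set \<open>B\<close> of
      the curve, and written near one point as a quotient of trace functions.\<close>
    let ?WU = "W \<inter> U"
    have WU: "openin (zar ?V) ?WU" "?WU \<noteq> {}"
      using irreducible_in_open_Int[OF Y(1)] W U by auto
    have WU': "openin (zar (sub_fspace ?V U)) ?WU" "k \<in> reg (sub_fspace ?V U) ?WU"
      using V.reg_sub_iff[OF U(1) WU(1)] V.reg_restrict[OF k W(1) WU(1)] by auto
    define B where "B = {ch \<in> f ` U. g ch \<in> ?WU}"
    have B: "openin (zar (sub_fspace ?C (f ` U))) B"
      using mg WU'(1) unfolding morphism_def continuous_map_def CU.points_eq B_def by blast
    have kg: "k \<circ> g \<in> reg (sub_fspace ?C (f ` U)) B"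
      using mg[unfolded morphism_def, THEN conjunct2] WU' unfolding CU.points_eq B_def by blast
    obtain y where y: "y \<in> ?WU" using WU by blast
    then have "f y \<in> B" using gf by (auto simp: B_def)
    with kg B obtain d p q where pq: "p \<in> trace_algebra piN" "q \<in> trace_algebra piN" "q (f y) \<noteq> 0"
      "\<And>ch. ch \<in> B \<Longrightarrow> q ch \<noteq> 0 \<Longrightarrow> (k \<circ> g) ch = p ch / q ch" by (rule CU.regE) blast
    obtain P Q where PQ: "\<And>s. s \<notin> excluded \<Longrightarrow> (q (chi (curve_rep j s)) \<noteq> 0 \<longleftrightarrow> poly Q s \<noteq> 0) \<and>
        p (chi (curve_rep j s)) / q (chi (curve_rep j s)) = poly P s / poly Q s"
      using trace_algebra_quotient[OF j pq(1,2)] by blast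
    have "openin (zar ?C) B"
      using B fU by (auto simp: openin_subtopology)
    then have "openin (zar ?C) (B \<inter> {ch \<in> curve j. q ch \<noteq> 0})"
      using C.openin_basic[OF pq(2)] by blast
    moreover have "f y \<in> B \<inter> {ch \<in> curve j. q ch \<noteq> 0}" using \<open>f y \<in> B\<close> pq(3) fUC y by blast
    ultimately have "\<forall>\<^sub>F s in cofinite. s \<notin> excluded \<and> chi (curve_rep j s) \<in> B \<inter> {ch \<in> curve j. q ch \<noteq> 0}"
      by (intro curve_open_cofinite[OF j]) auto
    then have "\<forall>\<^sub>F s in cofinite. \<gamma> s \<in> W \<and> poly Q s \<noteq> 0 \<and> k (\<gamma> s) = poly P s / poly Q s"
    proof eventually_elim
      case (elim s)
      then have s: "s \<notin> excluded" "chi (curve_rep j s) \<in> B" "q (chi (curve_rep j s)) \<noteq> 0" by auto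
      then show ?case using pq(4)[OF s(2,3)] PQ[OF s(1)] by (auto simp: \<gamma>_def B_def)
    qed
    then show ?thesis by blast
  qed
  have "parametrized_curve Y U (curve_coord \<circ> f) \<gamma>"
    using curve U \<sigma> \<sigma>\<gamma> pull by unfold_locales
  moreover have "parametrized_curve Y U (\<lambda>y. 1 / curve_coord (f y)) (\<lambda>s. \<gamma> (1 / s))"
  proof unfold_locales
    have "curve_coord (f y) \<noteq> 0" if "y \<in> U" for y
      using that fUC curveE(1)[OF _ j, of "f y"] by (auto simp: excluded_def)
    then have "(\<lambda>y. inverse ((curve_coord \<circ> f) y)) \<in> reg ?V U"
      by (intro V.reg_inverse[OF \<sigma> U(1)]) simp
    then show "(\<lambda>y. 1 / curve_coord (f y)) \<in> reg ?V U" by (simp add: divide_inverse)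
    show "\<forall>\<^sub>F s in cofinite. 1 / curve_coord (f (\<gamma> (1 / s))) = s"
      using eventually_cofinite_inverse[OF \<sigma>\<gamma>] by eventually_elim auto
    fix W k assume "openin (zar ?V) W" "W \<noteq> {}" "k \<in> reg ?V W"
    then obtain P Q where "\<forall>\<^sub>F s in cofinite. \<gamma> s \<in> W \<and> poly Q s \<noteq> 0 \<and> k (\<gamma> s) = poly P s / poly Q s"
      using pull by blast
    note PQ = eventually_cofinite_inverse[OF this]
    obtain P' Q' where P'Q': "\<And>s. s \<noteq> 0 \<Longrightarrow> \<exists>c. c \<noteq> 0 \<and> poly P' s = c * poly P (1 / s) \<and> poly Q' s = c * poly Q (1 / s)"
      using rational_inverse by blast
    have "\<forall>\<^sub>F s::complex in cofinite. s \<noteq> 0" by (simp add: eventually_cofinite)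
    with PQ have "\<forall>\<^sub>F s in cofinite. \<gamma> (1 / s) \<in> W \<and> poly Q' s \<noteq> 0 \<and> k (\<gamma> (1 / s)) = poly P' s / poly Q' s"
    proof eventually_elim
      case (elim s)
      obtain c where "c \<noteq> 0" "poly P' s = c * poly P (1 / s)" "poly Q' s = c * poly Q (1 / s)"
        using P'Q'[of s] elim by blast
      then show ?case using elim by simp
    qed
    then show "\<exists>P Q. \<forall>\<^sub>F s in cofinite. \<gamma> (1 / s) \<in> W \<and> poly Q s \<noteq> 0 \<and> k (\<gamma> (1 / s)) = poly P s / poly Q s"
      by blast
  qed (use curve U in auto)
  ultimately show "\<exists>\<gamma>. parametrized_curve Y U (curve_coord \<circ> f) \<gamma> \<and> parametrized_curve Y U (\<lambda>y. 1 / curve_coord (f y)) (\<lambda>s. \<gamma> (1 / s))"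
    by blast
qed

section \<open>The peripheral subgroup\<close>

context group
begin

lemma inv_commute:
  assumes "x \<in> carrier G" "y \<in> carrier G" "x \<otimes> y = y \<otimes> x"
  shows "inv x \<otimes> y = y \<otimes> inv x"
proof -
  have "inv x \<otimes> y = inv x \<otimes> ((y \<otimes> x) \<otimes> inv x)" using assms(1,2) by (simp add: m_assoc)
  also have "\<dots> = inv x \<otimes> (x \<otimes> (y \<otimes> inv x))" using assms by (simp add: m_assoc flip: assms(3))
  also have "\<dots> = y \<otimes> inv x" using assms(1,2) by (simp add: m_assoc[symmetric])
  finally show ?thesis .
qed

text \<open>The elements commuting with \<open>y\<close> form a subgroup.\<close>

lemma int_pow_commute:
  fixes i :: int
  assumes "x \<in> carrier G" "y \<in> carrier G" "x \<otimes> y = y \<otimes> x"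
  shows "x [^] i \<otimes> y = y \<otimes> x [^] i"
proof -
  have "subgroup {z \<in> carrier G. z \<otimes> y = y \<otimes> z} G"
  proof (rule subgroupI)
    show "{z \<in> carrier G. z \<otimes> y = y \<otimes> z} \<noteq> {}" using assms by blast
    fix a assume a: "a \<in> {z \<in> carrier G. z \<otimes> y = y \<otimes> z}"
    then show "inv a \<in> {z \<in> carrier G. z \<otimes> y = y \<otimes> z}" using inv_commute assms(2) by simp
    fix b assume b: "b \<in> {z \<in> carrier G. z \<otimes> y = y \<otimes> z}"
    have "a \<otimes> b \<otimes> y = a \<otimes> (y \<otimes> b)" using a b assms(2) by (simp add: m_assoc)
    also have "\<dots> = y \<otimes> (a \<otimes> b)" using a b assms(2) by (simp flip: m_assoc)
    finally show "a \<otimes> b \<in> {z \<in> carrier G. z \<otimes> y = y \<otimes> z}" using a b by simp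
  qed auto
  from subgroup_int_pow_closed[OF this, of x i] show ?thesis using assms by simp
qed

lemma generate_commuting_pair:
  assumes x: "x \<in> carrier G" and y: "y \<in> carrier G" and xy: "x \<otimes> y = y \<otimes> x" and g: "g \<in> generate G {x, y}"
  shows "\<exists>(p::int) (q::int). g = x [^] p \<otimes> y [^] q"
  using g
proof induction
  case one
  show ?case using x y by (intro exI[of _ 0]) simp
next
  case (incl h)
  then show ?case
  proof (elim insertE emptyE)
    assume "h = x"
    then show ?thesis using x y by (intro exI[of _ 1] exI[of _ 0]) simp
  next
    assume "h = y"
    then show ?thesis using x y by (intro exI[of _ 0] exI[of _ 1]) simp
  qed
next
  case (inv h)
  then show ?case
  proof (elim insertE emptyE)
    assume "h = x"
    then show ?thesis using x y by (intro exI[of _ "-1"] exI[of _ 0]) (simp add: int_pow_neg)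
  next
    assume "h = y"
    then show ?thesis using x y by (intro exI[of _ 0] exI[of _ "-1"]) (simp add: int_pow_neg)
  qed
next
  case (eng g h)
  then obtain p q p' q' :: int where gh: "g = x [^] p \<otimes> y [^] q" "h = x [^] p' \<otimes> y [^] q'" by blast
  have "y [^] q \<otimes> x [^] p' = x [^] p' \<otimes> y [^] q"
    using x y xy by (intro int_pow_commute int_pow_commute[symmetric]) auto
  then have "g \<otimes> h = x [^] p \<otimes> (x [^] p' \<otimes> (y [^] q \<otimes> y [^] q'))"
    unfolding gh using x y by (simp add: m_assoc) (simp flip: m_assoc)
  also have "\<dots> = x [^] (p + p') \<otimes> y [^] (q + q')"
    using x y by (simp add: int_pow_mult m_assoc)
  finally show ?case by blast
qed

text \<open>The monodromy fixes the boundary word. Conjugation by \<open>t\<close> sends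
  \<open>l\<close> to the commutator of \<open>u\<close> and \<open>v = b a u^3\<close>; since
  \<open>u b a = b^(-1)\<close>, this is \<open>b^(-1) u^3 u^(-1) u^(-3) a^(-1) b^(-1)\<close>, and
  \<open>u^(-1) = b a b\<close> returns \<open>l\<close>.\<close>

lemma commutator_fixed:
  assumes c: "a \<in> carrier G" "b \<in> carrier G" "t \<in> carrier G"
  defines "u \<equiv> inv b \<otimes> (inv a \<otimes> inv b)" and "l \<equiv> a \<otimes> (b \<otimes> (inv a \<otimes> inv b))"
  assumes ta: "t \<otimes> (a \<otimes> inv t) = u" and tb: "t \<otimes> (b \<otimes> inv t) = b \<otimes> (a \<otimes> (u \<otimes> (u \<otimes> u)))"
  shows "l \<otimes> t = t \<otimes> l"
proof -
  have cancel: "x \<otimes> (inv x \<otimes> y) = y" "inv x \<otimes> (x \<otimes> y) = y" if "x \<in> carrier G" "y \<in> carrier G" for x y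
    using that by (simp_all flip: m_assoc)
  have u: "u \<in> carrier G" unfolding u_def using c by simp
  define v where "v = b \<otimes> (a \<otimes> (u \<otimes> (u \<otimes> u)))"
  have v: "v \<in> carrier G" unfolding v_def using c u by simp
  have conj_inv: "t \<otimes> (inv x \<otimes> inv t) = inv (t \<otimes> (x \<otimes> inv t))" if "x \<in> carrier G" for x
    using that c by (simp add: inv_mult_group m_assoc)
  have "t \<otimes> (l \<otimes> inv t) = (t \<otimes> (a \<otimes> inv t)) \<otimes> ((t \<otimes> (b \<otimes> inv t)) \<otimes>
      ((t \<otimes> (inv a \<otimes> inv t)) \<otimes> (t \<otimes> (inv b \<otimes> inv t))))"
    unfolding l_def using c by (simp add: m_assoc cancel)
  also have "\<dots> = u \<otimes> (v \<otimes> (inv u \<otimes> inv v))"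
    unfolding conj_inv[OF c(1)] conj_inv[OF c(2)] ta tb[folded v_def] ..
  also have "\<dots> = l"
  proof -
    have "u \<otimes> (b \<otimes> a) = inv b"
      unfolding u_def using c by (simp add: m_assoc cancel)
    then have "u \<otimes> v = inv b \<otimes> (u \<otimes> (u \<otimes> u))"
      unfolding v_def using c u by (simp flip: m_assoc)
    moreover have "inv v = inv u \<otimes> (inv u \<otimes> (inv u \<otimes> (inv a \<otimes> inv b)))"
      unfolding v_def using c u by (simp add: inv_mult_group m_assoc)
    ultimately have "u \<otimes> (v \<otimes> (inv u \<otimes> inv v)) = inv b \<otimes> (inv u \<otimes> (inv a \<otimes> inv b))"
      using c u v by (simp flip: m_assoc) (simp add: m_assoc cancel)
    moreover have "inv u = b \<otimes> (a \<otimes> b)"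
      unfolding u_def using c by (simp add: inv_mult_group m_assoc)
    then have "inv b \<otimes> (inv u \<otimes> (inv a \<otimes> inv b)) = l"
      unfolding l_def using c by (simp add: m_assoc cancel)
    ultimately show ?thesis by simp
  qed
  finally have "t \<otimes> (l \<otimes> inv t) \<otimes> t = l \<otimes> t" by simp
  then show ?thesis using c by (simp add: l_def m_assoc)
qed

end

interpretation piN: group piN
  by (rule group_piN)

lemma wc_append: "wc u \<otimes>\<^bsub>piN\<^esub> wc v = wc (u @ v)"
  unfolding piN_def by (rule presented_group_mult)

lemma wc_in_carrier [simp]: "wc w \<in> carrier piN"
  by (simp add: carrier_piN)

lemma wc_inv: "inv\<^bsub>piN\<^esub> wc w = wc (inv_word w)"
proof (rule piN.inv_equality)
  show "wc (inv_word w) \<otimes>\<^bsub>piN\<^esub> wc w = \<one>\<^bsub>piN\<^esub>"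
    unfolding wc_append using inv_word_left[of bundle_relations w]
    by (simp add: piN_def presented_group_def word_class_eq_iff)
qed simp_all

definition wl :: "gen word" where
  "wl = wa @ wb @ inv_word wa @ inv_word wb"

lemma lN_eq: "lN = wc wl" and tN_eq: "tN = wc wt"
  by (simp_all add: lN_def tN_def wl_def)

lemma lN_tN_commute: "lN \<otimes>\<^bsub>piN\<^esub> tN = tN \<otimes>\<^bsub>piN\<^esub> lN"
proof -
  let ?u = "inv_word wb @ inv_word wa @ inv_word wb"
  have "(wt @ wa @ inv_word wt, ?u) \<in> bundle_relations"
    "(wt @ wb @ inv_word wt, wb @ wa @ ?u @ ?u @ ?u) \<in> bundle_relations"
    by (simp_all add: bundle_relations_def Let_def)
  then have "wc (wt @ wa @ inv_word wt) = wc ?u" "wc (wt @ wb @ inv_word wt) = wc (wb @ wa @ ?u @ ?u @ ?u)"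
    unfolding word_class_eq_iff by (auto intro: word_eq.relation)
  then show ?thesis
    using piN.commutator_fixed[of "wc wa" "wc wb" "wc wt"]
    by (simp add: lN_eq tN_eq wl_def wc_append wc_inv)
qed

lemma lN_in_carrier [simp]: "lN \<in> carrier piN" and tN_in_carrier [simp]: "tN \<in> carrier piN"
  by (simp_all add: lN_eq tN_eq)

lemma lN_tN_peripheral: "lN \<in> peripheralN" "tN \<in> peripheralN" "lN \<otimes>\<^bsub>piN\<^esub> tN \<in> peripheralN"
  unfolding peripheralN_def by (auto intro: generate.intros)

lemma peripheral_in_carrier: "\<alpha> \<in> peripheralN \<Longrightarrow> \<alpha> \<in> carrier piN"
  unfolding peripheralN_def using piN.generate_in_carrier[of "{lN, tN}"] by simp

lemma peripheral_eq_t: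
  assumes "\<alpha> \<in> peripheralN"
  shows "\<exists>(p::int) (q::int). \<alpha> = lN [^]\<^bsub>piN\<^esub> p \<otimes>\<^bsub>piN\<^esub> tN [^]\<^bsub>piN\<^esub> q"
  using assms lN_tN_commute unfolding peripheralN_def by (intro piN.generate_commuting_pair) auto

text \<open>By \<open>l^p t^q = l^(p - q) (l t)^q\<close> the pair \<open>l\<close>,
  \<open>lt\<close> serves as well as \<open>l\<close>, \<open>t\<close>, so both slopes can be
  handled by the same argument.\<close>

lemma peripheral_eq_lt:
  assumes "\<alpha> \<in> peripheralN"
  shows "\<exists>(p::int) (q::int). \<alpha> = lN [^]\<^bsub>piN\<^esub> p \<otimes>\<^bsub>piN\<^esub> (lN \<otimes>\<^bsub>piN\<^esub> tN) [^]\<^bsub>piN\<^esub> q"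
proof -
  obtain p q :: int where "\<alpha> = lN [^]\<^bsub>piN\<^esub> p \<otimes>\<^bsub>piN\<^esub> tN [^]\<^bsub>piN\<^esub> q"
    using peripheral_eq_t[OF assms] by blast
  also have "\<dots> = lN [^]\<^bsub>piN\<^esub> ((p - q) + q) \<otimes>\<^bsub>piN\<^esub> tN [^]\<^bsub>piN\<^esub> q" by simp
  also have "\<dots> = lN [^]\<^bsub>piN\<^esub> (p - q) \<otimes>\<^bsub>piN\<^esub> (lN \<otimes>\<^bsub>piN\<^esub> tN) [^]\<^bsub>piN\<^esub> q"
    unfolding piN.int_pow_mult[OF lN_in_carrier] piN.int_pow_mult_distrib[OF lN_tN_commute lN_in_carrier tN_in_carrier]
    by (simp add: piN.m_assoc)
  finally show ?thesis by blast
qed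


section \<open>Eigenvalues\<close>

lemma matrix_vector_2: "(mat2 a b c d *v v) $ 1 = a * v $ 1 + b * v $ 2" "(mat2 a b c d *v v) $ 2 = c * v $ 1 + d * v $ 2"
  by (simp_all add: matrix_vector_mult_def sum_2)

lemma smult_matrix_vector: "M *v (c *s v) = c *s (M *v v)" for M :: "complex^2^2"
  by (simp add: vec_eq_iff matrix_vector_mult_def sum_distrib_left algebra_simps)

lemma eigenvalue_trace:
  fixes M :: "complex^2^2"
  assumes det: "det M = 1" and v: "v \<noteq> 0" and eig: "M *v v = \<nu> *s v"
  shows "\<nu> \<noteq> 0" "trace M = \<nu> + 1 / \<nu>"
proof -
  obtain a b c d where M: "M = mat2 a b c d" by (rule mat2_cases)
  have 1: "a * v $ 1 + b * v $ 2 = \<nu> * v $ 1" "c * v $ 1 + d * v $ 2 = \<nu> * v $ 2"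
    using arg_cong[OF eig, of "\<lambda>w. w $ 1"] arg_cong[OF eig, of "\<lambda>w. w $ 2"] by (simp_all add: M matrix_vector_2)
  have 2: "a * d - b * c = 1" using det by (simp add: M)
  have "(\<nu> * \<nu> - (a + d) * \<nu> + 1) * v $ 1 = 0" "(\<nu> * \<nu> - (a + d) * \<nu> + 1) * v $ 2 = 0"
    using 1 2 by algebra+
  moreover have "v $ 1 \<noteq> 0 \<or> v $ 2 \<noteq> 0" using v by (auto simp: vec_eq_iff forall_2)
  ultimately have 3: "\<nu> * \<nu> - (a + d) * \<nu> + 1 = 0" by auto
  then show "\<nu> \<noteq> 0" by auto
  then show "trace M = \<nu> + 1 / \<nu>" using 3 by (simp add: M field_simps)
qed

lemma exists_eigenvector:
  fixes M :: "complex^2^2"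
  assumes det: "det M = 1" and tr: "trace M \<noteq> 2" "trace M \<noteq> -2"
  shows "\<exists>v \<nu>. v \<noteq> 0 \<and> M *v v = \<nu> *s v"
proof -
  obtain a b c d where M: "M = mat2 a b c d" by (rule mat2_cases)
  have ad: "a * d - b * c = 1" using det by (simp add: M)
  define \<nu> where "\<nu> = (a + d + csqrt ((a + d) ^ 2 - 4)) / 2"
  have "2 * \<nu> - (a + d) = csqrt ((a + d) ^ 2 - 4)" by (simp add: \<nu>_def field_simps)
  then have "(2 * \<nu> - (a + d)) ^ 2 = (a + d) ^ 2 - 4" by simp
  then have "4 * (\<nu> * \<nu> - (a + d) * \<nu> + 1) = 0" by algebra
  then have \<nu>: "\<nu> * \<nu> - (a + d) * \<nu> + 1 = 0" by (simp only: mult_eq_0_iff) simp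
  have eigI: "M *v (\<chi> i. if i = 1 then x else y) = \<mu> *s (\<chi> i. if i = 1 then x else y)"
    if "a * x + b * y = \<mu> * x" "c * x + d * y = \<mu> * y" for x y \<mu>
    using that two_neq_one by (simp add: vec_eq_iff forall_2 M matrix_vector_2)
  have nz: "(\<chi> i. if i = (1::2) then x else y) \<noteq> 0" if "x \<noteq> 0 \<or> y \<noteq> 0" for x y :: complex
    using that two_neq_one by (auto simp: vec_eq_iff forall_2)
  consider "b \<noteq> 0" | "c \<noteq> 0" | "b = 0" "c = 0" by blast
  then show ?thesis
  proof cases
    case 1
    \<comment> \<open>The vector \<open>(b, \<nu> - a)\<close> solves the first row of the
      eigenvalue equation identically and the second by the characteristic equation.\<close>
    have "a * b + b * (\<nu> - a) = \<nu> * b" by (simp add: algebra_simps)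
    moreover have "c * b + d * (\<nu> - a) = \<nu> * (\<nu> - a)" using \<nu> ad by algebra
    ultimately show ?thesis using eigI nz 1 by blast
  next
    case 2
    have "a * (\<nu> - d) + b * c = \<nu> * (\<nu> - d)" using \<nu> ad by algebra
    moreover have "c * (\<nu> - d) + d * c = \<nu> * c" by (simp add: algebra_simps)
    ultimately show ?thesis using eigI nz 2 by blast
  next
    case 3
    then have "a * 1 + b * 0 = a * 1" "c * 1 + d * 0 = a * 0" by simp_all
    then show ?thesis using eigI nz by (metis zero_neq_one)
  qed
qed

text \<open>As \<open>\<nu>^2\<close> is not 1, the two eigenvalues of \<open>L\<close> differ and
  the eigenspace is a line, which the commuting matrix \<open>M\<close> preserves.\<close>

lemma common_eigenvector:
  fixes L M :: "complex^2^2"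
  assumes L: "det L = 1" "trace L \<noteq> 2" "trace L \<noteq> -2" and comm: "L ** M = M ** L"
  shows "\<exists>v \<nu> \<mu>. v \<noteq> 0 \<and> L *v v = \<nu> *s v \<and> M *v v = \<mu> *s v"
proof -
  obtain v \<nu> where v: "v \<noteq> 0" "L *v v = \<nu> *s v" using exists_eigenvector[OF L] by blast
  note \<nu> = eigenvalue_trace[OF L(1) v]
  define w where "w = M *v v"
  have "L *v w = M *v (L *v v)" unfolding w_def by (simp add: matrix_vector_mul_assoc comm)
  also have "\<dots> = \<nu> *s w" unfolding v(2) w_def by (rule smult_matrix_vector)
  finally have Lw: "L *v w = \<nu> *s w" .
  obtain a b c d where Lm: "L = mat2 a b c d" by (rule mat2_cases)
  have e: "a * v $ 1 + b * v $ 2 = \<nu> * v $ 1" "c * v $ 1 + d * v $ 2 = \<nu> * v $ 2"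
    "a * w $ 1 + b * w $ 2 = \<nu> * w $ 1" "c * w $ 1 + d * w $ 2 = \<nu> * w $ 2"
    using arg_cong[OF v(2), of "\<lambda>w. w $ 1"] arg_cong[OF v(2), of "\<lambda>w. w $ 2"]
      arg_cong[OF Lw, of "\<lambda>w. w $ 1"] arg_cong[OF Lw, of "\<lambda>w. w $ 2"] by (simp_all add: Lm matrix_vector_2)
  have "a * d - b * c = 1" using L(1) by (simp add: Lm)
  with e have "(\<nu> * \<nu> - 1) * (v $ 1 * w $ 2 - v $ 2 * w $ 1) = 0" by algebra
  moreover have "\<nu> * \<nu> - 1 \<noteq> 0"
  proof
    assume "\<nu> * \<nu> - 1 = 0"
    then have "\<nu> = 1 \<or> \<nu> = -1" by (simp add: square_eq_1_iff)
    then show False using \<nu>(2) L(2,3) by auto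
  qed
  ultimately have cross: "v $ 1 * w $ 2 = v $ 2 * w $ 1" by simp
  have "\<exists>\<mu>. w = \<mu> *s v"
  proof (cases "v $ 1 = 0")
    case True
    then have "v $ 2 \<noteq> 0" using v(1) by (auto simp: vec_eq_iff forall_2)
    then show ?thesis using cross True
      by (intro exI[of _ "w $ 2 / v $ 2"]) (auto simp: vec_eq_iff forall_2)
  next
    case False
    then show ?thesis using cross
      by (intro exI[of _ "w $ 1 / v $ 1"]) (auto simp: vec_eq_iff forall_2 field_simps)
  qed
  then obtain \<mu> where "M *v v = \<mu> *s v" unfolding w_def ..
  with v show ?thesis by (intro exI conjI)
qed

lemma hom_piN_mult:
  assumes "\<rho> \<in> hom piN SL2C" "x \<in> carrier piN" "y \<in> carrier piN"
  shows "\<rho> (x \<otimes>\<^bsub>piN\<^esub> y) = \<rho> x ** \<rho> y"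
  using hom_mult[OF assms] by (simp add: SL2C_def)

lemma hom_piN_inv:
  assumes \<rho>: "\<rho> \<in> hom piN SL2C" and x: "x \<in> carrier piN"
  shows "\<rho> (inv\<^bsub>piN\<^esub> x) = adj2 (\<rho> x)"
proof -
  obtain w where "x = wc w" using x by (auto simp: carrier_piN)
  then show ?thesis using hom_wc[OF \<rho>] by (simp add: wc_inv eval_word_inv_word)
qed

lemma hom_piN_det: "\<rho> \<in> hom piN SL2C \<Longrightarrow> x \<in> carrier piN \<Longrightarrow> det (\<rho> x) = 1"
  using hom_in_carrier[of \<rho> piN SL2C x] by (simp add: SL2C_def)

lemma eigenvector_int_pow:
  assumes \<rho>: "\<rho> \<in> hom piN SL2C" and x: "x \<in> carrier piN" and v: "v \<noteq> 0" "\<rho> x *v v = \<nu> *s v"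
  shows "\<rho> (x [^]\<^bsub>piN\<^esub> (i::int)) *v v = (\<nu> powi i) *s v"
proof -
  have nat: "\<rho> (x [^]\<^bsub>piN\<^esub> (n::nat)) *v v = \<nu> ^ n *s v" for n
  proof (induction n)
    case 0
    have "\<rho> \<one>\<^bsub>piN\<^esub> = mat 1"
      using hom_wc[OF \<rho>, of "[]"] by (simp add: piN_def presented_group_def)
    then show ?case by simp
  next
    case (Suc n)
    have "\<rho> (x [^]\<^bsub>piN\<^esub> Suc n) *v v = \<rho> (x [^]\<^bsub>piN\<^esub> n) *v (\<rho> x *v v)"
      using hom_piN_mult[OF \<rho>, of "x [^]\<^bsub>piN\<^esub> n" x] x by (simp add: matrix_vector_mul_assoc)
    then show ?case by (simp add: v smult_matrix_vector Suc.IH vector_smult_assoc mult.commute)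
  qed
  have \<nu>: "\<nu> \<noteq> 0" using eigenvalue_trace(1)[OF hom_piN_det[OF \<rho> x] v] .
  show ?thesis
  proof (cases "0 \<le> i")
    case True
    then show ?thesis using nat[of "nat i"] int_pow_int[of piN x "nat i"] by (simp add: power_int_def)
  next
    case False
    define n where "n = nat (- i)"
    have i: "i = - int n" using False by (simp add: n_def)
    let ?y = "x [^]\<^bsub>piN\<^esub> n"
    have y: "?y \<in> carrier piN" using x by simp
    have "v = (adj2 (\<rho> ?y) ** \<rho> ?y) *v v" using adj2_inverse(2)[OF hom_piN_det[OF \<rho> y]] by simp
    also have "\<dots> = \<nu> ^ n *s (adj2 (\<rho> ?y) *v v)"
      by (simp add: nat smult_matrix_vector flip: matrix_vector_mul_assoc)
    finally have "(1 / \<nu> ^ n) *s v = (1 / \<nu> ^ n) *s (\<nu> ^ n *s (adj2 (\<rho> ?y) *v v))" by metis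
    then have "adj2 (\<rho> ?y) *v v = (1 / \<nu> ^ n) *s v" using \<nu> by (simp add: vector_smult_assoc)
    then show ?thesis
      using piN.int_pow_neg_int[OF x, of n] hom_piN_inv[OF \<rho> y]
      by (simp add: i power_int_minus divide_inverse)
  qed
qed

section \<open>Bounds for eigenvalues and traces\<close>

lemma norm_le_if_trace_le:
  fixes \<mu> :: complex
  assumes "\<mu> \<noteq> 0" "norm (\<mu> + 1 / \<mu>) \<le> K"
  shows "norm \<mu> \<le> K + 1"
proof (cases "norm \<mu> \<le> 1")
  case True
  moreover have "0 \<le> K" using assms(2) norm_ge_zero order_trans by blast
  ultimately show ?thesis by linarith
next
  case False
  then have "norm (1 / \<mu>) \<le> 1" by (auto simp: norm_divide divide_le_eq)
  moreover have "norm \<mu> \<le> norm (\<mu> + 1 / \<mu>) + norm (1 / \<mu>)"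
    using norm_triangle_ineq4[of "\<mu> + 1 / \<mu>" "1 / \<mu>"] by simp
  ultimately show ?thesis using assms(2) by linarith
qed

lemma norm_powi_le:
  fixes \<mu> :: complex
  assumes "\<mu> \<noteq> 0" "norm \<mu> \<le> M" "norm (1 / \<mu>) \<le> M"
  shows "norm (\<mu> powi i) \<le> M ^ nat \<bar>i\<bar>"
proof (cases "0 \<le> i")
  case True
  then show ?thesis using power_mono[OF assms(2), of "nat i"] by (simp add: power_int_def norm_power)
next
  case False
  then show ?thesis using power_mono[OF assms(3), of "nat (- i)"]
    by (simp add: power_int_def norm_power divide_inverse)
qed

lemma norm_le_if_powi_le:
  fixes \<mu> :: complex
  assumes "norm (\<mu> powi i) \<le> M" "norm (\<mu> powi (- i)) \<le> M" "i \<noteq> 0" "1 \<le> M"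
  shows "norm \<mu> \<le> M"
proof (cases "norm \<mu> \<le> 1")
  case False
  have "norm (\<mu> ^ nat \<bar>i\<bar>) \<le> M"
    using assms(1,2) by (cases "0 \<le> i") (simp_all add: power_int_def)
  moreover have "norm \<mu> ^ 1 \<le> norm \<mu> ^ nat \<bar>i\<bar>" using False assms(3) by (intro power_increasing) auto
  ultimately show ?thesis by (simp add: norm_power)
qed (use assms in linarith)

text \<open>On a common eigenvector \<open>x\<close> and \<open>y\<close> have eigenvalues
  \<open>\<nu>\<close> and \<open>\<mu>\<close>, and the product of powers has
  \<open>\<zeta> = \<nu>^p \<mu>^q\<close>. Bounded traces bound \<open>\<mu>\<close>,
  \<open>\<zeta>\<close> and their inverses, hence the powers of \<open>\<nu>\<close> with exponents
  \<open>p\<close> and \<open>-p\<close>, hence \<open>\<nu>\<close> and its inverse. The bound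
  depends only on \<open>K\<close> and \<open>q\<close>, not on \<open>\<rho>\<close>, so it can be
  used along the whole curve.\<close>

lemma trace_bound:
  assumes \<rho>: "\<rho> \<in> hom piN SL2C" and xy: "x \<in> carrier piN" "y \<in> carrier piN" "x \<otimes>\<^bsub>piN\<^esub> y = y \<otimes>\<^bsub>piN\<^esub> x"
    and p: "p \<noteq> 0" and K: "norm (trace (\<rho> y)) \<le> K"
      "norm (trace (\<rho> (x [^]\<^bsub>piN\<^esub> (p::int) \<otimes>\<^bsub>piN\<^esub> y [^]\<^bsub>piN\<^esub> (q::int)))) \<le> K"
  shows "norm (trace (\<rho> x)) \<le> 2 * (K + 1) ^ Suc (nat \<bar>q\<bar>)"
proof -
  have K0: "0 \<le> K" using K(1) norm_ge_zero order_trans by blast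
  then have M1: "1 \<le> (K + 1) ^ Suc (nat \<bar>q\<bar>)" by (intro one_le_power) simp
  show ?thesis
  proof (cases "trace (\<rho> x) = 2 \<or> trace (\<rho> x) = -2")
    case True
    then have "norm (trace (\<rho> x)) = 2" by auto
    then show ?thesis using M1 by linarith
  next
    case False
    have "\<rho> x ** \<rho> y = \<rho> y ** \<rho> x" using hom_piN_mult[OF \<rho>] xy by metis
    then obtain v \<nu> \<mu> where v: "v \<noteq> 0" "\<rho> x *v v = \<nu> *s v" "\<rho> y *v v = \<mu> *s v"
      using common_eigenvector[OF hom_piN_det[OF \<rho> xy(1)]] False by blast
    note \<nu> = eigenvalue_trace[OF hom_piN_det[OF \<rho> xy(1)] v(1,2)]
      and \<mu> = eigenvalue_trace[OF hom_piN_det[OF \<rho> xy(2)] v(1,3)]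
    define z where "z = x [^]\<^bsub>piN\<^esub> p \<otimes>\<^bsub>piN\<^esub> y [^]\<^bsub>piN\<^esub> q"
    define \<zeta> where "\<zeta> = \<nu> powi p * \<mu> powi q"
    have z: "z \<in> carrier piN" unfolding z_def using xy by simp
    have "\<rho> z *v v = \<rho> (x [^]\<^bsub>piN\<^esub> p) *v (\<rho> (y [^]\<^bsub>piN\<^esub> q) *v v)"
      unfolding z_def using hom_piN_mult[OF \<rho>] xy by (simp add: matrix_vector_mul_assoc)
    also have "\<dots> = \<zeta> *s v"
      using eigenvector_int_pow[OF \<rho> xy(1) v(1,2)] eigenvector_int_pow[OF \<rho> xy(2) v(1,3)]
      by (simp add: smult_matrix_vector vector_smult_assoc \<zeta>_def mult.commute)
    finally have eig: "\<rho> z *v v = \<zeta> *s v" .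
    note \<zeta> = eigenvalue_trace[OF hom_piN_det[OF \<rho> z] v(1) eig]
    have \<mu>K: "norm \<mu> \<le> K + 1" "norm (1 / \<mu>) \<le> K + 1"
      using norm_le_if_trace_le[of \<mu> K] norm_le_if_trace_le[of "1 / \<mu>" K] \<mu> K(1) by (auto simp: add.commute)
    have \<zeta>K: "norm \<zeta> \<le> K + 1" "norm (1 / \<zeta>) \<le> K + 1"
      using norm_le_if_trace_le[of \<zeta> K] norm_le_if_trace_le[of "1 / \<zeta>" K] \<zeta> K(2)
      by (auto simp: add.commute z_def)
    have "\<nu> powi p = \<zeta> * \<mu> powi (- q)" "\<nu> powi (- p) = (1 / \<zeta>) * \<mu> powi q"
      using \<mu>(1) \<nu>(1) by (simp_all add: \<zeta>_def power_int_minus field_simps)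
    then have "norm (\<nu> powi p) \<le> (K + 1) * (K + 1) ^ nat \<bar>q\<bar>" "norm (\<nu> powi (- p)) \<le> (K + 1) * (K + 1) ^ nat \<bar>q\<bar>"
      using mult_mono[OF \<zeta>K(1) norm_powi_le[OF \<mu>(1) \<mu>K, of "- q"]] mult_mono[OF \<zeta>K(2) norm_powi_le[OF \<mu>(1) \<mu>K, of q]] K0
      by (simp_all add: norm_mult norm_divide)
    then have le: "norm (\<nu> powi p) \<le> (K + 1) ^ Suc (nat \<bar>q\<bar>)" "norm (\<nu> powi (- p)) \<le> (K + 1) ^ Suc (nat \<bar>q\<bar>)"
      by simp_all
    have "norm \<nu> \<le> (K + 1) ^ Suc (nat \<bar>q\<bar>)"
      using norm_le_if_powi_le[OF le p M1] .
    moreover have "norm (1 / \<nu>) \<le> (K + 1) ^ Suc (nat \<bar>q\<bar>)"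
    proof (rule norm_le_if_powi_le[OF _ _ p M1])
      have "(1 / \<nu>) powi i = \<nu> powi (- i)" for i
        by (simp add: power_int_minus power_int_inverse divide_inverse)
      then show "norm ((1 / \<nu>) powi p) \<le> (K + 1) ^ Suc (nat \<bar>q\<bar>)" "norm ((1 / \<nu>) powi (- p)) \<le> (K + 1) ^ Suc (nat \<bar>q\<bar>)"
        using le by simp_all
    qed
    ultimately show ?thesis
      unfolding \<nu>(2) using norm_triangle_ineq[of \<nu> "1 / \<nu>"] by linarith
  qed
qed

section \<open>Primitive peripheral elements\<close>

text \<open>The homomorphism that counts the exponent of \<open>t\<close>, with the integer
  \<open>n\<close> coded by the diagonal matrix with entries \<open>2^n\<close> and
  \<open>2^(-n)\<close>.\<close>

definition degree_rep :: "gen \<Rightarrow> complex^2^2" where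
  "degree_rep g = (case g of Gen_t \<Rightarrow> mat2 2 0 0 (1 / 2) | _ \<Rightarrow> mat 1)"

lemma bundle_rep_degree_rep: "bundle_rep degree_rep"
proof -
  have "det (degree_rep g) = 1" for g by (cases g) (simp_all add: degree_rep_def mat_1_eq_mat2)
  then show ?thesis by (simp add: bundle_rep_def Let_def degree_rep_def mat_1_eq_mat2)
qed

lemma degree_rep_eval_word: "\<exists>n::int. eval_word degree_rep w = mat2 (2 powi n) 0 0 (2 powi (- n))"
proof (induction w)
  case Nil
  show ?case by (intro exI[of _ 0]) (simp add: mat_1_eq_mat2)
next
  case (Cons x w)
  then obtain n :: int where n: "eval_word degree_rep w = mat2 (2 powi n) 0 0 (2 powi (- n))" by blast
  obtain g e where x: "x = (g, e)" by (cases x)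
  have letter: "\<exists>k::int. (if e then degree_rep g else adj2 (degree_rep g)) = mat2 (2 powi k) 0 0 (2 powi (- k))"
  proof (cases "g = Gen_t")
    case True
    show ?thesis
    proof (cases e)
      case e: True
      show ?thesis by (intro exI[of _ 1]) (simp add: degree_rep_def True e inverse_eq_divide)
    next
      case e: False
      show ?thesis by (intro exI[of _ "-1"]) (simp add: degree_rep_def True e inverse_eq_divide)
    qed
  next
    case False
    then have "degree_rep g = mat 1" by (cases g) (auto simp: degree_rep_def)
    then show ?thesis by (intro exI[of _ 0]) (simp add: mat_1_eq_mat2)
  qed
  then obtain k :: int where k: "(if e then degree_rep g else adj2 (degree_rep g)) = mat2 (2 powi k) 0 0 (2 powi (- k))" ..
  then have "eval_word degree_rep (x # w) = mat2 (2 powi (k + n)) 0 0 (2 powi (- (k + n)))"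
    using power_int_add[of "2::complex" k n] power_int_add[of "2::complex" "- k" "- n"]
    unfolding eval_word.simps x fst_conv snd_conv k n by simp
  then show ?case by blast
qed

lemma powi_2_eq_2D:
  assumes "(2::complex) powi i = 2"
  shows "i = 1"
proof -
  have 2: "(2::real) powi i = 2"
    using arg_cong[OF assms, of norm] by (simp add: norm_power_int)
  show ?thesis
  proof (cases "0 \<le> i")
    case True
    then have "(2::real) ^ nat i = 2 ^ 1" using 2 by (simp add: power_int_def)
    then have "nat i = 1" by (subst (asm) power_inject_exp) auto
    then show ?thesis using True by simp
  next
    case False
    then have "(1 / 2) ^ nat (- i) = (2::real)" using 2 by (simp add: power_int_def inverse_eq_divide)
    moreover have "(1 / 2) ^ nat (- i) \<le> (1::real)" by (rule power_le_one) auto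
    ultimately show ?thesis by simp
  qed
qed

text \<open>For a \<open>k\<close>-th power of an element with exponent \<open>n\<close> of
  \<open>t\<close>, the exponent is \<open>n * k\<close>, and this is 1 only if both are
  units.\<close>

lemma primitive_if_degree_one:
  assumes \<alpha>: "\<alpha> \<in> peripheralN" and deg: "rep_of degree_rep \<alpha> = mat2 2 0 0 (1 / 2)"
  shows "primitive_in piN peripheralN \<alpha>"
  unfolding primitive_in_def
proof (intro conjI ballI allI impI \<alpha>)
  fix \<beta> and k :: int assume \<beta>: "\<beta> \<in> peripheralN" and eq: "\<alpha> = \<beta> [^]\<^bsub>piN\<^esub> k"
  have \<rho>: "rep_of degree_rep \<in> hom piN SL2C" by (rule rep_of_hom_piN[OF bundle_rep_degree_rep])
  obtain w where w: "\<beta> = wc w" using peripheral_in_carrier[OF \<beta>] by (auto simp: carrier_piN)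
  obtain n :: int where n: "rep_of degree_rep \<beta> = mat2 (2 powi n) 0 0 (2 powi (- n))"
    using degree_rep_eval_word[of w] rep_of_wc[OF bundle_rep_degree_rep] w by auto
  define v :: "complex^2" where "v = (\<chi> i. if i = 1 then 1 else 0)"
  have v: "v \<noteq> 0" "v $ 1 = 1" "v $ 2 = 0" using two_neq_one by (auto simp: v_def vec_eq_iff)
  have "rep_of degree_rep \<beta> *v v = (2 powi n) *s v"
    by (simp add: n vec_eq_iff forall_2 matrix_vector_2 v)
  from eigenvector_int_pow[OF \<rho> peripheral_in_carrier[OF \<beta>] v(1) this, of k]
  have "mat2 2 0 0 (1 / 2) *v v = ((2 powi n) powi k) *s v" using deg eq by simp
  from arg_cong[OF this, of "\<lambda>w. w $ 1"] have "(2::complex) powi (n * k) = 2"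
    by (simp add: matrix_vector_2 v power_int_mult)
  then have "n * k = 1" by (rule powi_2_eq_2D)
  then have "\<bar>k * n\<bar> = 1" by (simp add: mult.commute)
  then show "\<bar>k\<bar> = 1" by (rule abs_zmult_eq_1)
qed

lemma primitive_t: "primitive_in piN peripheralN tN"
  and primitive_lt: "primitive_in piN peripheralN (lN \<otimes>\<^bsub>piN\<^esub> tN)"
proof -
  have "eval_word degree_rep wt = mat2 2 0 0 (1 / 2)" "eval_word degree_rep wl = mat 1"
    by (simp_all add: wt_def wl_def wa_def wb_def inv_word_def degree_rep_def mat_1_eq_mat2)
  then show "primitive_in piN peripheralN tN" "primitive_in piN peripheralN (lN \<otimes>\<^bsub>piN\<^esub> tN)"
    using lN_tN_peripheral
    by (auto intro!: primitive_if_degree_one simp: tN_eq lN_eq wc_append rep_of_wc[OF bundle_rep_degree_rep] eval_word_append)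
qed

section \<open>Ideal points\<close>

lemma chi_eq_trace: "bundle_rep E \<Longrightarrow> x \<in> carrier piN \<Longrightarrow> chi E x = trace (rep_of E x)"
  by (simp add: chi_def character_def)

lemma chi_inv: "bundle_rep E \<Longrightarrow> x \<in> carrier piN \<Longrightarrow> chi E (inv\<^bsub>piN\<^esub> x) = chi E x"
  by (simp add: chi_eq_trace hom_piN_inv[OF rep_of_hom_piN])

lemma has_value_at_cong: "(\<And>y. y \<in> U \<Longrightarrow> g y = g' y) \<Longrightarrow> has_value_at V U g x c \<longleftrightarrow> has_value_at V U g' x c"
  unfolding has_value_at_def by auto

lemma poly_tendsto: "(poly p \<longlongrightarrow> poly p c) (at c)" for c :: complex
  by (simp flip: isCont_def)

lemma inverse_not_excluded: "s \<notin> excluded \<Longrightarrow> 1 / s \<notin> excluded"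
proof -
  have "1 / e \<in> excluded" if "e \<in> excluded" for e using that by (auto simp: excluded_def)
  from this[of "1 / s"] show "s \<notin> excluded \<Longrightarrow> 1 / s \<notin> excluded" by auto
qed

lemma eventually_at_not_excluded: "\<forall>\<^sub>F s in at c. s \<notin> excluded"
proof -
  have "\<forall>\<^sub>F s in at c. s \<noteq> 0 \<and> s \<noteq> 1 \<and> s \<noteq> -1"
    by (intro eventually_conj eventually_neq_at_within)
  then show ?thesis by eventually_elim (simp add: excluded_def)
qed

text \<open>The coordinate \<open>\<tau>\<close> is the parameter \<open>s\<close> or its inverse,
  and \<open>\<psi>\<close> returns to \<open>s\<close>. With the second choice a point over
  infinity is a point where \<open>\<tau>\<close> has value 0.\<close>

locale ideal_point_chart = parametrized_curve Y U \<tau> \<gamma>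
  for Y :: "(complex^'n) set set" and U \<tau> \<gamma> +
  fixes j :: complex and f :: "(complex^'n) set \<Rightarrow> gen word set \<Rightarrow> complex" and \<psi> :: "complex \<Rightarrow> complex"
  assumes j: "j ^ 2 = -1" and \<psi>: "\<psi> = (\<lambda>s. s) \<or> \<psi> = (\<lambda>s. 1 / s)"
    and f_eq: "y \<in> U \<Longrightarrow> f y = chi (curve_rep j (\<psi> (\<tau> y)))"
    and \<tau>_not_excluded: "y \<in> U \<Longrightarrow> \<tau> y \<notin> excluded"
begin

definition R :: "complex \<Rightarrow> gen word set \<Rightarrow> complex" where
  "R s = chi (curve_rep j (\<psi> s))"

lemma \<psi>_not_excluded: "s \<notin> excluded \<Longrightarrow> \<psi> s \<notin> excluded"
  using \<psi> inverse_not_excluded by auto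

lemma f_eq_R: "y \<in> U \<Longrightarrow> f y = R (\<tau> y)"
  by (simp add: R_def f_eq)

lemma R_rep: "s \<notin> excluded \<Longrightarrow> bundle_rep (curve_rep j (\<psi> s))"
  by (intro bundle_rep_curve_rep j \<psi>_not_excluded)

lemma R_rational: "\<exists>P Q. \<forall>s. s \<notin> excluded \<longrightarrow> poly Q s \<noteq> 0 \<and> R s (wc w) * poly Q s = poly P s"
proof -
  obtain N k where N: "\<And>s. s \<notin> excluded \<Longrightarrow> chi (curve_rep j s) (wc w) * poly excluded_poly s ^ k = poly N s"
    using trace_algebra_laurent[OF j trace_algebra_word[of w]] unfolding laurent_def by blast
  have NQ: "poly (excluded_poly ^ k) s \<noteq> 0 \<and> chi (curve_rep j s) (wc w) * poly (excluded_poly ^ k) s = poly N s"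
    if "s \<notin> excluded" for s
    using N[OF that] poly_excluded_poly_nonzero[OF that] by simp
  from \<psi> show ?thesis
  proof
    assume "\<psi> = (\<lambda>s. s)"
    then show ?thesis unfolding R_def using NQ by blast
  next
    assume inv: "\<psi> = (\<lambda>s. 1 / s)"
    obtain P' Q' where PQ: "\<And>s. s \<noteq> 0 \<Longrightarrow>
        \<exists>c. c \<noteq> 0 \<and> poly P' s = c * poly N (1 / s) \<and> poly Q' s = c * poly (excluded_poly ^ k) (1 / s)"
      using rational_inverse by blast
    have "poly Q' s \<noteq> 0 \<and> R s (wc w) * poly Q' s = poly P' s" if s: "s \<notin> excluded" for s
    proof -
      have "s \<noteq> 0" using s by (auto simp: excluded_def)
      then obtain c where "c \<noteq> 0" "poly P' s = c * poly N (1 / s)" "poly Q' s = c * poly (excluded_poly ^ k) (1 / s)"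
        using PQ by blast
      then show ?thesis
        using NQ[OF inverse_not_excluded[OF s]] unfolding R_def unfolding inv by (simp add: mult.left_commute)
    qed
    then show ?thesis by blast
  qed
qed

lemma trace_value_rational:
  assumes x: "has_value_at V U \<tau> x c"
    and PQ: "\<And>s. s \<notin> excluded \<Longrightarrow> R s \<alpha> * poly Q s = poly P s" and Q: "poly Q c \<noteq> 0"
  shows "trace_value Y U f x \<alpha> (poly P c / poly Q c)"
  unfolding trace_value_def
  by (rule has_value_at_rational[OF x _ Q]) (simp add: f_eq_R PQ \<tau>_not_excluded)

lemma trace_pole_rational:
  assumes x: "has_value_at V U \<tau> x c"
    and PQ: "\<And>s. s \<notin> excluded \<Longrightarrow> R s \<alpha> * poly Q s = poly P s" and Q: "poly Q c = 0" "poly P c \<noteq> 0"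
  shows "trace_pole Y U f x \<alpha>"
  unfolding trace_pole_def
  by (rule has_pole_at_rational[OF x _ Q]) (simp add: f_eq_R PQ \<tau>_not_excluded)

lemma trace_value_unique: "trace_value Y U f x \<alpha> v \<Longrightarrow> trace_value Y U f x \<alpha> v' \<Longrightarrow> v = v'"
  unfolding trace_value_def using has_value_at_unique U_open U_nonempty by blast

lemma not_trace_pole: "trace_value Y U f x \<alpha> v \<Longrightarrow> \<not> trace_pole Y U f x \<alpha>"
  unfolding trace_value_def trace_pole_def using not_has_pole_at_if_has_value_at U_open U_nonempty by blast

text \<open>After cancelling the common power of \<open>s - c\<close>, numerator and denominator do
  not both vanish at \<open>c\<close>.\<close>

lemma trace_value_or_pole:
  assumes x: "has_value_at V U \<tau> x c"
  shows "(\<exists>P Q. poly Q c \<noteq> 0 \<and> (\<forall>s. s \<notin> excluded \<longrightarrow> R s (wc w) * poly Q s = poly P s)) \<or>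
    trace_pole Y U f x (wc w)"
proof -
  obtain P Q where PQ: "\<And>s. s \<notin> excluded \<Longrightarrow> poly Q s \<noteq> 0 \<and> R s (wc w) * poly Q s = poly P s"
    using R_rational by blast
  \<comment> \<open>Any parameter that is not excluded shows that \<open>Q\<close> is not the zero
    polynomial.\<close>
  have "2 \<notin> excluded" by (simp add: excluded_def)
  then have "Q \<noteq> 0" using PQ by force
  \<comment> \<open>The pair is a family over \<open>bool\<close>, so that one and the same power is
    cancelled from both.\<close>
  then obtain m q where q: "\<forall>b. (if b then P else Q) = [:-c, 1:] ^ m * q b" "\<exists>b. poly (q b) c \<noteq> 0"
    using divide_common_zeros[of "\<lambda>b. if b then P else Q" False c] by auto
  have q': "P = [:-c, 1:] ^ m * q True" "Q = [:-c, 1:] ^ m * q False"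
    using q(1)[rule_format, of True] q(1)[rule_format, of False] by simp_all
  have eq: "R s (wc w) * poly (q False) s = poly (q True) s" if "s \<notin> excluded" for s
  proof -
    have "(s - c) ^ m * (R s (wc w) * poly (q False) s) = (s - c) ^ m * poly (q True) s" "(s - c) ^ m \<noteq> 0"
      using PQ[OF that] unfolding q' by (auto simp: poly_power mult.left_commute)
    then show ?thesis by auto
  qed
  show ?thesis
  proof (cases "poly (q False) c = 0")
    case True
    then have "poly (q True) c \<noteq> 0" using q(2) by (metis (full_types))
    then show ?thesis using trace_pole_rational[OF x eq True] by blast
  next
    case False
    then show ?thesis using eq by blast
  qed
qed

text \<open>Passes from the algebraic notion of value to limits in the complex numbers, where norms
  can be estimated.\<close>

lemma trace_value_tendsto:
  assumes x: "has_value_at V U \<tau> x c" and v: "trace_value Y U f x (wc w) v"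
  shows "((\<lambda>s. R s (wc w)) \<longlongrightarrow> v) (at c)"
proof -
  obtain P Q where PQ: "poly Q c \<noteq> 0" "\<And>s. s \<notin> excluded \<Longrightarrow> R s (wc w) * poly Q s = poly P s"
    using trace_value_or_pole[OF x, of w] not_trace_pole[OF v] by blast
  have v_eq: "v = poly P c / poly Q c" using trace_value_unique[OF v trace_value_rational[OF x PQ(2,1)]] .
  have "((\<lambda>s. poly P s / poly Q s) \<longlongrightarrow> v) (at c)"
    unfolding v_eq by (intro tendsto_divide poly_tendsto PQ(1))
  moreover have "\<forall>\<^sub>F s in at c. poly Q s \<noteq> 0"
    using tendsto_imp_eventually_ne[OF poly_tendsto PQ(1)] .
  then have "\<forall>\<^sub>F s in at c. poly P s / poly Q s = R s (wc w)"
    using eventually_at_not_excluded by eventually_elim (simp add: PQ(2)[symmetric])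
  ultimately show ?thesis by (rule Lim_transform_eventually)
qed

text \<open>All three traces depend on \<open>z^2\<close> only, and \<open>s \<mapsto> 1 / s\<close>
  merely changes the sign of \<open>z\<close>, hence the same formulas in both charts. They come
  from \<open>tr t = j z^2 / 2\<close>, \<open>tr lt = 8 j / z^2\<close> and
  \<open>2 z^2 tr l = z^4 - 4 z^2 + 16\<close>.\<close>

lemma R_traces:
  assumes s: "s \<notin> excluded"
  shows "R s tN * poly (2 * [:0, 1:] ^ 2) s = poly (smult j ([:-1, 0, 1:] ^ 2)) s"
    "R s (lN \<otimes>\<^bsub>piN\<^esub> tN) * poly ([:-1, 0, 1:] ^ 2) s = poly (smult (8 * j) ([:0, 1:] ^ 2)) s"
    "R s lN * poly (2 * [:0, 1:] ^ 2 * [:-1, 0, 1:] ^ 2) s =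
      poly ([:-1, 0, 1:] ^ 4 - 4 * [:0, 1:] ^ 2 * [:-1, 0, 1:] ^ 2 + 16 * [:0, 1:] ^ 4) s"
proof -
  let ?s = "\<psi> s"
  define z x where "z = ?s - 1 / ?s" and "x = (?s + 1 / ?s) / sqrt2"
  note par = curve_parameter[OF \<psi>_not_excluded[OF s], folded z_def x_def]
  note tr = traces_curve_rep[OF j \<psi>_not_excluded[OF s], folded R_def, folded z_def x_def]
  have s0: "s \<noteq> 0" and e0: "s ^ 2 - 1 \<noteq> 0" using s by (auto simp: excluded_def power2_eq_1_iff)
  have zs: "z ^ 2 * s ^ 2 = (s ^ 2 - 1) ^ 2"
  proof -
    have "z * s = s ^ 2 - 1 \<or> z * s = 1 - s ^ 2"
      using \<psi> s0 by (auto simp: z_def field_simps power2_eq_square)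
    then have "(z * s) ^ 2 = (s ^ 2 - 1) ^ 2" by (auto simp: power2_commute)
    then show ?thesis by (simp add: power_mult_distrib)
  qed
  have pol: "poly [:0, 1:] s = s" "poly [:-1, 0, 1:] s = s ^ 2 - 1" by (simp_all add: power2_eq_square)
  have Rt: "R s tN = j * z ^ 2 / 2" using tr by (simp add: tN_eq)
  then show "R s tN * poly (2 * [:0, 1:] ^ 2) s = poly (smult j ([:-1, 0, 1:] ^ 2)) s"
    by (simp add: Rt pol zs[symmetric] del: poly_pCons)
  note rep = R_rep[OF s]
  have "R s (lN \<otimes>\<^bsub>piN\<^esub> tN) = trace (eval_word (curve_rep j ?s) (wl @ wt))"
    unfolding lN_eq tN_eq wc_append R_def using chi_wc[OF rep] .
  also have "\<dots> = 8 * j * (1 / z) ^ 2"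
    using trace_lt_curve_matrices[OF par(1,2), of j]
    by (simp add: eval_word_append eval_word_inv_word wl_def wa_def wb_def wt_def curve_rep_def z_def x_def inv_word_def
        flip: matrix_mul_assoc)
  finally have "R s (lN \<otimes>\<^bsub>piN\<^esub> tN) * z ^ 2 = 8 * j" using par(3) by (simp add: power_divide)
  then have "R s (lN \<otimes>\<^bsub>piN\<^esub> tN) * (s ^ 2 - 1) ^ 2 = 8 * j * s ^ 2"
    unfolding zs[symmetric] by (metis mult.assoc)
  then show "R s (lN \<otimes>\<^bsub>piN\<^esub> tN) * poly ([:-1, 0, 1:] ^ 2) s = poly (smult (8 * j) ([:0, 1:] ^ 2)) s"
    by (simp add: pol del: poly_pCons)
  have "R s lN = x ^ 2 + (2 * x / z) ^ 2 + z ^ 2 - x * (2 * x / z) * z - 2"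
    using chi_traces[OF rep, folded R_def] tr unfolding lN_eq wl_def by simp
  then have "R s lN * z ^ 2 = 4 * x ^ 2 + z ^ 4 - x ^ 2 * z ^ 2 - 2 * z ^ 2"
    using par(3) by (simp add: field_simps power2_eq_square power4_eq_xxxx)
  then have Rl: "R s lN * (2 * z ^ 2) = z ^ 4 - 4 * z ^ 2 + 16" using par(1) by algebra
  have "R s lN * (2 * s ^ 2 * (s ^ 2 - 1) ^ 2) = R s lN * (2 * z ^ 2) * s ^ 4"
    unfolding zs[symmetric] by (simp add: power2_eq_square power4_eq_xxxx)
  also have "\<dots> = (z ^ 2 * s ^ 2) ^ 2 - 4 * s ^ 2 * (z ^ 2 * s ^ 2) + 16 * s ^ 4"
    unfolding Rl by (simp add: power2_eq_square power4_eq_xxxx algebra_simps)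
  also have "\<dots> = (s ^ 2 - 1) ^ 4 - 4 * s ^ 2 * (s ^ 2 - 1) ^ 2 + 16 * s ^ 4"
    unfolding zs by (simp flip: power_mult)
  finally show "R s lN * poly (2 * [:0, 1:] ^ 2 * [:-1, 0, 1:] ^ 2) s =
      poly ([:-1, 0, 1:] ^ 4 - 4 * [:0, 1:] ^ 2 * [:-1, 0, 1:] ^ 2 + 16 * [:0, 1:] ^ 4) s"
    by (simp add: pol del: poly_pCons)
qed

lemma trace_pole_l:
  assumes x: "has_value_at V U \<tau> x c" and c: "c \<in> excluded"
  shows "trace_pole Y U f x lN"
  \<comment> \<open>At an excluded \<open>c\<close> the denominator vanishes, while the numerator is
    1 for \<open>c = 0\<close> and 16 for \<open>c = 1\<close> or \<open>c = -1\<close>.\<close>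
  by (rule trace_pole_rational[OF x R_traces(3)]) (use c in \<open>auto simp: excluded_def\<close>)

text \<open>Near \<open>c\<close> the traces of \<open>m\<close> and of the product stay bounded.
  For nonzero \<open>p\<close> the uniform estimate \<open>trace_bound\<close> would bound the trace
  of \<open>l\<close> as well, although it has a pole.\<close>

lemma finite_trace_exponent:
  assumes x: "has_value_at V U \<tau> x c" "c \<in> excluded"
    and m: "m \<in> carrier piN" "lN \<otimes>\<^bsub>piN\<^esub> m = m \<otimes>\<^bsub>piN\<^esub> lN" "trace_value Y U f x m vm"
    and v: "trace_value Y U f x (lN [^]\<^bsub>piN\<^esub> (p::int) \<otimes>\<^bsub>piN\<^esub> m [^]\<^bsub>piN\<^esub> (q::int)) v"
  shows "p = 0"
proof (rule ccontr)
  assume p: "p \<noteq> 0"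
  define \<alpha> where "\<alpha> = lN [^]\<^bsub>piN\<^esub> p \<otimes>\<^bsub>piN\<^esub> m [^]\<^bsub>piN\<^esub> q"
  have \<alpha>: "\<alpha> \<in> carrier piN" unfolding \<alpha>_def using m by simp
  obtain w w' where w: "m = wc w" "\<alpha> = wc w'" using m(1) \<alpha> by (auto simp: carrier_piN)
  define K where "K = max (norm vm) (norm v) + 1"
  have "((\<lambda>s. norm (R s m)) \<longlongrightarrow> norm vm) (at c)" "((\<lambda>s. norm (R s \<alpha>)) \<longlongrightarrow> norm v) (at c)"
    using trace_value_tendsto[OF x(1), of w vm] trace_value_tendsto[OF x(1), of w' v] m(3) v w
    by (auto intro!: tendsto_norm simp: \<alpha>_def)
  then have bounds: "\<forall>\<^sub>F s in at c. norm (R s m) < K" "\<forall>\<^sub>F s in at c. norm (R s \<alpha>) < K"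
    by (auto elim!: order_tendstoD simp: K_def)
  define Q P :: "complex poly" where "Q = 2 * [:0, 1:] ^ 2 * [:-1, 0, 1:] ^ 2"
    and "P = [:-1, 0, 1:] ^ 4 - 4 * [:0, 1:] ^ 2 * [:-1, 0, 1:] ^ 2 + 16 * [:0, 1:] ^ 4"
  define M where "M = 2 * (K + 1) ^ Suc (nat \<bar>q\<bar>)"
  \<comment> \<open>The bound on \<open>P / Q\<close> is multiplied out so that the limit at
    \<open>c\<close> can be taken, where \<open>Q\<close> vanishes and \<open>P\<close> does
    not.\<close>
  have "\<forall>\<^sub>F s in at c. norm (poly P s) \<le> M * norm (poly Q s)"
    using bounds eventually_at_not_excluded
  proof eventually_elim
    case (elim s)
    note rep = R_rep[OF elim(3)]
    have R: "R s y = trace (rep_of (curve_rep j (\<psi> s)) y)" if "y \<in> carrier piN" for y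
      unfolding R_def using chi_eq_trace[OF rep that] .
    have "norm (R s lN) \<le> M"
      unfolding M_def R[OF lN_in_carrier]
      by (rule trace_bound[OF rep_of_hom_piN[OF rep] lN_in_carrier m(1,2) p])
        (use elim(1,2) R m(1) \<alpha> in \<open>auto simp: \<alpha>_def\<close>)
    moreover have "poly P s = R s lN * poly Q s"
      unfolding P_def Q_def using R_traces(3)[OF elim(3)] by simp
    ultimately show ?case by (simp add: norm_mult mult_right_mono)
  qed
  moreover have "((\<lambda>s. M * norm (poly Q s)) \<longlongrightarrow> M * norm (poly Q c)) (at c)"
    "((\<lambda>s. norm (poly P s)) \<longlongrightarrow> norm (poly P c)) (at c)"
    by (intro tendsto_mult tendsto_const tendsto_norm poly_tendsto)+
  ultimately have "norm (poly P c) \<le> M * norm (poly Q c)"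
    by (intro tendsto_le[of "at c"]) auto
  moreover have "poly Q c = 0" "poly P c \<noteq> 0" using x(2) by (auto simp: P_def Q_def excluded_def)
  ultimately show False by simp
qed

lemma trace_value_inv:
  assumes "m \<in> carrier piN"
  shows "trace_value Y U f x (inv\<^bsub>piN\<^esub> m) v \<longleftrightarrow> trace_value Y U f x m v"
  unfolding trace_value_def
  by (rule has_value_at_cong) (simp add: f_eq chi_inv assms R_rep \<tau>_not_excluded)

text \<open>Here \<open>m\<close> stands for \<open>t\<close> or \<open>lt\<close>. By
  \<open>finite_trace_exponent\<close> a peripheral element of finite trace is a power of
  \<open>m\<close>. The value 0 at \<open>m\<close> means
  \<open>\<zeta> + 1 / \<zeta> = 0\<close>.\<close>

lemma slope_and_root:
  assumes x: "has_value_at V U \<tau> x c" "c \<in> excluded"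
    and m: "primitive_in piN peripheralN m" "lN \<otimes>\<^bsub>piN\<^esub> m = m \<otimes>\<^bsub>piN\<^esub> lN" "trace_value Y U f x m 0"
    and decomp: "\<And>\<alpha>. \<alpha> \<in> peripheralN \<Longrightarrow> \<exists>(p::int) (q::int). \<alpha> = lN [^]\<^bsub>piN\<^esub> p \<otimes>\<^bsub>piN\<^esub> m [^]\<^bsub>piN\<^esub> q"
  shows "associated_slope piN peripheralN Y U f x {m, inv\<^bsub>piN\<^esub> m}"
    "{\<zeta>. associated_root piN peripheralN Y U f x \<zeta>} = {\<i>, -\<i>}"
proof -
  have mP: "m \<in> peripheralN" using m(1) by (simp add: primitive_in_def)
  note mc = peripheral_in_carrier[OF mP]
  have vals: "trace_value Y U f x \<alpha> 0" if "\<alpha> \<in> {m, inv\<^bsub>piN\<^esub> m}" for \<alpha>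
    using that m(3) trace_value_inv[OF mc] by auto
  have "s' = {m, inv\<^bsub>piN\<^esub> m}" if s': "s' \<in> slopes piN peripheralN" "\<forall>\<alpha>\<in>s'. \<exists>v. trace_value Y U f x \<alpha> v" for s'
  proof -
    obtain \<alpha> where \<alpha>: "s' = {\<alpha>, inv\<^bsub>piN\<^esub> \<alpha>}" "primitive_in piN peripheralN \<alpha>"
      using s'(1) by (auto simp: slopes_def)
    then have "\<alpha> \<in> peripheralN" by (simp add: primitive_in_def)
    then obtain p q :: int where pq: "\<alpha> = lN [^]\<^bsub>piN\<^esub> p \<otimes>\<^bsub>piN\<^esub> m [^]\<^bsub>piN\<^esub> q" using decomp by blast
    obtain v where "trace_value Y U f x \<alpha> v" using s'(2) \<alpha>(1) by blast
    then have "p = 0" using finite_trace_exponent[OF x mc m(2,3)] unfolding pq by blast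
    then have \<alpha>q: "\<alpha> = m [^]\<^bsub>piN\<^esub> q" using pq mc by simp
    \<comment> \<open>Primitivity of \<open>\<alpha>\<close> is applied to \<open>m\<close> itself
      as the root.\<close>
    then have "\<bar>q\<bar> = 1" using \<alpha>(2) mP unfolding primitive_in_def by blast
    then have "q = 1 \<or> q = -1" by linarith
    then show ?thesis
    proof
      assume "q = 1"
      then show ?thesis using \<alpha>(1) \<alpha>q mc by simp
    next
      assume "q = -1"
      then have "\<alpha> = inv\<^bsub>piN\<^esub> m" using \<alpha>q mc by (simp add: piN.int_pow_neg)
      then show ?thesis using \<alpha>(1) mc by auto
    qed
  qed
  moreover have "{m, inv\<^bsub>piN\<^esub> m} \<in> slopes piN peripheralN" using m(1) by (auto simp: slopes_def)
  ultimately have set: "{s' \<in> slopes piN peripheralN. \<forall>\<alpha>\<in>s'. \<exists>v. trace_value Y U f x \<alpha> v} = {{m, inv\<^bsub>piN\<^esub> m}}"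
    using vals by blast
  then show slope: "associated_slope piN peripheralN Y U f x {m, inv\<^bsub>piN\<^esub> m}"
    unfolding associated_slope_def using lN_tN_peripheral(1) trace_pole_l[OF x] by blast
  show "{\<zeta>. associated_root piN peripheralN Y U f x \<zeta>} = {\<i>, -\<i>}"
  proof (intro equalityI subsetI)
    fix \<zeta> assume "\<zeta> \<in> {\<zeta>. associated_root piN peripheralN Y U f x \<zeta>}"
    then obtain n s where n: "n > (0::nat)" "\<zeta> ^ n = 1" and s: "associated_slope piN peripheralN Y U f x s"
      "\<forall>\<alpha>\<in>s. trace_value Y U f x \<alpha> (\<zeta> + inverse \<zeta>)"
      unfolding associated_root_def by blast
    have "s = {m, inv\<^bsub>piN\<^esub> m}" using s(1) set unfolding associated_slope_def by simp
    then have "trace_value Y U f x m (\<zeta> + inverse \<zeta>)" using s(2) by blast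
    then have 0: "\<zeta> + inverse \<zeta> = 0" using trace_value_unique m(3) by blast
    have "\<zeta> \<noteq> 0" using n by (auto simp: power_0_left)
    then have "(\<zeta> - \<i>) * (\<zeta> + \<i>) = 0" using 0 by (simp add: field_simps)
    then show "\<zeta> \<in> {\<i>, -\<i>}" by (auto simp: eq_neg_iff_add_eq_0)
  next
    fix \<zeta> assume "\<zeta> \<in> {\<i>, -\<i>}"
    then have root: "\<zeta> ^ 4 = 1" "\<zeta> + inverse \<zeta> = 0" by auto
    show "\<zeta> \<in> {\<zeta>. associated_root piN peripheralN Y U f x \<zeta>}"
      unfolding associated_root_def mem_Collect_eq root(2)
    proof (intro conjI exI[of _ "4::nat"] exI[of _ "{m, inv\<^bsub>piN\<^esub> m}"] ballI slope root(1))
      show "trace_value Y U f x \<alpha> 0" if "\<alpha> \<in> {m, inv\<^bsub>piN\<^esub> m}" for \<alpha> using that by (rule vals)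
    qed simp
  qed
qed

lemma at_zero:
  assumes x: "has_value_at V U \<tau> x 0"
  shows "trace_pole Y U f x lN"
    "associated_slope piN peripheralN Y U f x {lN \<otimes>\<^bsub>piN\<^esub> tN, inv\<^bsub>piN\<^esub> (lN \<otimes>\<^bsub>piN\<^esub> tN)}"
    "{\<zeta>. associated_root piN peripheralN Y U f x \<zeta>} = {\<i>, -\<i>}"
proof -
  have e: "(0::complex) \<in> excluded" by (simp add: excluded_def)
  show "trace_pole Y U f x lN" using trace_pole_l[OF x e] .
  have "trace_value Y U f x (lN \<otimes>\<^bsub>piN\<^esub> tN) 0"
    using trace_value_rational[OF x R_traces(2)] by simp
  moreover have "lN \<otimes>\<^bsub>piN\<^esub> (lN \<otimes>\<^bsub>piN\<^esub> tN) = (lN \<otimes>\<^bsub>piN\<^esub> tN) \<otimes>\<^bsub>piN\<^esub> lN"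
  proof -
    have "lN \<otimes>\<^bsub>piN\<^esub> (lN \<otimes>\<^bsub>piN\<^esub> tN) = lN \<otimes>\<^bsub>piN\<^esub> (tN \<otimes>\<^bsub>piN\<^esub> lN)" by (simp only: lN_tN_commute)
    also have "\<dots> = (lN \<otimes>\<^bsub>piN\<^esub> tN) \<otimes>\<^bsub>piN\<^esub> lN" by (simp add: piN.m_assoc)
    finally show ?thesis .
  qed
  ultimately show "associated_slope piN peripheralN Y U f x {lN \<otimes>\<^bsub>piN\<^esub> tN, inv\<^bsub>piN\<^esub> (lN \<otimes>\<^bsub>piN\<^esub> tN)}"
    "{\<zeta>. associated_root piN peripheralN Y U f x \<zeta>} = {\<i>, -\<i>}"
    using slope_and_root[OF x e primitive_lt _ _ peripheral_eq_lt] by blast+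
qed

lemma at_one:
  assumes x: "has_value_at V U \<tau> x c" and c: "c = 1 \<or> c = -1"
  shows "trace_pole Y U f x lN"
    "associated_slope piN peripheralN Y U f x {tN, inv\<^bsub>piN\<^esub> tN}"
    "{\<zeta>. associated_root piN peripheralN Y U f x \<zeta>} = {\<i>, -\<i>}"
proof -
  have e: "c \<in> excluded" using c by (auto simp: excluded_def)
  show "trace_pole Y U f x lN" using trace_pole_l[OF x e] .
  have "trace_value Y U f x tN 0"
    using trace_value_rational[OF x R_traces(1)] c by auto
  then show "associated_slope piN peripheralN Y U f x {tN, inv\<^bsub>piN\<^esub> tN}"
    "{\<zeta>. associated_root piN peripheralN Y U f x \<zeta>} = {\<i>, -\<i>}"
    using slope_and_root[OF x e primitive_t lN_tN_commute _ peripheral_eq_t] by blast+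
qed

lemma not_ideal:
  assumes x: "has_value_at V U \<tau> x c" and c: "c \<notin> excluded"
  shows "x \<notin> ideal_points piN Y U f"
proof -
  have "\<not> trace_pole Y U f x (wc w)" for w
  proof -
    obtain P Q where PQ: "\<And>s. s \<notin> excluded \<Longrightarrow> poly Q s \<noteq> 0 \<and> R s (wc w) * poly Q s = poly P s"
      using R_rational by blast
    show ?thesis
      by (rule not_trace_pole[OF trace_value_rational[OF x]]) (use PQ c in auto)
  qed
  then show ?thesis by (auto simp: ideal_points_def carrier_piN)
qed

end

section \<open>Counting the ideal points\<close>

text \<open>At the parameter 2 the traces of \<open>t\<close> and \<open>lt\<close> are
  \<open>9 j / 8\<close> and \<open>32 j / 9\<close>, and an inverse has the same trace.
  Distinctness of the slopes is what makes the two counts exact.\<close>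

lemma slopes_distinct:
  assumes j: "j ^ 2 = -1" and chart: "ideal_point_chart Y U \<tau> \<gamma> j f \<psi>"
  shows "{tN, inv\<^bsub>piN\<^esub> tN} \<noteq> {lN \<otimes>\<^bsub>piN\<^esub> tN, inv\<^bsub>piN\<^esub> (lN \<otimes>\<^bsub>piN\<^esub> tN)}"
proof
  interpret ideal_point_chart Y U \<tau> \<gamma> j f \<psi> by fact
  assume "{tN, inv\<^bsub>piN\<^esub> tN} = {lN \<otimes>\<^bsub>piN\<^esub> tN, inv\<^bsub>piN\<^esub> (lN \<otimes>\<^bsub>piN\<^esub> tN)}"
  then have "tN = lN \<otimes>\<^bsub>piN\<^esub> tN \<or> tN = inv\<^bsub>piN\<^esub> (lN \<otimes>\<^bsub>piN\<^esub> tN)" by (metis insertCI insertE singletonD)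
  moreover have 2: "2 \<notin> excluded" by (simp add: excluded_def)
  have "R 2 (inv\<^bsub>piN\<^esub> (lN \<otimes>\<^bsub>piN\<^esub> tN)) = R 2 (lN \<otimes>\<^bsub>piN\<^esub> tN)"
    unfolding R_def by (intro chi_inv R_rep 2) simp
  ultimately have eq: "R 2 tN = R 2 (lN \<otimes>\<^bsub>piN\<^esub> tN)" by metis
  have "R 2 tN * 8 = 9 * j" "R 2 (lN \<otimes>\<^bsub>piN\<^esub> tN) * 9 = 32 * j"
    using R_traces(1,2)[OF 2] by (simp_all add: mult.commute)
  then have "81 * j = 256 * j" unfolding eq by algebra
  then show False using j by simp
qed

text \<open>Each point of \<open>Y\<close> lies over a finite value of \<open>\<sigma>\<close> or
  over infinity because it is smooth, and over a value that is not excluded all traces are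
  finite.\<close>

lemma ideal_points_smooth_model:
  assumes j: "j ^ 2 = -1" and sm: "smooth_model (char_variety piN) (curve j) Y U f"
  shows "let I = ideal_points piN Y U f;
            slope = associated_slope piN peripheralN Y U f;
            root_of_unity = associated_root piN peripheralN Y U f
        in card I = 4 \<and>
           (\<forall>x\<in>I. \<exists>\<delta>\<in>peripheralN. trace_pole Y U f x \<delta>) \<and>
           card {x \<in> I. slope x {tN, inv\<^bsub>piN\<^esub> tN}} = 2 \<and>
           card {x \<in> I. slope x {lN \<otimes>\<^bsub>piN\<^esub> tN, inv\<^bsub>piN\<^esub> (lN \<otimes>\<^bsub>piN\<^esub> tN)}} = 2 \<and>
           {x \<in> I. slope x {tN, inv\<^bsub>piN\<^esub> tN}} \<inter>
             {x \<in> I. slope x {lN \<otimes>\<^bsub>piN\<^esub> tN, inv\<^bsub>piN\<^esub> (lN \<otimes>\<^bsub>piN\<^esub> tN)}} = {} \<and>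
           (\<forall>x\<in>I. {\<zeta>. root_of_unity x \<zeta>} = {\<i>, - \<i>})"
proof -
  define \<sigma> where "\<sigma> = curve_coord \<circ> f"
  define \<sigma>' where "\<sigma>' = (\<lambda>y. 1 / curve_coord (f y))"
  obtain \<gamma> where \<gamma>: "parametrized_curve Y U \<sigma> \<gamma>" "parametrized_curve Y U \<sigma>' (\<lambda>s. \<gamma> (1 / s))"
    using smooth_model_parametrized(1)[OF j sm] unfolding \<sigma>_def \<sigma>'_def by blast
  note fC = curveE[OF smooth_model_parametrized(2)[OF j sm] j]
  have A: "ideal_point_chart Y U \<sigma> \<gamma> j f (\<lambda>s. s)"
    using fC by (intro ideal_point_chart.intro[OF \<gamma>(1)] ideal_point_chart_axioms.intro) (auto simp: j \<sigma>_def)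
  have ne: "\<sigma>' y \<notin> excluded" if "y \<in> U" for y
    using inverse_not_excluded[OF fC(1)[OF that]] by (simp add: \<sigma>'_def)
  have B: "ideal_point_chart Y U \<sigma>' (\<lambda>s. \<gamma> (1 / s)) j f (\<lambda>s. 1 / s)"
    using fC ne by (intro ideal_point_chart.intro[OF \<gamma>(2)] ideal_point_chart_axioms.intro) (auto simp: j \<sigma>'_def)
  interpret A: ideal_point_chart Y U \<sigma> \<gamma> j f "\<lambda>s. s" by (rule A)
  interpret B: ideal_point_chart Y U \<sigma>' "\<lambda>s. \<gamma> (1 / s)" j f "\<lambda>s. 1 / s" by (rule B)
  let ?V = "sub_fspace proj_space Y"
  let ?val = "has_value_at ?V U \<sigma>" and ?inf = "\<lambda>x. has_value_at ?V U \<sigma>' x 0"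
  have \<sigma>\<sigma>': "\<sigma> y * \<sigma>' y = 1" "\<sigma> y \<noteq> 0" if "y \<in> U" for y
    using fC(1)[OF that] by (auto simp: \<sigma>_def \<sigma>'_def excluded_def)
  \<comment> \<open>On \<open>U\<close> the equation \<open>h * \<sigma> = 1\<close> says that
    \<open>h\<close> is \<open>\<sigma>'\<close>, so a pole of \<open>\<sigma>\<close> is a zero of
    its reciprocal and the second chart applies.\<close>
  have pole_iff: "has_pole_at ?V U \<sigma> x \<longleftrightarrow> ?inf x" for x
  proof -
    have "h y * \<sigma> y = 1 \<longleftrightarrow> \<sigma>' y = h y" if "y \<in> U" for h y
      using \<sigma>\<sigma>'[OF that] by (metis mult.commute mult_right_cancel)
    then show ?thesis unfolding has_pole_at_def has_value_at_def by (metis (no_types, lifting) IntD2)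
  qed
  have val_inf: "\<not> ?inf x" if "?val x c" for x c
    using A.not_has_pole_at_if_has_value_at[OF that A.U_open A.U_nonempty] pole_iff by blast
  have val_unique: "c = c'" if "?val x c" "?val x c'" for x c c'
    using A.has_value_at_unique[OF that A.U_open A.U_nonempty] .
  have total: "(\<exists>c. ?val x c) \<or> ?inf x" if "x \<in> Y" for x
    using A.has_value_or_pole_at[OF A.Y_smooth[OF that] A.U_open A.U_nonempty A.\<sigma>_reg] pole_iff by blast
  obtain x0 where x0: "x0 \<in> Y" "?val x0 0" "\<And>x. x \<in> Y \<Longrightarrow> ?val x 0 \<Longrightarrow> x = x0"
    using A.unique_point_with_value[of 0] by metis
  obtain x1 where x1: "x1 \<in> Y" "?val x1 1" "\<And>x. x \<in> Y \<Longrightarrow> ?val x 1 \<Longrightarrow> x = x1"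
    using A.unique_point_with_value[of 1] by metis
  obtain x2 where x2: "x2 \<in> Y" "?val x2 (-1)" "\<And>x. x \<in> Y \<Longrightarrow> ?val x (-1) \<Longrightarrow> x = x2"
    using A.unique_point_with_value[of "-1"] by metis
  obtain x3 where x3: "x3 \<in> Y" "?inf x3" "\<And>x. x \<in> Y \<Longrightarrow> ?inf x \<Longrightarrow> x = x3"
    using B.unique_point_with_value[of 0] by metis
  have distinct: "x0 \<noteq> x1" "x0 \<noteq> x2" "x0 \<noteq> x3" "x1 \<noteq> x2" "x1 \<noteq> x3" "x2 \<noteq> x3"
    using val_unique[of x0 0 1] val_unique[of x0 0 "-1"] val_unique[of x1 1 "-1"]
      val_inf[OF x0(2)] val_inf[OF x1(2)] val_inf[OF x2(2)] x0(2) x1(2) x2(2) x3(2) by auto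
  note P0 = A.at_zero[OF x0(2)] and P3 = B.at_zero[OF x3(2)]
    and P1 = A.at_one[OF x1(2) disjI1[OF HOL.refl]] and P2 = A.at_one[OF x2(2) disjI2[OF HOL.refl]]
  have I: "ideal_points piN Y U f = {x0, x1, x2, x3}"
  proof (intro equalityI subsetI)
    fix x assume x: "x \<in> ideal_points piN Y U f"
    then have xY: "x \<in> Y" by (simp add: ideal_points_def)
    show "x \<in> {x0, x1, x2, x3}"
    proof (cases "?inf x")
      case True
      then show ?thesis using x3(3)[OF xY] by simp
    next
      case False
      then obtain c where c: "?val x c" using total[OF xY] by blast
      then have "c \<in> excluded" using A.not_ideal x by blast
      then show ?thesis using c x0(3)[OF xY] x1(3)[OF xY] x2(3)[OF xY] by (auto simp: excluded_def)
    qed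
  next
    fix x assume "x \<in> {x0, x1, x2, x3}"
    then show "x \<in> ideal_points piN Y U f"
      unfolding ideal_points_def using P0(1) P1(1) P2(1) P3(1) x0(1) x1(1) x2(1) x3(1) lN_in_carrier by blast
  qed
  let ?t = "{tN, inv\<^bsub>piN\<^esub> tN}" and ?lt = "{lN \<otimes>\<^bsub>piN\<^esub> tN, inv\<^bsub>piN\<^esub> (lN \<otimes>\<^bsub>piN\<^esub> tN)}"
  let ?slope = "associated_slope piN peripheralN Y U f"
  have slope_unique: "s = s'" if "?slope x s" "?slope x s'" for x s s'
    using that unfolding associated_slope_def by simp
  note dist = slopes_distinct[OF j A]
  have not: "\<not> ?slope x0 ?t" "\<not> ?slope x3 ?t" "\<not> ?slope x1 ?lt" "\<not> ?slope x2 ?lt"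
    using slope_unique[OF _ P0(2)] slope_unique[OF _ P3(2)] slope_unique[OF P1(2)] slope_unique[OF P2(2)] dist by blast+
  have t: "{x \<in> {x0, x1, x2, x3}. ?slope x ?t} = {x1, x2}"
    using P1(2) P2(2) not by blast
  have lt: "{x \<in> {x0, x1, x2, x3}. ?slope x ?lt} = {x0, x3}"
    using P0(2) P3(2) not by blast
  have "card {x0, x1, x2, x3} = 4" "card {x1, x2} = 2" "card {x0, x3} = 2" "{x1, x2} \<inter> {x0, x3} = {}"
    using distinct by auto
  moreover have "\<forall>x\<in>{x0, x1, x2, x3}. \<exists>\<delta>\<in>peripheralN. trace_pole Y U f x \<delta>"
    using P0(1) P1(1) P2(1) P3(1) lN_tN_peripheral(1) by blast
  moreover have "\<forall>x\<in>{x0, x1, x2, x3}. {\<zeta>. associated_root piN peripheralN Y U f x \<zeta>} = {\<i>, -\<i>}"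
    using P0(3) P1(3) P2(3) P3(3) by blast
  ultimately show ?thesis
    unfolding Let_def I t lt by blast
qed

theorem mainTheorem1:
  fixes X0 :: "(gen word set \<Rightarrow> complex) set"
    and \<rho> :: "gen word set \<Rightarrow> complex^2^2"
  assumes component: "irreducible_component (char_variety piN) X0"
    and df: "discrete_faithful piN \<rho>"
    and df_mem: "character piN \<rho> \<in> X0"
  shows "irreducible_curve (char_variety piN) X0 \<and>
    birational (sub_fspace (char_variety piN) X0) (proj_space :: (complex^2) set fspace) \<and>
    (\<forall>(Y :: (complex^'n) set set) U f. smooth_model (char_variety piN) X0 Y U f \<longrightarrow>
       (let I = ideal_points piN Y U f;
            slope = associated_slope piN peripheralN Y U f;
            root_of_unity = associated_root piN peripheralN Y U f
        in card I = 4 \<and>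
           (\<forall>x\<in>I. \<exists>\<delta>\<in>peripheralN. trace_pole Y U f x \<delta>) \<and>
           card {x \<in> I. slope x {tN, inv\<^bsub>piN\<^esub> tN}} = 2 \<and>
           card {x \<in> I. slope x {lN \<otimes>\<^bsub>piN\<^esub> tN, inv\<^bsub>piN\<^esub> (lN \<otimes>\<^bsub>piN\<^esub> tN)}} = 2 \<and>
           {x \<in> I. slope x {tN, inv\<^bsub>piN\<^esub> tN}} \<inter>
             {x \<in> I. slope x {lN \<otimes>\<^bsub>piN\<^esub> tN, inv\<^bsub>piN\<^esub> (lN \<otimes>\<^bsub>piN\<^esub> tN)}} = {} \<and>
           (\<forall>x\<in>I. {\<zeta>. root_of_unity x \<zeta>} = {\<i>, - \<i>}))) \<and>
    (\<exists>(Y :: (complex^2) set set) U f x \<zeta>.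
       smooth_model (char_variety piN) X0 Y U f \<and> x \<in> ideal_points piN Y U f \<and>
       associated_root piN peripheralN Y U f x \<zeta> \<and> \<zeta> \<noteq> 1 \<and> \<zeta> \<noteq> - 1)"
proof -
  have "\<exists>j. j ^ 2 = -1 \<and> X0 = curve j"
    using component_eq_curve[OF component df df_mem]
  proof
    assume "X0 = curve \<i>"
    then show ?thesis by (intro exI[of _ \<i>]) simp
  next
    assume "X0 = curve (-\<i>)"
    then show ?thesis by (intro exI[of _ "-\<i>"]) simp
  qed
  then obtain j where j: "j ^ 2 = -1" and X0: "X0 = curve j" by blast
  \<comment> \<open>The projective line serves as the model for the last claim; it has four ideal
    points, and at any of them \<open>\<i>\<close> is an associated root.\<close>
  let ?Y = "proj_points :: (complex^2) set set" and ?f = "\<lambda>P. chi (curve_rep j (proj_coord P))"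
  note sm = smooth_model_line[OF j]
  note ideal = ideal_points_smooth_model[OF j sm, unfolded Let_def]
  have "card (ideal_points piN ?Y affine_part ?f) = 4" using ideal by (rule conjunct1)
  then have "ideal_points piN ?Y affine_part ?f \<noteq> {}" by (metis card.empty zero_neq_numeral)
  then obtain x where x: "x \<in> ideal_points piN ?Y affine_part ?f" by (meson ex_in_conv)
  have "\<forall>x\<in>ideal_points piN ?Y affine_part ?f.
      {\<zeta>. associated_root piN peripheralN ?Y affine_part ?f x \<zeta>} = {\<i>, - \<i>}"
    using ideal by (elim conjE)
  from bspec[OF this x] have root: "associated_root piN peripheralN ?Y affine_part ?f x \<i>"
    by (metis insertI1 mem_Collect_eq)
  show ?thesis
    unfolding X0
  proof (intro conjI allI impI)
    show "irreducible_curve (char_variety piN) (curve j)" by (rule irreducible_curve_curve[OF j])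
    show "birational (sub_fspace (char_variety piN) (curve j)) (proj_space :: (complex^2) set fspace)"
      by (rule birational_curve[OF j])
    show "\<exists>(Y :: (complex^2) set set) U f x \<zeta>.
       smooth_model (char_variety piN) (curve j) Y U f \<and> x \<in> ideal_points piN Y U f \<and>
       associated_root piN peripheralN Y U f x \<zeta> \<and> \<zeta> \<noteq> 1 \<and> \<zeta> \<noteq> - 1"
      by (intro exI conjI) (rule sm, rule x, rule root, simp_all add: complex_eq_iff)
  qed (rule ideal_points_smooth_model[OF j])
qed

end
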